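(* The mapping $$f_{\mathrm U}(G)=\bigcup_{u\in V(G),\ x\in N^{\mathtt{ov}}(u)}\big\{\{u\}\cup N^{\mathtt{cd}}(u)\cup N^{\mathtt{cc}}(u)\cup\{y\in N^{\mathtt{ov}}(u)\mid x\sim_u y\}\big\}$$ is a candidate function for the class of uniform CA graphs and can be computed in logarithmic space.
   Context: Graphs are finite, undirected, without self-loops; standing assumption: twin-free (no distinct $u,v$ with $N[u]=N[v]$) and no universal vertex, where $N[v]$ is the closed neighbourhood and $N(v)$ the open one. An arc is a connected proper subset of the circle. A CA representation of $G$ is a bijection $\rho$ from $V(G)$ to a set of arcs (pairwise distinct endpoints) with $u\neq v$ adjacent iff $\rho(u)\cap\rho(v)\neq\emptyset$; $G$ is a CA graph if it has one. Intersection types of distinct arcs $A,B$: $\mathtt{di}$ disjoint; $\mathtt{cd}$ $A\subsetneq B$; $\mathtt{cs}$ $B\subsetneq A$; $\mathtt{cc}$ $A\cup B$ is the whole circle and neither contains the other; $\mathtt{ov}$ $A\cap B,A\setminus B,B\setminus A$ nonempty and $A\cup B$ not the whole circle. Sets $A,B$ overlap ($A\between B$) if $A\cap B,A\setminus B,B\setminus A\neq\emptyset$. Neighborhood matrix $\lambda_G$, for $u\neq v$ the first applicable value: $\mathtt{di}$ if nonadjacent; $\mathtt{cd}$ if $N[u]\subsetneq N[v]$; $\mathtt{cs}$ if $N[v]\subsetneq N[u]$; $\mathtt{cc}$ if $N[u]\between N[v]$, $N[u]\cup N[v]=V(G)$, all $w\in N[u]\setminus N[v]$ satisfy $N[w]\subset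 N[u]$ and all $w\in N[v]\setminus N[u]$ satisfy $N[w]\subset N[v]$; $\mathtt{ov}$ otherwise. $u\,\alpha\,v$ means $(\lambda_G)_{u,v}=\alpha$; $N^{\alpha}(u)=\{v\in N(u)\mid u\,\alpha\,v\}$. $\mathcal{N}(G)$: CA representations $\rho$ with intersection type of $\rho(u),\rho(v)$ equal to $(\lambda_G)_{u,v}$ for all $u\neq v$; $\rho[V']=\{\rho(v)\mid v\in V'\}$. An $\mathtt{ov}$-triangle is a set of three vertices pairwise in relation $\mathtt{ov}$; three pairwise intersecting arcs form a non-Helly triangle if their common intersection is empty. $N_S(S')$ (for $S'\subseteq S\subseteq V(G)$): vertices of $V(G)\setminus S$ adjacent to all of $S'$ and none of $S\setminus S'$; $N_S(x)=N_S(\{x\})$, $N_S(x,y)=N_S(\{x,y\})$. $\Delta_G$: $\mathtt{ov}$-triangles $T$ with $\bigcup_{v\in T}N[v]=V(G)$ and $v\,\mathtt{cd}\,x$ for all $x\in T$, $v\in N_T(x)$. A CA graph is uniform if for all $\mathtt{ov}$-triangles $T$ and all $\rho\in\mathcal{N}(G)$, $T\in\Delta_G$ implies $\rho[T]$ is a non-Helly triangle. For an $\mathtt{ov}$-triangle $T=\{a,b,c\}\notin\Delta_G$, $b$ is in-between $a,c$ if $N_T(a),N_T(c)\neq\emptyset$, or some $z\in N_T(a,c)$ has $\{a,c,z\}\in\Delta_G$. On $N^{\mathtt{ov}}(u)$: $x\sim_u y$ iff $x=y$, or $x\,\mathtt{cs}\,y$ or $x\,\mathtt{cd}\,y$, or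 ($x\,\mathtt{ov}\,y$, $\{x,y,u\}\notin\Delta_G$ and $u$ is not in-between $x,y$). A nonempty $X\subseteq V(G)$ is a flip set if there exist $\rho\in\mathcal{N}(G)$ and a point $p$ of the circle with $v\in X\iff p\in\rho(v)$. A function $f$ with $f(G)\subseteq\mathcal{P}(V(G))$ is label-independent if for all isomorphic $G,H$ and every isomorphism $\pi:G\to H$, $f(H)=\{\pi(X)\mid X\in f(G)\}$. $f$ is a candidate function for a class $\mathcal{C}$ of CA graphs if every $G\in\mathcal{C}$ has a flip set in $f(G)$ and $f$ is label-independent.
   Formalization: The class is restricted to uniform CA graphs in which some N^ov(u) is nonempty; without any ov-pair (e.g. two isolated vertices) the union f_U(G) is empty and contains no flip set, so the claim fails for exactly the excluded graphs. *)

theory Defs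
  imports "HOL-Analysis.Analysis" "HOL-Library.Log_Nat"
begin

section \<open>Graphs\<close>

record 'a graph =
  verts :: "'a set"
  edges :: "'a set set"

definition simple_graph :: "'a graph \<Rightarrow> bool" where
  "simple_graph G \<longleftrightarrow> finite (verts G) \<and> (\<forall>e \<in> edges G. e \<subseteq> verts G \<and> card e = 2)"

definition adj :: "'a graph \<Rightarrow> 'a \<Rightarrow> 'a \<Rightarrow> bool" where
  "adj G u v \<longleftrightarrow> {u, v} \<in> edges G \<and> u \<noteq> v"

definition nbh :: "'a graph \<Rightarrow> 'a \<Rightarrow> 'a set" where
  "nbh G v = {w \<in> verts G. adj G v w}"

definition cnbh :: "'a graph \<Rightarrow> 'a \<Rightarrow> 'a set" where
  "cnbh G v = insert v (nbh G v)"

definition twin_free :: "'a graph \<Rightarrow> bool" where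
  "twin_free G \<longleftrightarrow> (\<forall>u \<in> verts G. \<forall>v \<in> verts G. u \<noteq> v \<longrightarrow> cnbh G u \<noteq> cnbh G v)"

definition universal_vertex :: "'a graph \<Rightarrow> 'a \<Rightarrow> bool" where
  "universal_vertex G v \<longleftrightarrow> v \<in> verts G \<and> cnbh G v = verts G"

text \<open>The graphs under consideration throughout.\<close>

definition admissible :: "'a graph \<Rightarrow> bool" where
  "admissible G \<longleftrightarrow> simple_graph G \<and> twin_free G \<and> (\<nexists>v. universal_vertex G v)"

definition isomorphism :: "'a graph \<Rightarrow> 'a graph \<Rightarrow> ('a \<Rightarrow> 'a) \<Rightarrow> bool" where
  "isomorphism G H \<pi> \<longleftrightarrow> bij_betw \<pi> (verts G) (verts H) \<and>
     (\<forall>u \<in> verts G. \<forall>v \<in> verts G. adj G u v \<longleftrightarrow> adj H (\<pi> u) (\<pi> v))"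

section \<open>Arcs and circular-arc representations\<close>

abbreviation circle :: "complex set" where
  "circle \<equiv> sphere 0 1"

text \<open>Arcs may be open, closed or half-open, but are not empty.\<close>

definition arc_set :: "complex set \<Rightarrow> bool" where
  "arc_set A \<longleftrightarrow> A \<noteq> {} \<and> A \<subset> circle \<and> connected A"

definition endpoints :: "complex set \<Rightarrow> complex set" where
  "endpoints A = (top_of_set circle) frontier_of A"

definition ca_representation :: "'a graph \<Rightarrow> ('a \<Rightarrow> complex set) \<Rightarrow> bool" where
  "ca_representation G \<rho> \<longleftrightarrow>
     (\<forall>v \<in> verts G. arc_set (\<rho> v)) \<and> inj_on \<rho> (verts G) \<and>
     (\<forall>u \<in> verts G. \<forall>v \<in> verts G. u \<noteq> v \<longrightarrow>
        endpoints (\<rho> u) \<inter> endpoints (\<rho> v) = {} \<and>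
        (adj G u v \<longleftrightarrow> \<rho> u \<inter> \<rho> v \<noteq> {}))"

definition ca_graph :: "'a graph \<Rightarrow> bool" where
  "ca_graph G \<longleftrightarrow> admissible G \<and> (\<exists>\<rho>. ca_representation G \<rho>)"

datatype itype = DI | CD | CS | CC | OV

definition overlap :: "'b set \<Rightarrow> 'b set \<Rightarrow> bool" where
  "overlap A B \<longleftrightarrow> A \<inter> B \<noteq> {} \<and> A - B \<noteq> {} \<and> B - A \<noteq> {}"

fun has_itype :: "complex set \<Rightarrow> complex set \<Rightarrow> itype \<Rightarrow> bool" where
  "has_itype A B DI \<longleftrightarrow> A \<inter> B = {}"
| "has_itype A B CD \<longleftrightarrow> A \<subset> B"
| "has_itype A B CS \<longleftrightarrow> B \<subset> A"
| "has_itype A B CC \<longleftrightarrow> A \<union> B = circle \<and> \<not> A \<subseteq> B \<and> \<not> B \<subseteq> A"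
| "has_itype A B OV \<longleftrightarrow> overlap A B \<and> A \<union> B \<noteq> circle"

definition nonhelly_triangle :: "complex set set \<Rightarrow> bool" where
  "nonhelly_triangle \<A> \<longleftrightarrow>
     card \<A> = 3 \<and> (\<forall>A \<in> \<A>. \<forall>B \<in> \<A>. A \<inter> B \<noteq> {}) \<and> \<Inter>\<A> = {}"

section \<open>Neighbourhood matrix and normalized representations\<close>

text \<open>Only the entries with \<^term>\<open>u \<noteq> v\<close> are meaningful; the diagonal evaluates to \<^term>\<open>DI\<close>.\<close>

definition nmat :: "'a graph \<Rightarrow> 'a \<Rightarrow> 'a \<Rightarrow> itype" where
  "nmat G u v =
    (if \<not> adj G u v then DI
     else if cnbh G u \<subset> cnbh G v then CD
     else if cnbh G v \<subset> cnbh G u then CS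
     else if overlap (cnbh G u) (cnbh G v) \<and> cnbh G u \<union> cnbh G v = verts G \<and>
        (\<forall>w \<in> cnbh G u - cnbh G v. cnbh G w \<subset> cnbh G u) \<and>
        (\<forall>w \<in> cnbh G v - cnbh G u. cnbh G w \<subset> cnbh G v) then CC
     else OV)"

definition nbh_type :: "'a graph \<Rightarrow> itype \<Rightarrow> 'a \<Rightarrow> 'a set" where
  "nbh_type G \<alpha> u = {v \<in> nbh G u. nmat G u v = \<alpha>}"

definition normalized_reps :: "'a graph \<Rightarrow> ('a \<Rightarrow> complex set) set" where
  "normalized_reps G = {\<rho>. ca_representation G \<rho> \<and>
     (\<forall>u \<in> verts G. \<forall>v \<in> verts G. u \<noteq> v \<longrightarrow> has_itype (\<rho> u) (\<rho> v) (nmat G u v))}"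

section \<open>Uniform circular-arc graphs\<close>

definition ov_triangle :: "'a graph \<Rightarrow> 'a set \<Rightarrow> bool" where
  "ov_triangle G T \<longleftrightarrow> T \<subseteq> verts G \<and> card T = 3 \<and>
     (\<forall>u \<in> T. \<forall>v \<in> T. u \<noteq> v \<longrightarrow> nmat G u v = OV)"

definition excl_nbh :: "'a graph \<Rightarrow> 'a set \<Rightarrow> 'a set \<Rightarrow> 'a set" where
  "excl_nbh G S S' =
     {v \<in> verts G - S. (\<forall>x \<in> S'. adj G v x) \<and> (\<forall>x \<in> S - S'. \<not> adj G v x)}"

definition Delta :: "'a graph \<Rightarrow> 'a set set" where
  "Delta G = {T. ov_triangle G T \<and> (\<Union>v \<in> T. cnbh G v) = verts G \<and>
     (\<forall>x \<in> T. \<forall>v \<in> excl_nbh G T {x}. nmat G v x = CD)}"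

definition uniform_ca_graph :: "'a graph \<Rightarrow> bool" where
  "uniform_ca_graph G \<longleftrightarrow> ca_graph G \<and>
     (\<forall>T \<rho>. ov_triangle G T \<longrightarrow> \<rho> \<in> normalized_reps G \<longrightarrow>
        T \<in> Delta G \<longrightarrow> nonhelly_triangle (\<rho> ` T))"

section \<open>Flip sets and candidate functions\<close>

definition flip_set :: "'a graph \<Rightarrow> 'a set \<Rightarrow> bool" where
  "flip_set G X \<longleftrightarrow> X \<noteq> {} \<and> X \<subseteq> verts G \<and>
     (\<exists>\<rho> \<in> normalized_reps G. \<exists>p \<in> circle. \<forall>v \<in> verts G. v \<in> X \<longleftrightarrow> p \<in> \<rho> v)"

definition label_independent :: "('a graph \<Rightarrow> 'a set set) \<Rightarrow> bool" where
  "label_independent f \<longleftrightarrow>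
     (\<forall>G H \<pi>. admissible G \<longrightarrow> admissible H \<longrightarrow> isomorphism G H \<pi> \<longrightarrow>
        f H = {\<pi> ` X | X. X \<in> f G})"

definition candidate_function :: "('a graph \<Rightarrow> 'a set set) \<Rightarrow> 'a graph set \<Rightarrow> bool" where
  "candidate_function f \<C> \<longleftrightarrow>
     (\<forall>G. admissible G \<longrightarrow> f G \<subseteq> Pow (verts G)) \<and>
     (\<forall>G \<in> \<C>. \<exists>X \<in> f G. flip_set G X) \<and> label_independent f"

section \<open>The mapping\<close>

text \<open>\<open>in_between G b a c\<close>: the vertex \<open>b\<close> lies in-between \<open>a\<close> and \<open>c\<close>.\<close>

definition in_between :: "'a graph \<Rightarrow> 'a \<Rightarrow> 'a \<Rightarrow> 'a \<Rightarrow> bool" where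
  "in_between G b a c \<longleftrightarrow> ov_triangle G {a, b, c} \<and> {a, b, c} \<notin> Delta G \<and>
     (excl_nbh G {a, b, c} {a} \<noteq> {} \<and> excl_nbh G {a, b, c} {c} \<noteq> {} \<or>
      (\<exists>z \<in> excl_nbh G {a, b, c} {a, c}. {a, c, z} \<in> Delta G))"

definition same_side :: "'a graph \<Rightarrow> 'a \<Rightarrow> 'a \<Rightarrow> 'a \<Rightarrow> bool" where
  "same_side G u x y \<longleftrightarrow> x \<in> nbh_type G OV u \<and> y \<in> nbh_type G OV u \<and>
     (x = y \<or> nmat G x y = CS \<or> nmat G x y = CD \<or>
      nmat G x y = OV \<and> {x, y, u} \<notin> Delta G \<and> \<not> in_between G u x y)"

definition f_U :: "'a graph \<Rightarrow> 'a set set" where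
  "f_U G = (\<Union>u \<in> verts G. \<Union>x \<in> nbh_type G OV u.
     {{u} \<union> nbh_type G CD u \<union> nbh_type G CC u \<union> {y \<in> nbh_type G OV u. same_side G u x y}})"

text \<open>
  The family is empty if no two vertices are in relation \<^term>\<open>OV\<close>, so that such a graph
  (for example two isolated vertices) has no flip set in it.
\<close>

lemma f_U_eq_empty_iff: "f_U G = {} \<longleftrightarrow> (\<forall>u \<in> verts G. nbh_type G OV u = {})"
  by (auto simp: f_U_def)

section \<open>Logarithmic-space computation\<close>

text \<open>
  Deterministic Turing machines with a two-way read-only input tape between end markers,
  finitely many one-way infinite work tapes and a write-only output tape. States and work
  symbols are natural numbers drawn from finite sets, and \<open>0\<close> is the blank. A machine halts
  when its transition function yields \<^term>\<open>None\<close>. A transition gives the new state, the move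
  of the input head, a written symbol and a head move for each work tape, and at most one
  output symbol.
\<close>

datatype symbol = Zero | One | Sep

datatype cell = LeftEnd | Letter symbol | RightEnd

datatype direction = GoLeft | Stay | GoRight

record machine =
  num_tapes :: nat
  states :: "nat set"
  work_symbols :: "nat set"
  init_state :: nat
  transition :: "nat \<Rightarrow> cell \<Rightarrow> nat list \<Rightarrow>
    (nat \<times> direction \<times> (nat \<times> direction) list \<times> symbol option) option"

definition wf_machine :: "machine \<Rightarrow> bool" where
  "wf_machine M \<longleftrightarrow>
     finite (states M) \<and> init_state M \<in> states M \<and>
     finite (work_symbols M) \<and> 0 \<in> work_symbols M \<and>
     (\<forall>q c ss q' d acts out.
        q \<in> states M \<longrightarrow> length ss = num_tapes M \<longrightarrow> set ss \<subseteq> work_symbols M \<longrightarrow>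
        transition M q c ss = Some (q', d, acts, out) \<longrightarrow>
        q' \<in> states M \<and> length acts = num_tapes M \<and> fst ` set acts \<subseteq> work_symbols M)"

text \<open>State, input head position, head position and contents of every work tape, output so far.\<close>

type_synonym config = "nat \<times> nat \<times> (nat \<times> (nat \<Rightarrow> nat)) list \<times> symbol list"

definition input_cell :: "symbol list \<Rightarrow> nat \<Rightarrow> cell" where
  "input_cell w i =
     (if i = 0 then LeftEnd else if i \<le> length w then Letter (w ! (i - 1)) else RightEnd)"

fun move_head :: "direction \<Rightarrow> nat \<Rightarrow> nat" where
  "move_head GoLeft i = i - 1"
| "move_head Stay i = i"
| "move_head GoRight i = Suc i"

definition init_config :: "machine \<Rightarrow> config" where
  "init_config M = (init_state M, 0, replicate (num_tapes M) (0, \<lambda>_. 0), [])"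

fun step :: "machine \<Rightarrow> symbol list \<Rightarrow> config \<Rightarrow> config option" where
  "step M w (q, i, tps, out) =
     (case transition M q (input_cell w i) (map (\<lambda>(h, t). t h) tps) of
        None \<Rightarrow> None
      | Some (q', d, acts, new) \<Rightarrow>
          Some (q', min (Suc (length w)) (move_head d i),
            map2 (\<lambda>(h, t) (s, e). (move_head e h, t(h := s))) tps acts,
            out @ (case new of None \<Rightarrow> [] | Some s \<Rightarrow> [s])))"

definition reachable :: "machine \<Rightarrow> symbol list \<Rightarrow> config \<Rightarrow> bool" where
  "reachable M w c \<longleftrightarrow> (\<lambda>c1 c2. step M w c1 = Some c2)\<^sup>*\<^sup>* (init_config M) c"

definition halts_with :: "machine \<Rightarrow> symbol list \<Rightarrow> symbol list \<Rightarrow> bool" where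
  "halts_with M w out \<longleftrightarrow>
     (\<exists>q i tps. reachable M w (q, i, tps, out) \<and> step M w (q, i, tps, out) = None)"

definition within_space :: "machine \<Rightarrow> symbol list \<Rightarrow> nat \<Rightarrow> bool" where
  "within_space M w s \<longleftrightarrow>
     (\<forall>q i tps out. reachable M w (q, i, tps, out) \<longrightarrow> (\<forall>(h, t) \<in> set tps. h < s))"

text \<open>
  \<open>logspace_computable D enc spec\<close>: one machine maps the code \<^term>\<open>enc x\<close> of every instance
  \<^term>\<open>x \<in> D\<close> to a word that represents the result for \<^term>\<open>x\<close> according to \<^term>\<open>spec x\<close>.
  The number \<^term>\<open>floorlog 2 n\<close> is the length of the binary representation of \<^term>\<open>n\<close>.
\<close>

definition logspace_computable ::
  "'x set \<Rightarrow> ('x \<Rightarrow> symbol list) \<Rightarrow> ('x \<Rightarrow> symbol list \<Rightarrow> bool) \<Rightarrow> bool" where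
  "logspace_computable D enc spec \<longleftrightarrow>
     (\<exists>M c. wf_machine M \<and>
        (\<forall>x \<in> D. within_space M (enc x) (c * Suc (floorlog 2 (length (enc x)))) \<and>
           (\<exists>out. halts_with M (enc x) out \<and> spec x out)))"

text \<open>A list of subsets of \<open>{0..<n}\<close> as characteristic vectors, each followed by a separator.\<close>

definition enc_sets :: "nat \<Rightarrow> nat set list \<Rightarrow> symbol list" where
  "enc_sets n Xs =
     concat (map (\<lambda>X. map (\<lambda>v. if v \<in> X then One else Zero) [0..<n] @ [Sep]) Xs)"

text \<open>The adjacency matrix, row by row, of a graph with vertex set \<open>{0..<n}\<close>.\<close>

definition enc_graph :: "nat graph \<Rightarrow> symbol list" where
  "enc_graph G = (let n = card (verts G) in enc_sets n (map (nbh G) [0..<n]))"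

text \<open>The family is output as a list in an arbitrary order, possibly with repetitions.\<close>

definition logspace_computable_family :: "(nat graph \<Rightarrow> nat set set) \<Rightarrow> bool" where
  "logspace_computable_family f \<longleftrightarrow>
     logspace_computable {G. admissible G \<and> (\<exists>n. verts G = {0..<n})} enc_graph
       (\<lambda>G out. \<exists>Xs. set Xs = f G \<and> out = enc_sets (card (verts G)) Xs)"

end

(* Normalized representations exist. The union of the closed arcs of all vertices whose neighbourhood
   lies in N[v] is an arc that meets the same arcs as that of v, so containment of neighbourhoods can
   be turned into containment of arcs; next, the gap left by a pair of type CC is added to the arc of
   the vertex with the larger neighbourhood. Both changes may create common endpoints. These are
   removed by thickening the arc of v by a small amount that grows with the size of N[v]; each bad
   coincidence excludes only finitely many amounts.

   Flip sets. Let u be a vertex with arc A, and let a and b be the endpoints of A. A neighbour of type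
   OV contains exactly one of them. Since the complement of an arc is connected, two such arcs X, Y
   that contain a have X - A inside Y or Y - A inside X, which rules out that u is in-between; if X
   contains a, Y contains b, and X, Y, A have a common point, then X Int Y lies inside A, and every
   vertex outside N[u] that is adjacent to both yields a triangle of Delta. Hence the relation
   defining f_U groups the OV-neighbours by endpoint, and a point of A next to a realizes the set
   belonging to a.

   Logarithmic space. Membership in the sets of f_U is a first-order property of the graph. A formula is
   evaluated by a machine with a fixed number of binary counters below a power of two exceeding the
   number of vertices. *)

theory Submission
  imports Defs "HOL-Library.Nat_Bijection"
begin

section \<open>Connected subsets of the circle\<close>

text \<open>Arcs may be open, closed or half-open, and endpoints are frontier points relative to the
  circle, so no cyclic order of endpoints is used. Every geometric claim is reduced to
  connectedness: complements of arcs are connected, and two arcs without a common endpoint cannot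
  split a connected set between them. The second fact rests on the distinct endpoints.

  Enlarging arcs puts two things at risk: non-adjacent vertices must stay apart, and containments
  already achieved must survive. Hence every enlargement is also given to all vertices with a larger
  neighbourhood, and the final thickening grows with the size of N[v], since a strict containment of
  N[u] in N[v] makes the amount for u strictly smaller.

  Uniformity supplies a single implication, from Delta to non-Helly triangles. Its converse for
  ov-triangles holds in every normalized representation, so in a uniform graph the combinatorial
  relation can be read off any one of them.

  Work tape cells hold sets, so that all counters run in parallel tracks over one marked stretch of
  cells; its length is found while the vertices are counted.\<close>

lemma circle_eq_cis_image: "circle = (\<lambda>t. cis (\<theta> + t)) ` {0..2 * pi}"
proof -
  have "p \<in> (\<lambda>t. cis (\<theta> + t)) ` {0..2 * pi}" if "p \<in> circle" for p
  proof -
    let ?z = "p / cis \<theta>"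
    have "norm ?z = 1" using that by (simp add: norm_divide)
    then have "?z = cis (Arg2pi ?z)" using Arg2pi_eq[of ?z] by (simp add: cis_conv_exp)
    then have "p = cis (\<theta> + Arg2pi ?z)" by (simp add: cis_mult[symmetric] field_simps)
    moreover have "Arg2pi ?z \<in> {0..2 * pi}" using Arg2pi[of ?z] by auto
    ultimately show ?thesis by blast
  qed
  then show ?thesis by auto
qed

lemma connected_circle: "connected circle"
  by (subst circle_eq_cis_image[of 0]) (auto intro!: connected_continuous_image continuous_intros)

text \<open>The base point has the two parameters 0 and 2 pi. Both are kept, so that parameter
  intervals stay compact and their images closed.\<close>

lemma cis_eq_cases:
  assumes "cis (\<theta> + x) = cis (\<theta> + y)" "x \<in> {0..2 * pi}" "y \<in> {0..2 * pi}"
  shows "x = y \<or> (x = 2 * pi \<and> y = 0) \<or> (x = 0 \<and> y = 2 * pi)"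
proof -
  have "cis x = cis y" using assms(1) by (simp add: cis_mult[symmetric])
  then have "sin x = sin y \<and> cos x = cos y" by (simp add: complex_eq_iff)
  then obtain n :: int where n: "x = y + 2 * pi * n"
    using sin_cos_eq_iff by blast
  have "\<bar>2 * pi * n\<bar> \<le> 2 * pi" using n assms by auto
  then have "\<bar>real_of_int n\<bar> \<le> 1" by (simp add: abs_mult)
  then have "n = 0 \<or> n = 1 \<or> n = -1" by linarith
  then show ?thesis using n assms by auto
qed

lemma cis_arcs_Int:
  assumes "0 \<le> s" "s \<le> t" "t \<le> 2 * pi"
  shows "(\<lambda>t. cis (\<theta> + t)) ` {s..t} \<inter> (\<lambda>t. cis (\<theta> + t)) ` ({0..s} \<union> {t..2 * pi})
           \<subseteq> {cis (\<theta> + s), cis (\<theta> + t)}"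
proof
  fix p assume "p \<in> (\<lambda>t. cis (\<theta> + t)) ` {s..t} \<inter> (\<lambda>t. cis (\<theta> + t)) ` ({0..s} \<union> {t..2 * pi})"
  then obtain x y where xy: "p = cis (\<theta> + x)" "p = cis (\<theta> + y)" "x \<in> {s..t}"
    "y \<in> {0..s} \<union> {t..2 * pi}" by blast
  then have "x = y \<or> (x = 2 * pi \<and> y = 0) \<or> (x = 0 \<and> y = 2 * pi)"
    using cis_eq_cases[of \<theta> x y] assms by auto
  then consider "x = s" | "x = t" using xy assms by force
  then show "p \<in> {cis (\<theta> + s), cis (\<theta> + t)}" using xy by cases auto
qed

lemma closed_cis_image: "compact K \<Longrightarrow> closed ((\<lambda>t. cis (\<theta> + t)) ` K)"
  by (intro compact_imp_closed compact_continuous_image continuous_intros)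

text \<open>The circle is cut at a point outside S. If a parameter between two parameters of S were
  missing, the closed arcs on both sides of it would separate S, since they meet only at the missing
  point and at the cut.\<close>

lemma connected_circle_interval:
  assumes S: "connected S" "S \<subseteq> circle" and q: "cis \<theta> \<notin> S"
  defines "I \<equiv> {t \<in> {0..2 * pi}. cis (\<theta> + t) \<in> S}"
  shows "is_interval I" "S = (\<lambda>t. cis (\<theta> + t)) ` I"
proof -
  have param: "\<exists>t\<in>{0..2 * pi}. p = cis (\<theta> + t)" if "p \<in> circle" for p
    using that by (subst (asm) circle_eq_cis_image[of \<theta>]) blast
  show "S = (\<lambda>t. cis (\<theta> + t)) ` I"
    using S(2) param unfolding I_def by blast
  show "is_interval I"
    unfolding is_interval_1
  proof (intro ballI allI impI, rule ccontr)
    fix s t x assume st: "s \<in> I" "t \<in> I" "s \<le> x \<and> x \<le> t" and x: "x \<notin> I"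
    let ?K1 = "(\<lambda>t. cis (\<theta> + t)) ` {0..x}" and ?K2 = "(\<lambda>t. cis (\<theta> + t)) ` {x..2 * pi}"
    have bd: "0 \<le> s" "t \<le> 2 * pi" using st unfolding I_def by auto
    have "closed ?K1" "closed ?K2" by (simp_all add: closed_cis_image)
    moreover have "S \<subseteq> ?K1 \<union> ?K2"
    proof
      fix p assume "p \<in> S"
      then obtain t where "t \<in> {0..2 * pi}" "p = cis (\<theta> + t)" using S(2) param by blast
      then show "p \<in> ?K1 \<union> ?K2" by (cases "t \<le> x") auto
    qed
    moreover have "?K1 \<inter> ?K2 \<inter> S = {}"
    proof -
      have "?K1 \<inter> ?K2 \<subseteq> {cis (\<theta> + 0), cis (\<theta> + x)}"
        using cis_arcs_Int[of 0 x \<theta>] bd st by (fastforce simp: image_Un)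
      moreover have "cis (\<theta> + x) \<notin> S" using x bd st unfolding I_def by auto
      ultimately show ?thesis using q by auto
    qed
    moreover have "cis (\<theta> + s) \<in> ?K1 \<inter> S" "cis (\<theta> + t) \<in> ?K2 \<inter> S"
      using st bd unfolding I_def by auto
    ultimately show False using connected_closedD[OF S(1), of ?K1 ?K2] by blast
  qed
qed

text \<open>After a cut outside S, the complement consists of the parameters to the left and to the
  right of an interval. Both parts are intervals, and they are glued at the cut, which has the
  parameters 0 and 2 pi.\<close>

lemma connected_circle_Diff:
  assumes S: "connected S" "S \<subseteq> circle"
  shows "connected (circle - S)"
proof (cases "S = {} \<or> S = circle")
  case True
  then show ?thesis using connected_circle by auto
next
  case False
  then obtain q where "q \<in> circle" "q \<notin> S" using S by blast
  then obtain \<theta> where q: "cis \<theta> \<notin> S" using circle_eq_cis_image[of 0] by force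
  define I where "I = {t \<in> {0..2 * pi}. cis (\<theta> + t) \<in> S}"
  have I: "is_interval I" "S = (\<lambda>t. cis (\<theta> + t)) ` I"
    using connected_circle_interval[OF S q] unfolding I_def by auto
  define L where "L = {t \<in> {0..2 * pi}. \<forall>i\<in>I. t < i}"
  define R where "R = {t \<in> {0..2 * pi}. \<forall>i\<in>I. i < t}"
  have LR: "{0..2 * pi} - I = L \<union> R"
  proof -
    have "t \<in> I" if "t \<in> {0..2 * pi}" "t \<notin> L" "t \<notin> R" for t
    proof -
      obtain i j where "i \<in> I" "j \<in> I" "i \<le> t" "t \<le> j"
        using \<open>t \<in> {0..2 * pi}\<close> \<open>t \<notin> L\<close> \<open>t \<notin> R\<close> unfolding L_def R_def by (auto simp: not_less)
      then show ?thesis using I(1) unfolding is_interval_1 by blast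
    qed
    moreover have "L \<inter> I = {}" "R \<inter> I = {}" unfolding L_def R_def by blast+
    ultimately show ?thesis unfolding L_def R_def by blast
  qed
  have "0 \<notin> I" "2 * pi \<notin> I" using q unfolding I_def by (auto simp: cis_mult[symmetric])
  then have 0: "0 \<in> L" "2 * pi \<in> R"
    unfolding L_def R_def I_def by (auto simp: less_le)
  have "is_interval L" "is_interval R"
    unfolding is_interval_1 L_def R_def by (auto; force)+
  then have "connected ((\<lambda>t. cis (\<theta> + t)) ` L)" "connected ((\<lambda>t. cis (\<theta> + t)) ` R)"
    by (auto intro!: connected_continuous_image continuous_intros simp: is_interval_connected_1)
  moreover have "cis \<theta> \<in> (\<lambda>t. cis (\<theta> + t)) ` L" "cis \<theta> \<in> (\<lambda>t. cis (\<theta> + t)) ` R"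
    using 0 by (auto simp: image_iff cis_mult[symmetric] intro!: bexI)
  ultimately have "connected ((\<lambda>t. cis (\<theta> + t)) ` L \<union> (\<lambda>t. cis (\<theta> + t)) ` R)"
    by (intro connected_Un) auto
  also have "(\<lambda>t. cis (\<theta> + t)) ` L \<union> (\<lambda>t. cis (\<theta> + t)) ` R = circle - S"
  proof -
    have "(\<lambda>t. cis (\<theta> + t)) ` ({0..2 * pi} - I) = circle - S"
      using circle_eq_cis_image[of \<theta>] unfolding I_def by auto
    then show ?thesis unfolding LR image_Un .
  qed
  finally show ?thesis .
qed

text \<open>The circle is closed, so closures relative to it are ordinary closures.\<close>

lemma endpoints_eq:
  assumes "A \<subseteq> circle"
  shows "endpoints A = closure A \<inter> closure (circle - A)"
proof -
  have sub: "top_of_set circle closure_of B = closure B" if "B \<subseteq> circle" for B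
  proof -
    have "closure B \<subseteq> circle" using that closed_sphere by (rule closure_minimal)
    then have "circle \<inter> closure B = closure B" by (rule Int_absorb1)
    moreover have "circle \<inter> B = B" using that by (rule Int_absorb1)
    ultimately show ?thesis by (simp only: closure_of_subtopology euclidean_closure_of)
  qed
  show ?thesis
    unfolding endpoints_def frontier_of_closures topspace_euclidean_subtopology sub[OF assms]
      sub[OF Diff_subset] ..
qed

text \<open>Let l and r be the infimum and the supremum of the parameters of A. The closures of A
  and of its complement lie in the two closed arcs cut out by l and r, which share only the points
  at l and r.\<close>

lemma endpoints_card2:
  assumes A: "connected A" "A \<subset> circle"
  obtains a b where "endpoints A \<subseteq> {a, b}"
proof (cases "A = {}")
  case True
  then show ?thesis using that by (simp add: endpoints_eq)
next
  case False
  obtain q where "q \<in> circle" "q \<notin> A" using A by blast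
  then obtain \<theta> where q: "cis \<theta> \<notin> A" using circle_eq_cis_image[of 0] by force
  define I where "I = {t \<in> {0..2 * pi}. cis (\<theta> + t) \<in> A}"
  have I: "is_interval I" "A = (\<lambda>t. cis (\<theta> + t)) ` I"
    using connected_circle_interval[of A \<theta>] A q unfolding I_def by auto
  have ne: "I \<noteq> {}" using False I(2) by auto
  have bd: "bdd_above I" "bdd_below I"
    unfolding I_def by (auto intro!: bdd_aboveI bdd_belowI)
  define l r where "l = Inf I" and "r = Sup I"
  have lr: "0 \<le> l" "l \<le> r" "r \<le> 2 * pi"
    unfolding l_def r_def using ne bd
    by (auto intro!: cInf_greatest cSup_least cInf_le_cSup simp: I_def)
  have sub: "I \<subseteq> {l..r}"
    unfolding l_def r_def using bd by (auto intro: cInf_lower cSup_upper)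
  have sub': "{0..2 * pi} - I \<subseteq> {0..l} \<union> {r..2 * pi}"
  proof
    fix t assume t: "t \<in> {0..2 * pi} - I"
    show "t \<in> {0..l} \<union> {r..2 * pi}"
    proof (rule ccontr)
      assume "t \<notin> {0..l} \<union> {r..2 * pi}"
      then have "l < t" "t < r" using t by auto
      then obtain i j where "i \<in> I" "i < t" "j \<in> I" "t < j"
        unfolding l_def r_def using ne bd by (metis cInf_lessD less_cSupD)
      then have "t \<in> I" using I(1) unfolding is_interval_1 by (meson less_imp_le)
      then show False using t by auto
    qed
  qed
  have "closure A \<subseteq> (\<lambda>t. cis (\<theta> + t)) ` {l..r}"
    using sub I(2) by (intro closure_minimal closed_cis_image) auto
  moreover have "closure (circle - A) \<subseteq> (\<lambda>t. cis (\<theta> + t)) ` ({0..l} \<union> {r..2 * pi})"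
  proof (intro closure_minimal closed_cis_image)
    have "circle - A = (\<lambda>t. cis (\<theta> + t)) ` ({0..2 * pi} - I)"
      using circle_eq_cis_image[of \<theta>] unfolding I_def by auto
    then show "circle - A \<subseteq> (\<lambda>t. cis (\<theta> + t)) ` ({0..l} \<union> {r..2 * pi})" using sub' by auto
  qed (auto intro: compact_Un)
  ultimately have "endpoints A \<subseteq> {cis (\<theta> + l), cis (\<theta> + r)}"
    using cis_arcs_Int[OF lr, of \<theta>] A by (subst endpoints_eq) auto
  then show ?thesis using that by blast
qed

text \<open>Otherwise the closures of A and of its complement, which together cover M, would
  separate M.\<close>

lemma connected_meets_endpoints:
  assumes "connected M" "M \<subseteq> circle" "A \<subseteq> circle" "M \<inter> A \<noteq> {}" "M - A \<noteq> {}"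
  shows "M \<inter> endpoints A \<noteq> {}"
proof (rule notI)
  assume "M \<inter> endpoints A = {}"
  then have 1: "closure A \<inter> closure (circle - A) \<inter> M = {}"
    unfolding endpoints_eq[OF assms(3)] by (simp only: Int_commute)
  have 2: "M \<subseteq> closure A \<union> closure (circle - A)"
  proof
    fix p assume "p \<in> M"
    then have "p \<in> A \<or> p \<in> circle - A" using assms(2) by blast
    then show "p \<in> closure A \<union> closure (circle - A)"
      using closure_subset[of A] closure_subset[of "circle - A"] by (elim disjE) (rule UnI1 UnI2; erule subsetD; assumption)+
  qed
  have 3: "closure A \<inter> M \<noteq> {}"
    using assms(4) closure_subset[of A] by blast
  have 4: "closure (circle - A) \<inter> M \<noteq> {}"
  proof -
    obtain p where "p \<in> M" "p \<notin> A" using assms(5) by blast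
    then have "p \<in> circle - A" using assms(2) by (intro DiffI) (erule subsetD)
    then have "p \<in> closure (circle - A)" by (rule subsetD[OF closure_subset])
    then show ?thesis using \<open>p \<in> M\<close> by (metis IntI empty_iff)
  qed
  show False
    using connected_closedD[OF assms(1) 1 2 closed_closure closed_closure] 3 4 by metis
qed

lemma endpoints_nonempty:
  assumes "A \<noteq> {}" "A \<subset> circle"
  shows "endpoints A \<noteq> {}"
  using connected_meets_endpoints[OF connected_circle, of A] assms by auto

text \<open>The two pieces of M would have to touch. A point of one piece that is a limit of the
  other is a limit of both X and its complement, and likewise for Y, hence a common
  endpoint.\<close>

lemma connected_not_split:
  assumes M: "connected M" "M \<subseteq> X \<union> Y" "M \<inter> X \<inter> Y = {}"
    and XY: "X \<subseteq> circle" "Y \<subseteq> circle" "endpoints X \<inter> endpoints Y = {}"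
  shows "M \<inter> X = {} \<or> M \<inter> Y = {}"
proof (rule ccontr)
  assume ne: "\<not> ?thesis"
  have sep: "p \<notin> closure (M \<inter> Y)" if "p \<in> M \<inter> X" "X \<subseteq> circle" "Y \<subseteq> circle" 
    "M \<inter> X \<inter> Y = {}" "endpoints X \<inter> endpoints Y = {}" for p X Y
  proof
    assume p: "p \<in> closure (M \<inter> Y)"
    have "p \<in> closure Y" using p by (meson closure_mono inf_le2 subsetD)
    moreover have "p \<in> closure (circle - Y)" using that closure_subset by blast
    ultimately have "p \<in> endpoints Y" using that by (simp add: endpoints_eq)
    moreover have "M \<inter> Y \<subseteq> circle - X" using that by auto
    then have "p \<in> closure (circle - X)" using p closure_mono by blast
    then have "p \<in> endpoints X" using that closure_subset[of X] by (auto simp: endpoints_eq)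
    ultimately show False using that by auto
  qed
  have "closure (M \<inter> X) \<inter> closure (M \<inter> Y) \<inter> M = {}"
    using sep[of _ X Y] sep[of _ Y X] M XY by blast
  moreover have "M \<subseteq> closure (M \<inter> X) \<union> closure (M \<inter> Y)"
    using M(2) closure_subset[of "M \<inter> X"] closure_subset[of "M \<inter> Y"] by blast
  moreover have "closure (M \<inter> X) \<inter> M \<noteq> {}" "closure (M \<inter> Y) \<inter> M \<noteq> {}"
    using ne closure_subset[of "M \<inter> X"] closure_subset[of "M \<inter> Y"] by blast+
  ultimately show False
    using M(1) connected_closedD[OF _ _ _ closed_closure closed_closure] by blast
qed

text \<open>Passing to complements turns the intersection into a union of two connected sets that
  share a point outside X and Y.\<close>

lemma connected_circle_Int:
  assumes "connected X" "connected Y" "X \<subseteq> circle" "Y \<subseteq> circle" "X \<union> Y \<noteq> circle"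
  shows "connected (X \<inter> Y)"
proof -
  have "connected ((circle - X) \<union> (circle - Y))"
    using assms by (intro connected_Un connected_circle_Diff) auto
  then have "connected (circle - ((circle - X) \<union> (circle - Y)))"
    by (intro connected_circle_Diff) auto
  also have "circle - ((circle - X) \<union> (circle - Y)) = X \<inter> Y" using assms by auto
  finally show ?thesis .
qed

lemma connected_Un_Union:
  assumes A: "connected A" "A \<noteq> {}" and F: "\<And>B. B \<in> F \<Longrightarrow> connected B \<and> A \<inter> B \<noteq> {}"
  shows "connected (A \<union> \<Union>F)"
proof -
  have "connected (\<Union>(insert A ((\<lambda>B. A \<union> B) ` F)))"
  proof (rule connected_Union)
    show "connected s" if "s \<in> insert A ((\<lambda>B. A \<union> B) ` F)" for s
      using that A(1) F by (auto intro: connected_Un)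
    show "\<Inter>(insert A ((\<lambda>B. A \<union> B) ` F)) \<noteq> {}" using A(2) by auto
  qed
  also have "\<Union>(insert A ((\<lambda>B. A \<union> B) ` F)) = A \<union> \<Union>F" by auto
  finally show ?thesis .
qed

section \<open>Representations by thickened arcs\<close>

text \<open>The union of the rotations of S by angles of size at most \<epsilon>, written as an
  image of a product so that connectedness and compactness are inherited at once.\<close>

definition thicken :: "real \<Rightarrow> complex set \<Rightarrow> complex set" where
  "thicken \<epsilon> S = (\<lambda>(s, t). s * cis t) ` (S \<times> {-\<epsilon>..\<epsilon>})"

lemma thicken_iff: "p \<in> thicken \<epsilon> S \<longleftrightarrow> (\<exists>s\<in>S. \<exists>t. \<bar>t\<bar> \<le> \<epsilon> \<and> p = s * cis t)"
proof
  assume "p \<in> thicken \<epsilon> S"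
  then obtain s t where "s \<in> S" "t \<in> {-\<epsilon>..\<epsilon>}" "p = s * cis t"
    unfolding thicken_def by auto
  then show "\<exists>s\<in>S. \<exists>t. \<bar>t\<bar> \<le> \<epsilon> \<and> p = s * cis t"
    by (intro bexI[of _ s] exI[of _ t]) auto
next
  assume "\<exists>s\<in>S. \<exists>t. \<bar>t\<bar> \<le> \<epsilon> \<and> p = s * cis t"
  then obtain s t where "s \<in> S" "\<bar>t\<bar> \<le> \<epsilon>" "p = s * cis t" by blast
  then show "p \<in> thicken \<epsilon> S"
    unfolding thicken_def by (intro image_eqI[of _ _ "(s, t)"]) auto
qed

lemma thicken_subset_circle: "S \<subseteq> circle \<Longrightarrow> thicken \<epsilon> S \<subseteq> circle"
  by (auto simp: thicken_iff norm_mult subset_iff)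

lemma subset_thicken: "0 \<le> \<epsilon> \<Longrightarrow> S \<subseteq> thicken \<epsilon> S"
  unfolding thicken_iff subset_iff by (metis abs_zero cis_zero mult.right_neutral)

lemma thicken_mono: "\<epsilon> \<le> \<delta> \<Longrightarrow> S \<subseteq> T \<Longrightarrow> thicken \<epsilon> S \<subseteq> thicken \<delta> T"
  unfolding thicken_def by (intro image_mono Sigma_mono) auto

lemma continuous_on_thicken: "continuous_on X (\<lambda>(s, t). s * cis t)"
  by (auto simp: case_prod_unfold intro!: continuous_intros)

lemma connected_thicken: "connected S \<Longrightarrow> connected (thicken \<epsilon> S)"
  unfolding thicken_def by (intro connected_continuous_image continuous_on_thicken connected_Times) auto

lemma compact_thicken: "compact S \<Longrightarrow> compact (thicken \<epsilon> S)"
  unfolding thicken_def by (intro compact_continuous_image continuous_on_thicken compact_Times) auto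

lemma dist_mult_cis_le:
  assumes "norm s = 1"
  shows "dist (s * cis t) s \<le> \<bar>t\<bar>"
proof -
  have "dist (s * cis t) s = norm (s * (cis t - 1))" by (simp add: dist_norm algebra_simps)
  also have "\<dots> = 2 * \<bar>sin (t / 2)\<bar>"
    using dist_exp_i_1[of t] assms by (simp add: norm_mult cis_conv_exp)
  also have "\<dots> \<le> \<bar>t\<bar>" using abs_sin_x_le_abs_x[of "t / 2"] by simp
  finally show ?thesis .
qed

text \<open>Continuity of \<open>Arg\<close> at 1, applied to the quotient q / p.\<close>

lemma circle_near_imp_cis:
  assumes "norm p = 1" "e > 0"
  obtains r where "r > 0" "\<And>q. norm q = 1 \<Longrightarrow> dist q p < r \<Longrightarrow> \<exists>t. \<bar>t\<bar> < e \<and> q = p * cis t"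
proof -
  have "isCont Arg 1" by (rule continuous_at_Arg) simp
  then obtain r where r: "r > 0" "\<And>z. dist z 1 < r \<Longrightarrow> dist (Arg z) (Arg 1) < e"
    using assms(2) unfolding continuous_at_eps_delta by blast
  have "\<exists>t. \<bar>t\<bar> < e \<and> q = p * cis t" if "norm q = 1" "dist q p < r" for q
  proof (intro exI conjI)
    have [simp]: "p \<noteq> 0" using assms by auto
    have "norm (q / p) = 1" "q \<noteq> 0" using that assms by (auto simp: norm_divide)
    then have "q / p = cis (Arg (q / p))"
      using Arg_eq[of "q / p"] by (auto simp: cis_conv_exp)
    then show "q = p * cis (Arg (q / p))" by (simp add: field_simps)
    have "dist (q / p) 1 = norm ((q - p) / p)" by (simp add: dist_norm diff_divide_distrib)
    also have "\<dots> = dist q p" using assms by (simp add: norm_divide dist_norm)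
    finally show "\<bar>Arg (q / p)\<bar> < e" using r(2)[of "q / p"] that by (simp add: dist_real_def)
  qed
  with r(1) show ?thesis using that by blast
qed

text \<open>A point of the smaller thickening can be rotated by any angle below \<delta> -
  \<epsilon> without leaving the larger one, so it is interior to it relative to the circle.\<close>

lemma endpoints_thicken_disjoint:
  assumes S: "compact S" "S \<subseteq> circle" and "\<epsilon> < \<delta>"
  shows "endpoints (thicken \<epsilon> S) \<inter> endpoints (thicken \<delta> S) = {}"
proof (rule ccontr)
  assume "\<not> ?thesis"
  then obtain p where "p \<in> endpoints (thicken \<epsilon> S)" "p \<in> endpoints (thicken \<delta> S)" by blast
  then have p: "p \<in> closure (thicken \<epsilon> S)" "p \<in> closure (circle - thicken \<delta> S)"
    using endpoints_eq[OF thicken_subset_circle[OF S(2)]] by blast+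
  have "p \<in> thicken \<epsilon> S"
    using p(1) S by (simp add: compact_thicken compact_imp_closed closure_closed)
  then obtain s t where st: "s \<in> S" "\<bar>t\<bar> \<le> \<epsilon>" "p = s * cis t"
    unfolding thicken_iff by blast
  have "norm s = 1" using st S by auto
  then have np: "norm p = 1" using st by (simp add: norm_mult)
  obtain r where r: "r > 0" "\<And>q. norm q = 1 \<Longrightarrow> dist q p < r \<Longrightarrow> \<exists>t. \<bar>t\<bar> < \<delta> - \<epsilon> \<and> q = p * cis t"
    using circle_near_imp_cis[OF np, of "\<delta> - \<epsilon>"] assms(3) by auto
  obtain q where q: "q \<in> circle" "q \<notin> thicken \<delta> S" "dist q p < r"
    using p(2) r(1) unfolding closure_approachable by blast
  then obtain t' where t': "\<bar>t'\<bar> < \<delta> - \<epsilon>" "q = p * cis t'" using r(2)[of q] by auto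
  then have "q = s * cis (t + t')" "\<bar>t + t'\<bar> \<le> \<delta>"
    using st by (auto simp: cis_mult[symmetric])
  then show False using q(2) st(1) unfolding thicken_iff by blast
qed

lemma thicken_disjoint:
  assumes "compact S" "compact T" "S \<subseteq> circle" "T \<subseteq> circle" "S \<inter> T = {}"
  shows "\<forall>\<^sub>F d in at_right 0. thicken d S \<inter> thicken d T = {}"
proof -
  obtain r where r: "r > 0" "\<And>x y. x \<in> S \<Longrightarrow> y \<in> T \<Longrightarrow> r \<le> dist x y"
    using separate_compact_closed[OF assms(1) compact_imp_closed[OF assms(2)] assms(5)] by blast
  \<comment> \<open>Thickening moves each point by at most d, so the sets would have points at
    distance at most 2 d.\<close>
  have "thicken d S \<inter> thicken d T = {}" if "d < r / 2" for d
  proof (rule ccontr)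
    assume "\<not> ?thesis"
    then obtain p where "p \<in> thicken d S" "p \<in> thicken d T" by blast
    then obtain s t x y where *: "s \<in> S" "t \<in> T" "\<bar>x\<bar> \<le> d" "\<bar>y\<bar> \<le> d" "s * cis x = t * cis y"
      unfolding thicken_iff by metis
    have "dist s t \<le> dist (s * cis x) s + dist (t * cis y) t"
      using dist_triangle2[of s t "s * cis x"] *(5) by (simp add: dist_commute)
    also have "\<dots> \<le> \<bar>x\<bar> + \<bar>y\<bar>"
      using *(1,2) assms(3,4) by (intro add_mono dist_mult_cis_le) auto
    also have "\<dots> < r" using * that by simp
    finally show False using r(2)[OF *(1,2)] by simp
  qed
  then show ?thesis
    using r(1) eventually_at_right_real[of 0 "r / 2"] by (auto elim!: eventually_mono)
qed

lemma thicken_proper: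
  assumes "compact S" "S \<subset> circle"
  shows "\<forall>\<^sub>F d in at_right 0. thicken d S \<noteq> circle"
proof -
  obtain q where q: "q \<in> circle" "q \<notin> S" using assms(2) by blast
  \<comment> \<open>Treating S and a missed point q as two disjoint compact sets keeps q
    uncovered.\<close>
  have "\<forall>\<^sub>F d in at_right (0::real). thicken d S \<inter> thicken d {q} = {}"
    using assms q by (intro thicken_disjoint) auto
  moreover have "\<forall>\<^sub>F d in at_right (0::real). d > 0"
    by (simp add: eventually_at_right_less)
  ultimately show ?thesis
  proof eventually_elim
    case (elim d)
    then have "q \<in> thicken d {q}" using subset_thicken[of d "{q}"] by auto
    then show ?case using elim q(1) by blast
  qed
qed

text \<open>The induction adds elements by increasing r, so a new amount only has to exceed the
  earlier ones. As the sets \<open>E x e\<close> are disjoint for distinct e, each of the finitely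
  many points already in use rules out at most one amount. In the application, \<open>E v e\<close>
  is the set of endpoints of the arc of v thickened by e.\<close>

lemma choose_thresholds:
  fixes E :: "'a \<Rightarrow> real \<Rightarrow> 'b set" and r :: "'a \<Rightarrow> nat"
  assumes "finite V" "d > 0"
    and fin: "\<And>v e. v \<in> V \<Longrightarrow> 0 < e \<Longrightarrow> e < d \<Longrightarrow> finite (E v e)"
    and dis: "\<And>v e e'. v \<in> V \<Longrightarrow> e < e' \<Longrightarrow> E v e \<inter> E v e' = {}"
  shows "\<exists>\<epsilon>. (\<forall>v\<in>V. 0 < \<epsilon> v \<and> \<epsilon> v < d) \<and> (\<forall>u\<in>V. \<forall>v\<in>V. r u < r v \<longrightarrow> \<epsilon> u < \<epsilon> v) \<and>
     (\<forall>u\<in>V. \<forall>v\<in>V. u \<noteq> v \<longrightarrow> E u (\<epsilon> u) \<inter> E v (\<epsilon> v) = {})"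
  using assms(1) fin dis
proof (induction V rule: finite_ranking_induct[where f = r])
  case empty
  then show ?case by simp
next
  case (insert x S)
  obtain \<epsilon> where \<epsilon>: "\<forall>v\<in>S. 0 < \<epsilon> v \<and> \<epsilon> v < d" "\<forall>u\<in>S. \<forall>v\<in>S. r u < r v \<longrightarrow> \<epsilon> u < \<epsilon> v"
    "\<forall>u\<in>S. \<forall>v\<in>S. u \<noteq> v \<longrightarrow> E u (\<epsilon> u) \<inter> E v (\<epsilon> v) = {}"
    using insert.IH insert.prems by auto
  show ?case
  proof (cases "x \<in> S")
    case True
    then show ?thesis using \<epsilon> by (auto simp: insert_absorb)
  next
    case False
    \<comment> \<open>The 0 gives the maximum a value when S is empty and keeps all amounts
      positive.\<close>
    define m where "m = Max (insert 0 (\<epsilon> ` S))"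
    have m: "m < d" "0 \<le> m" "\<And>v. v \<in> S \<Longrightarrow> \<epsilon> v \<le> m"
      unfolding m_def using \<epsilon>(1) \<open>d > 0\<close> insert.hyps(1) by auto
    define F where "F = (\<Union>u\<in>S. E u (\<epsilon> u))"
    have "finite F" unfolding F_def using \<epsilon>(1) insert by auto
    define B where "B = (\<Union>f\<in>F. {e. f \<in> E x e})"
    have "finite B"
      unfolding B_def
    proof (intro finite_UN_I \<open>finite F\<close>)
      fix f
      have "e = e'" if "f \<in> E x e" "f \<in> E x e'" for e e'
        using that insert.prems(2)[of x e e'] insert.prems(2)[of x e' e]
        by (metis disjoint_iff insertI1 linorder_neqE_linordered_idom)
      then have "{e. f \<in> E x e} \<subseteq> {SOME e. f \<in> E x e}" by (auto intro: someI2)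
      then show "finite {e. f \<in> E x e}" by (rule finite_subset) simp
    qed
    then have "infinite ({m<..<d} - B)" using m by (simp add: infinite_Ioo)
    then obtain e where e: "e \<in> {m<..<d}" "e \<notin> B" by (metis Diff_iff all_not_in_conv finite.emptyI)
    have disj: "E x e \<inter> E u (\<epsilon> u) = {}" if "u \<in> S" for u
      using e(2) that unfolding B_def F_def by blast
    have lt: "\<epsilon> u < e" if "u \<in> S" for u using m(3)[OF that] e by auto
    define \<epsilon>' where "\<epsilon>' = \<epsilon>(x := e)"
    have [simp]: "\<epsilon>' x = e" "\<And>u. u \<in> S \<Longrightarrow> \<epsilon>' u = \<epsilon> u" using False by (auto simp: \<epsilon>'_def)
    show ?thesis
    proof (intro exI conjI)
      show "\<forall>v\<in>insert x S. 0 < \<epsilon>' v \<and> \<epsilon>' v < d" using \<epsilon>(1) e m by auto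
      show "\<forall>u\<in>insert x S. \<forall>v\<in>insert x S. r u < r v \<longrightarrow> \<epsilon>' u < \<epsilon>' v"
        using \<epsilon>(2) lt insert.hyps(2) by (auto simp: not_less[symmetric])
      show "\<forall>u\<in>insert x S. \<forall>v\<in>insert x S. u \<noteq> v \<longrightarrow> E u (\<epsilon>' u) \<inter> E v (\<epsilon>' v) = {}"
        using \<epsilon>(3) disj by (auto simp: Int_commute)
    qed
  qed
qed

section \<open>Closed neighbourhoods in admissible graphs\<close>

lemma adj_sym: "adj G u v \<longleftrightarrow> adj G v u"
  by (auto simp: adj_def insert_commute)

lemma adj_irrefl [simp]: "\<not> adj G u u"
  by (simp add: adj_def)

lemma adj_verts: "simple_graph G \<Longrightarrow> adj G u v \<Longrightarrow> u \<in> verts G \<and> v \<in> verts G"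
  by (auto simp: adj_def simple_graph_def)

lemma in_cnbh_iff: "simple_graph G \<Longrightarrow> w \<in> cnbh G v \<longleftrightarrow> w = v \<or> adj G v w"
  by (auto simp: cnbh_def nbh_def dest: adj_verts)

lemma cnbh_sym: "simple_graph G \<Longrightarrow> u \<in> cnbh G v \<longleftrightarrow> v \<in> cnbh G u"
  by (auto simp: in_cnbh_iff adj_sym)

lemma cnbh_refl [simp]: "v \<in> cnbh G v"
  by (simp add: cnbh_def)

lemma cnbh_subset_verts: "v \<in> verts G \<Longrightarrow> cnbh G v \<subseteq> verts G"
  by (auto simp: cnbh_def nbh_def)

lemma in_cnbh_verts: "w \<in> cnbh G v \<Longrightarrow> v \<in> verts G \<Longrightarrow> w \<in> verts G"
  using cnbh_subset_verts by (rule subsetD)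

lemma cnbh_not_verts: "admissible G \<Longrightarrow> v \<in> verts G \<Longrightarrow> cnbh G v \<noteq> verts G"
  by (auto simp: admissible_def universal_vertex_def)

lemma cnbh_eqD: "admissible G \<Longrightarrow> u \<in> verts G \<Longrightarrow> v \<in> verts G \<Longrightarrow> cnbh G u = cnbh G v \<Longrightarrow> u = v"
  by (auto simp: admissible_def twin_free_def)

lemma card_cnbh_less:
  "simple_graph G \<Longrightarrow> v \<in> verts G \<Longrightarrow> cnbh G u \<subset> cnbh G v \<Longrightarrow> card (cnbh G u) < card (cnbh G v)"
  by (meson cnbh_subset_verts finite_subset psubset_card_mono simple_graph_def)

text \<open>Turns compact connected sets, which may share endpoints, into a representation.
  Thickening by less than a small d creates no new intersections, and amounts increasing with the
  size of N[v] preserve containments. That the sets only grow keeps covers of the circle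
  intact.\<close>

lemma realize_compact_arcs:
  assumes G: "admissible G"
    and S: "\<And>v. v \<in> verts G \<Longrightarrow> compact (S v) \<and> connected (S v) \<and> S v \<subseteq> circle \<and> S v \<noteq> {}"
    and int: "\<And>u v. u \<in> verts G \<Longrightarrow> v \<in> verts G \<Longrightarrow> S u \<inter> S v \<noteq> {} \<longleftrightarrow> u \<in> cnbh G v"
    and mono: "\<And>u v. u \<in> verts G \<Longrightarrow> v \<in> verts G \<Longrightarrow> cnbh G u \<subseteq> cnbh G v \<Longrightarrow> S u \<subseteq> S v"
  shows "\<exists>\<rho>. ca_representation G \<rho> \<and> (\<forall>v \<in> verts G. S v \<subseteq> \<rho> v \<and> compact (\<rho> v)) \<and>
    (\<forall>u \<in> verts G. \<forall>v \<in> verts G. cnbh G u \<subset> cnbh G v \<longrightarrow> \<rho> u \<subset> \<rho> v)"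
proof -
  let ?V = "verts G"
  have sG: "simple_graph G" and fin: "finite ?V"
    using G by (auto simp: admissible_def simple_graph_def)
  \<comment> \<open>A set equal to the circle would meet all others and make v universal.\<close>
  have proper: "S v \<subset> circle" if v: "v \<in> ?V" for v
  proof (rule ccontr)
    assume "\<not> S v \<subset> circle"
    then have "S v = circle" using S[OF v] by auto
    then have "u \<in> cnbh G v" if "u \<in> ?V" for u using int[OF that v] S[OF that] by auto
    then show False using cnbh_not_verts[OF G v] cnbh_subset_verts[OF v] by blast
  qed
  have "\<forall>\<^sub>F d in at_right 0. \<forall>u\<in>?V. \<forall>v\<in>?V. S u \<inter> S v = {} \<longrightarrow> thicken d (S u) \<inter> thicken d (S v) = {}"
  proof (intro eventually_ball_finite fin ballI)
    fix u v assume uv: "u \<in> ?V" "v \<in> ?V"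
    show "\<forall>\<^sub>F d in at_right 0. S u \<inter> S v = {} \<longrightarrow> thicken d (S u) \<inter> thicken d (S v) = {}"
      using thicken_disjoint[of "S u" "S v"] S[OF uv(1)] S[OF uv(2)]
      by (cases "S u \<inter> S v = {}") (auto elim: eventually_mono)
  qed
  moreover have "\<forall>\<^sub>F d in at_right 0. \<forall>v\<in>?V. thicken d (S v) \<noteq> circle"
    using fin S proper by (intro eventually_ball_finite ballI thicken_proper) auto
  moreover have "\<forall>\<^sub>F d in at_right (0::real). d > 0"
    by (simp add: eventually_at_right_less)
  ultimately have "\<forall>\<^sub>F d in at_right (0::real). d > 0 \<and> (\<forall>v\<in>?V. thicken d (S v) \<noteq> circle) \<and>
      (\<forall>u\<in>?V. \<forall>v\<in>?V. S u \<inter> S v = {} \<longrightarrow> thicken d (S u) \<inter> thicken d (S v) = {})"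
    by eventually_elim blast
  then obtain d where d: "d > 0" "\<And>v. v \<in> ?V \<Longrightarrow> thicken d (S v) \<noteq> circle"
     "\<And>u v. u \<in> ?V \<Longrightarrow> v \<in> ?V \<Longrightarrow> S u \<inter> S v = {} \<Longrightarrow> thicken d (S u) \<inter> thicken d (S v) = {}"
    using eventually_happens'[OF trivial_limit_at_right_real] by blast
  have th_proper: "thicken e (S v) \<subset> circle" if "v \<in> ?V" "e \<le> d" for v e
    using thicken_mono[OF that(2), of "S v" "S v"] d(2)[OF that(1)] S[OF that(1)]
      thicken_subset_circle[of "S v" e] thicken_subset_circle[of "S v" d] by blast
  have ex: "\<exists>\<epsilon>. (\<forall>v\<in>?V. 0 < \<epsilon> v \<and> \<epsilon> v < d) \<and>
     (\<forall>u\<in>?V. \<forall>v\<in>?V. card (cnbh G u) < card (cnbh G v) \<longrightarrow> \<epsilon> u < \<epsilon> v) \<and>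
     (\<forall>u\<in>?V. \<forall>v\<in>?V. u \<noteq> v \<longrightarrow>
        endpoints (thicken (\<epsilon> u) (S u)) \<inter> endpoints (thicken (\<epsilon> v) (S v)) = {})"
  proof (intro choose_thresholds[where E = "\<lambda>v e. endpoints (thicken e (S v))"] fin d(1))
    fix v e assume "v \<in> ?V" "0 < e" "e < d"
    then obtain a b where "endpoints (thicken e (S v)) \<subseteq> {a, b}"
      using endpoints_card2[of "thicken e (S v)"] connected_thicken S th_proper[of v e] by auto
    then show "finite (endpoints (thicken e (S v)))" by (rule finite_subset) simp
  next
    fix v and e e' :: real assume "v \<in> ?V" "e < e'"
    then show "endpoints (thicken e (S v)) \<inter> endpoints (thicken e' (S v)) = {}"
      using endpoints_thicken_disjoint[of "S v" e e'] S by simp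
  qed
  obtain \<epsilon> where \<epsilon>: "\<And>v. v \<in> ?V \<Longrightarrow> 0 < \<epsilon> v \<and> \<epsilon> v < d"
    "\<And>u v. u \<in> ?V \<Longrightarrow> v \<in> ?V \<Longrightarrow> card (cnbh G u) < card (cnbh G v) \<Longrightarrow> \<epsilon> u < \<epsilon> v"
    "\<And>u v. u \<in> ?V \<Longrightarrow> v \<in> ?V \<Longrightarrow> u \<noteq> v \<Longrightarrow>
        endpoints (thicken (\<epsilon> u) (S u)) \<inter> endpoints (thicken (\<epsilon> v) (S v)) = {}"
    using exE[OF ex] by metis
  define \<rho> where "\<rho> v = thicken (\<epsilon> v) (S v)" for v
  have sup: "S v \<subseteq> \<rho> v" if "v \<in> ?V" for v
    unfolding \<rho>_def using \<epsilon>(1)[OF that] by (intro subset_thicken) simp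
  have arc: "arc_set (\<rho> v)" if "v \<in> ?V" for v
    unfolding arc_set_def
    using sup[OF that] S[OF that] th_proper[OF that, of "\<epsilon> v"] \<epsilon>(1)[OF that] connected_thicken
    by (auto simp: \<rho>_def)
  have ends: "endpoints (\<rho> u) \<inter> endpoints (\<rho> v) = {}" if "u \<in> ?V" "v \<in> ?V" "u \<noteq> v" for u v
    unfolding \<rho>_def using \<epsilon>(3) that by blast
  \<comment> \<open>Equal arcs would share their endpoints, and every arc has at least one.\<close>
  have neq: "\<rho> u \<noteq> \<rho> v" if "u \<in> ?V" "v \<in> ?V" "u \<noteq> v" for u v
    using ends[OF that] endpoints_nonempty[of "\<rho> u"] arc[OF that(1)] unfolding arc_set_def by auto
  have adj: "adj G u v \<longleftrightarrow> \<rho> u \<inter> \<rho> v \<noteq> {}" if "u \<in> ?V" "v \<in> ?V" "u \<noteq> v" for u v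
  proof
    assume "adj G u v"
    then have "S u \<inter> S v \<noteq> {}" using int[OF that(1,2)] sG by (simp add: in_cnbh_iff adj_sym)
    then show "\<rho> u \<inter> \<rho> v \<noteq> {}" using sup that by blast
  next
    assume ne: "\<rho> u \<inter> \<rho> v \<noteq> {}"
    have "\<rho> u \<subseteq> thicken d (S u)" "\<rho> v \<subseteq> thicken d (S v)"
      unfolding \<rho>_def using \<epsilon>(1) that by (simp_all add: thicken_mono less_imp_le)
    then have "S u \<inter> S v \<noteq> {}" using d(3)[of u v] ne that by blast
    then show "adj G u v" using int[OF that(1,2)] sG that by (auto simp: in_cnbh_iff adj_sym)
  qed
  show ?thesis
  proof (intro exI[of _ \<rho>] conjI ballI impI)
    show "ca_representation G \<rho>"
      unfolding ca_representation_def inj_on_def using arc neq ends adj by blast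
    show "\<rho> u \<subset> \<rho> v" if "u \<in> ?V" "v \<in> ?V" "cnbh G u \<subset> cnbh G v" for u v
    proof
      show "\<rho> u \<subseteq> \<rho> v"
        unfolding \<rho>_def
        using \<epsilon>(2)[OF that(1,2) card_cnbh_less[OF sG that(2,3)]] mono[OF that(1,2)] that(3)
        by (intro thicken_mono) auto
      show "\<rho> u \<noteq> \<rho> v" using neq that by blast
    qed
  qed (use sup S compact_thicken in \<open>auto simp: \<rho>_def\<close>)
qed

section \<open>Normalized representations\<close>

lemma nmat_CD_iff: "nmat G u v = CD \<longleftrightarrow> adj G u v \<and> cnbh G u \<subset> cnbh G v"
  by (auto simp: nmat_def)

lemma nmat_CS_iff: "nmat G u v = CS \<longleftrightarrow> adj G u v \<and> cnbh G v \<subset> cnbh G u"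
  by (auto simp: nmat_def)

lemma nmat_DI_iff: "nmat G u v = DI \<longleftrightarrow> \<not> adj G u v"
  by (auto simp: nmat_def)

lemma nmat_CC_D:
  assumes "nmat G u v = CC"
  shows "adj G u v" "overlap (cnbh G u) (cnbh G v)" "cnbh G u \<union> cnbh G v = verts G"
    "w \<in> cnbh G u - cnbh G v \<Longrightarrow> cnbh G w \<subset> cnbh G u"
    "w \<in> cnbh G v - cnbh G u \<Longrightarrow> cnbh G w \<subset> cnbh G v"
  using assms by (auto simp: nmat_def split: if_splits)

lemma nmat_sym:
  "nmat G v u = (case nmat G u v of CD \<Rightarrow> CS | CS \<Rightarrow> CD | t \<Rightarrow> t)"
proof -
  have *: "overlap (cnbh G u) (cnbh G v) \<longleftrightarrow> overlap (cnbh G v) (cnbh G u)"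
    "cnbh G u \<union> cnbh G v = cnbh G v \<union> cnbh G u"
    by (auto simp: overlap_def)
  show ?thesis
    unfolding nmat_def adj_sym[of G v u] * by (auto split: if_splits)
qed

lemma nmat_OV_sym: "nmat G u v = OV \<longleftrightarrow> nmat G v u = OV"
  unfolding nmat_sym[of G v u] by (cases "nmat G u v") auto

context
  fixes G :: "'a graph" and \<rho> :: "'a \<Rightarrow> complex set"
  assumes G: "admissible G" and \<rho>: "ca_representation G \<rho>"
begin

lemma rep_simple: "simple_graph G"
  using G by (simp add: admissible_def)

lemma rep_arc:
  assumes "v \<in> verts G"
  shows "\<rho> v \<noteq> {}" "\<rho> v \<subset> circle" "\<rho> v \<subseteq> circle" "connected (\<rho> v)"
  using assms \<rho> by (auto simp: ca_representation_def arc_set_def)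

lemma rep_endpoints:
  "u \<in> verts G \<Longrightarrow> v \<in> verts G \<Longrightarrow> u \<noteq> v \<Longrightarrow> endpoints (\<rho> u) \<inter> endpoints (\<rho> v) = {}"
  using \<rho> by (simp add: ca_representation_def)

lemma rep_adj:
  "u \<in> verts G \<Longrightarrow> v \<in> verts G \<Longrightarrow> u \<noteq> v \<Longrightarrow> adj G u v \<longleftrightarrow> \<rho> u \<inter> \<rho> v \<noteq> {}"
  using \<rho> by (simp add: ca_representation_def)

lemma rep_cnbh:
  "u \<in> verts G \<Longrightarrow> v \<in> verts G \<Longrightarrow> \<rho> u \<inter> \<rho> v \<noteq> {} \<longleftrightarrow> u \<in> cnbh G v"
  using rep_adj[of u v] rep_arc(1)[of u] rep_simple
  by (cases "u = v") (auto simp: in_cnbh_iff adj_sym)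

lemma rep_subset_cnbh:
  assumes "u \<in> verts G" "v \<in> verts G" "\<rho> u \<subseteq> \<rho> v"
  shows "cnbh G u \<subseteq> cnbh G v"
proof
  fix w assume w: "w \<in> cnbh G u"
  then have wV: "w \<in> verts G" using assms(1) by (rule in_cnbh_verts)
  then have "\<rho> w \<inter> \<rho> u \<noteq> {}" using w rep_cnbh[of w u] assms(1) by simp
  then have "\<rho> w \<inter> \<rho> v \<noteq> {}" using assms(3) by blast
  then show "w \<in> cnbh G v" using rep_cnbh[OF wV assms(2)] by simp
qed

text \<open>Twin-freeness makes the resulting containment of neighbourhoods strict.\<close>

lemma rep_subset_CD:
  assumes "u \<in> verts G" "v \<in> verts G" "u \<noteq> v" "\<rho> u \<subseteq> \<rho> v"
  shows "nmat G u v = CD"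
proof -
  have "cnbh G u \<subset> cnbh G v"
    using rep_subset_cnbh[OF assms(1,2,4)] cnbh_eqD[OF G assms(1,2)] assms(3) by blast
  moreover have "adj G u v" using rep_adj[OF assms(1-3)] rep_arc(1)[OF assms(1)] assms(4) by blast
  ultimately show ?thesis by (simp add: nmat_CD_iff)
qed

text \<open>A vertex w adjacent to u but not to v has its arc in the complement of that of v, hence
  inside that of u, which gives the condition on N[w]. A containment between N[u] and N[v] would
  make u or v universal.\<close>

lemma rep_cover_CC:
  assumes uv: "u \<in> verts G" "v \<in> verts G" "u \<noteq> v"
    and cover: "\<rho> u \<union> \<rho> v = circle"
  shows "nmat G u v = CC"
proof -
  \<comment> \<open>Two disjoint arcs without a common endpoint cannot partition the connected
    circle.\<close>
  have adj: "adj G u v"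
  proof (rule ccontr)
    assume "\<not> adj G u v"
    then have "\<rho> u \<inter> \<rho> v = {}" using rep_adj uv by blast
    then show False
      using connected_not_split[OF connected_circle, of "\<rho> u" "\<rho> v"] cover
        rep_arc[OF uv(1)] rep_arc[OF uv(2)] rep_endpoints[OF uv] by blast
  qed
  have un: "cnbh G u \<union> cnbh G v = verts G"
  proof -
    have "w \<in> cnbh G u \<union> cnbh G v" if w: "w \<in> verts G" for w
      using rep_cnbh[OF w uv(1)] rep_cnbh[OF w uv(2)] rep_arc(1,3)[OF w] cover by blast
    then show ?thesis
      using cnbh_subset_verts[OF uv(1)] cnbh_subset_verts[OF uv(2)] by blast
  qed
  have nsub: "\<not> cnbh G u \<subseteq> cnbh G v" "\<not> cnbh G v \<subseteq> cnbh G u"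
    using un cnbh_not_verts[OF G] uv by (metis Un_absorb1 Un_absorb2)+
  have strict: "cnbh G w \<subset> cnbh G x"
    if "w \<in> cnbh G x - cnbh G y" "\<rho> x \<union> \<rho> y = circle" "x \<in> verts G" "y \<in> verts G" "x \<in> cnbh G y"
    for w x y
  proof -
    have w: "w \<in> verts G" using that(1,3) in_cnbh_verts[of w G x] by simp
    have "\<rho> w \<inter> \<rho> y = {}" using rep_cnbh[OF w that(4)] that(1) by blast
    then have "\<rho> w \<subseteq> \<rho> x" using rep_arc(3)[OF w] that(2) by blast
    moreover have "w \<noteq> x" using that by blast
    ultimately have "nmat G w x = CD" using rep_subset_CD w that(3) by blast
    then show ?thesis by (simp add: nmat_CD_iff)
  qed
  have mem: "u \<in> cnbh G v" "v \<in> cnbh G u"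
    using adj rep_simple by (auto simp: in_cnbh_iff adj_sym)
  have "overlap (cnbh G u) (cnbh G v)"
    using mem nsub cnbh_refl[of u G] unfolding overlap_def by blast
  moreover have "\<forall>w \<in> cnbh G u - cnbh G v. cnbh G w \<subset> cnbh G u"
    using strict[of _ u v] cover uv mem by blast
  moreover have "\<forall>w \<in> cnbh G v - cnbh G u. cnbh G w \<subset> cnbh G v"
    using strict[of _ v u] cover uv mem by (metis Un_commute)
  ultimately show ?thesis
    unfolding nmat_def using adj un nsub by auto
qed

text \<open>Only CD and CC have to be arranged, CS being CD reversed. A pair of type OV shows
  neither a containment nor a cover in any representation, since these would force CD, CS or
  CC.\<close>

lemma normalized_repsI:
  assumes CD: "\<And>u v. u \<in> verts G \<Longrightarrow> v \<in> verts G \<Longrightarrow> cnbh G u \<subset> cnbh G v \<Longrightarrow> \<rho> u \<subset> \<rho> v"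
    and CC: "\<And>u v. u \<in> verts G \<Longrightarrow> v \<in> verts G \<Longrightarrow> nmat G u v = CC \<Longrightarrow> \<rho> u \<union> \<rho> v = circle"
  shows "\<rho> \<in> normalized_reps G"
proof -
  have "has_itype (\<rho> u) (\<rho> v) (nmat G u v)" if uv: "u \<in> verts G" "v \<in> verts G" "u \<noteq> v" for u v
  proof (cases "nmat G u v")
    case DI
    then have "\<rho> u \<inter> \<rho> v = {}" using rep_adj[OF uv] nmat_DI_iff[of G u v] by simp
    then show ?thesis using DI by simp
  next
    case CD
    then have "\<rho> u \<subset> \<rho> v" using assms(1)[OF uv(1,2)] nmat_CD_iff[of G u v] by simp
    then show ?thesis using CD by simp
  next
    case CS
    then have "\<rho> v \<subset> \<rho> u" using assms(1)[OF uv(2,1)] nmat_CS_iff[of G u v] by simp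
    then show ?thesis using CS by simp
  next
    case CC
    have "\<not> \<rho> u \<subseteq> \<rho> v" "\<not> \<rho> v \<subseteq> \<rho> u"
      using nmat_CC_D(2)[OF CC] rep_subset_cnbh[OF uv(1,2)] rep_subset_cnbh[OF uv(2,1)]
      unfolding overlap_def by blast+
    then show ?thesis using assms(2)[OF uv(1,2) CC] CC by simp
  next
    case OV
    then have "adj G u v" using nmat_DI_iff[of G u v] by auto
    then have "\<rho> u \<inter> \<rho> v \<noteq> {}" using rep_adj[OF uv] by simp
    moreover have "\<not> \<rho> u \<subseteq> \<rho> v" using rep_subset_CD[OF uv] OV by auto
    moreover have "\<not> \<rho> v \<subseteq> \<rho> u"
      using rep_subset_CD[OF uv(2,1)] uv(3) OV nmat_OV_sym[of G u v] by auto
    moreover have "\<rho> u \<union> \<rho> v \<noteq> circle" using rep_cover_CC[OF uv] OV by auto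
    ultimately show ?thesis using OV by (auto simp: overlap_def)
  qed
  then show ?thesis using \<rho> by (simp add: normalized_reps_def)
qed

text \<open>A common limit point of disjoint arcs is an endpoint of both.\<close>

lemma closures_disjoint:
  assumes "u \<in> verts G" "v \<in> verts G" "u \<noteq> v" "\<rho> u \<inter> \<rho> v = {}"
  shows "closure (\<rho> u) \<inter> closure (\<rho> v) = {}"
proof (rule ccontr)
  assume "\<not> ?thesis"
  then obtain p where p: "p \<in> closure (\<rho> u)" "p \<in> closure (\<rho> v)" by blast
  have "\<rho> u \<subseteq> circle - \<rho> v" "\<rho> v \<subseteq> circle - \<rho> u"
    using assms(4) rep_arc(3)[OF assms(1)] rep_arc(3)[OF assms(2)] by blast+
  then have "p \<in> closure (circle - \<rho> v)" "p \<in> closure (circle - \<rho> u)"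
    using p closure_mono by blast+
  then have "p \<in> endpoints (\<rho> u) \<inter> endpoints (\<rho> v)"
    using p endpoints_eq[OF rep_arc(3)[OF assms(1)]] endpoints_eq[OF rep_arc(3)[OF assms(2)]] by simp
  then show False using rep_endpoints[OF assms(1-3)] by simp
qed

text \<open>A point of the closed inner arc that is a limit of points outside the outer arc would be
  an endpoint of both. This keeps a contained arc away from a gap next to the containing
  one.\<close>

lemma subset_imp_closure_gap_disjoint:
  assumes "u \<in> verts G" "v \<in> verts G" "u \<noteq> v" "\<rho> u \<subseteq> \<rho> v" "closed (\<rho> u)" "M \<subseteq> circle - \<rho> v"
  shows "closure M \<inter> \<rho> u = {}"
proof (rule ccontr)
  assume "\<not> ?thesis"
  then obtain p where p: "p \<in> closure M" "p \<in> \<rho> u" by blast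
  have "circle - \<rho> v \<subseteq> circle - \<rho> u" using assms(4) by blast
  then have 1: "p \<in> closure (circle - \<rho> v)" "p \<in> closure (circle - \<rho> u)"
    using p(1) assms(6) closure_mono by (metis subsetD)+
  have 2: "p \<in> closure (\<rho> u)" "p \<in> closure (\<rho> v)"
    using p(2) assms(4) closure_subset by blast+
  have "p \<in> endpoints (\<rho> u) \<inter> endpoints (\<rho> v)"
    using 1 2 endpoints_eq[OF rep_arc(3)[OF assms(1)]] endpoints_eq[OF rep_arc(3)[OF assms(2)]] by simp
  then show False using rep_endpoints[OF assms(1-3)] by simp
qed

end

text \<open>The arcs are closed up first; distinct endpoints ensure that this creates no new
  intersections. Each enlarged set is connected because a vertex u with N[u] inside N[v] lies in
  N[v], so that its closed arc meets that of v.\<close>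

lemma ca_graph_imp_monotone_representation:
  assumes "ca_graph G"
  shows "\<exists>\<rho>. ca_representation G \<rho> \<and> (\<forall>v \<in> verts G. compact (\<rho> v)) \<and>
    (\<forall>u \<in> verts G. \<forall>v \<in> verts G. cnbh G u \<subset> cnbh G v \<longrightarrow> \<rho> u \<subset> \<rho> v)"
proof -
  let ?V = "verts G"
  obtain \<sigma> where G: "admissible G" and \<sigma>: "ca_representation G \<sigma>"
    using assms by (auto simp: ca_graph_def)
  note arc = rep_arc[OF G \<sigma>]
  have sG: "simple_graph G" and fin: "finite ?V" using G by (auto simp: admissible_def simple_graph_def)
  have comp: "compact (closure (\<sigma> v))" "closure (\<sigma> v) \<subseteq> circle" if "v \<in> ?V" for v
  proof -
    show "closure (\<sigma> v) \<subseteq> circle" using arc(3)[OF that] closed_sphere by (rule closure_minimal)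
    then show "compact (closure (\<sigma> v))"
      by (metis bounded_subset bounded_sphere closed_closure compact_eq_bounded_closed)
  qed
  have clos: "closure (\<sigma> u) \<inter> closure (\<sigma> v) \<noteq> {} \<longleftrightarrow> u \<in> cnbh G v" if uv: "u \<in> ?V" "v \<in> ?V" for u v
  proof (cases "u = v")
    case True
    then show ?thesis using arc(1)[OF uv(1)] closure_eq_empty by auto
  next
    case False
    have "closure (\<sigma> u) \<inter> closure (\<sigma> v) \<noteq> {} \<longleftrightarrow> \<sigma> u \<inter> \<sigma> v \<noteq> {}"
      using closures_disjoint[OF G \<sigma> uv False] closure_subset[of "\<sigma> u"] closure_subset[of "\<sigma> v"] by blast
    then show ?thesis using rep_cnbh[OF G \<sigma> uv] by simp
  qed
  define S where "S v = (\<Union>u\<in>{u\<in>?V. cnbh G u \<subseteq> cnbh G v}. closure (\<sigma> u))" for v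
  \<comment> \<open>Adjacency climbs along the containments: y in N[x] gives y in N[u], that is u in
    N[y], hence u in N[v].\<close>
  have int: "S u \<inter> S v \<noteq> {} \<longleftrightarrow> u \<in> cnbh G v" if uv: "u \<in> ?V" "v \<in> ?V" for u v
  proof
    assume "S u \<inter> S v \<noteq> {}"
    then obtain x y where x: "x \<in> ?V" "cnbh G x \<subseteq> cnbh G u" and y: "y \<in> ?V" "cnbh G y \<subseteq> cnbh G v"
      and xy: "closure (\<sigma> x) \<inter> closure (\<sigma> y) \<noteq> {}"
      unfolding S_def by blast
    have "y \<in> cnbh G x" using clos[OF x(1) y(1)] xy cnbh_sym[OF sG, of x y] by simp
    then have "u \<in> cnbh G y" using x(2) cnbh_sym[OF sG, of u y] by blast
    then show "u \<in> cnbh G v" using y(2) by blast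
  next
    assume "u \<in> cnbh G v"
    then have "closure (\<sigma> u) \<inter> closure (\<sigma> v) \<noteq> {}" using clos[OF uv] by simp
    then show "S u \<inter> S v \<noteq> {}" unfolding S_def using uv by blast
  qed
  have conn: "connected (S v)" if v: "v \<in> ?V" for v
  proof -
    have "connected (closure (\<sigma> v) \<union> (\<Union>u\<in>{u\<in>?V. cnbh G u \<subseteq> cnbh G v}. closure (\<sigma> u)))"
    proof (rule connected_Un_Union)
      show "connected (closure (\<sigma> v))" by (rule connected_imp_connected_closure[OF arc(4)[OF v]])
      show "closure (\<sigma> v) \<noteq> {}" using arc(1)[OF v] by simp
      fix C assume "C \<in> (\<lambda>u. closure (\<sigma> u)) ` {u\<in>?V. cnbh G u \<subseteq> cnbh G v}"
      then obtain u where u: "u \<in> ?V" "cnbh G u \<subseteq> cnbh G v" "C = closure (\<sigma> u)" by blast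
      have "u \<in> cnbh G v" using u(2) cnbh_refl by (rule subsetD)
      then show "connected C \<and> closure (\<sigma> v) \<inter> C \<noteq> {}"
        using clos[OF u(1) v] connected_imp_connected_closure[OF arc(4)[OF u(1)]]
        unfolding u(3) by (simp add: Int_commute)
    qed
    also have "closure (\<sigma> v) \<union> (\<Union>u\<in>{u\<in>?V. cnbh G u \<subseteq> cnbh G v}. closure (\<sigma> u)) = S v"
      unfolding S_def using v by blast
    finally show ?thesis .
  qed
  have S: "compact (S v) \<and> connected (S v) \<and> S v \<subseteq> circle \<and> S v \<noteq> {}" if v: "v \<in> ?V" for v
  proof (intro conjI conn v)
    show "compact (S v)" unfolding S_def using fin comp(1) by (intro compact_UN) auto
    show "S v \<subseteq> circle" unfolding S_def using comp(2) by blast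
    show "S v \<noteq> {}" using int[OF v v] by simp
  qed
  have S_mono: "S u \<subseteq> S v" if "u \<in> ?V" "v \<in> ?V" "cnbh G u \<subseteq> cnbh G v" for u v
    unfolding S_def using that(3) by blast
  have "\<exists>\<rho>. ca_representation G \<rho> \<and> (\<forall>v \<in> verts G. S v \<subseteq> \<rho> v \<and> compact (\<rho> v)) \<and>
    (\<forall>u \<in> verts G. \<forall>v \<in> verts G. cnbh G u \<subset> cnbh G v \<longrightarrow> \<rho> u \<subset> \<rho> v)"
    by (rule realize_compact_arcs[OF G]) (fact S int S_mono)+
  then show ?thesis by metis
qed

text \<open>If the arcs of a pair of type \<^const>\<open>CC\<close> leave a gap on the circle, then every other vertex
  whose arc meets the closed gap is adjacent to both. The gap is added to the vertex with the
  larger neighbourhood only: two non-adjacent vertices never both receive a gap in this way.\<close>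

lemma normalized_reps_nonempty:
  assumes ca: "ca_graph G"
  obtains \<rho> where "\<rho> \<in> normalized_reps G"
proof -
  let ?V = "verts G"
  obtain \<sigma> where \<sigma>: "ca_representation G \<sigma>" and comp': "\<forall>v\<in>?V. compact (\<sigma> v)"
    and mono': "\<forall>u\<in>?V. \<forall>v\<in>?V. cnbh G u \<subset> cnbh G v \<longrightarrow> \<sigma> u \<subset> \<sigma> v"
    using ca_graph_imp_monotone_representation[OF ca] by metis
  have comp: "compact (\<sigma> v)" if "v \<in> ?V" for v using comp' that by simp
  have mono: "\<sigma> u \<subset> \<sigma> v" if "u \<in> ?V" "v \<in> ?V" "cnbh G u \<subset> cnbh G v" for u v
    using mono' that by simp
  have G: "admissible G" using ca by (simp add: ca_graph_def)
  have sG: "simple_graph G" and fin: "finite ?V" using G by (auto simp: admissible_def simple_graph_def)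
  note arc = rep_arc[OF G \<sigma>]
  have mono_sub: "\<sigma> u \<subseteq> \<sigma> v" if "u \<in> ?V" "v \<in> ?V" "cnbh G u \<subseteq> cnbh G v" for u v
    using mono[OF that(1,2)] cnbh_eqD[OF G that(1,2)] that(3) by blast
  define gap where "gap u v = closure (circle - (\<sigma> u \<union> \<sigma> v))" for u v
  \<comment> \<open>Equal sizes are allowed, so each CC pair with a gap occurs in at least one order
    and a tie in both. In a tie both vertices receive the gap, which is harmless as they are
    adjacent.\<close>
  define P where "P u v \<longleftrightarrow> u \<in> ?V \<and> v \<in> ?V \<and> nmat G u v = CC \<and> \<sigma> u \<union> \<sigma> v \<noteq> circle \<and>
      card (cnbh G v) \<le> card (cnbh G u)" for u v
  have PD: "u \<in> ?V" "v \<in> ?V" "nmat G u v = CC" "u \<noteq> v" "\<sigma> u \<inter> \<sigma> v \<noteq> {}"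
    "\<not> \<sigma> u \<subseteq> \<sigma> v" "\<sigma> u \<union> \<sigma> v \<noteq> circle" "card (cnbh G v) \<le> card (cnbh G u)" if "P u v" for u v
  proof -
    show *: "u \<in> ?V" "v \<in> ?V" "nmat G u v = CC" "\<sigma> u \<union> \<sigma> v \<noteq> circle" "card (cnbh G v) \<le> card (cnbh G u)"
      using that by (auto simp: P_def)
    then show "u \<noteq> v" using nmat_CC_D(1) by force
    then show "\<sigma> u \<inter> \<sigma> v \<noteq> {}" using rep_adj[OF G \<sigma> *(1,2)] nmat_CC_D(1)[OF *(3)] by simp
    show "\<not> \<sigma> u \<subseteq> \<sigma> v"
      using rep_subset_CD[OF G \<sigma> *(1,2) \<open>u \<noteq> v\<close>] *(3) by auto
  qed
  have gap_circle: "gap u v \<subseteq> circle" for u v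
    unfolding gap_def by (rule closure_minimal) (auto simp: closed_sphere)
  \<comment> \<open>A vertex outside N[u] lies in N[v], so type CC puts its neighbourhood strictly
    inside N[v]. Its arc is then a compact subset of the arc of v with other endpoints and cannot
    touch the closed gap.\<close>
  have gap_nbr: "y \<in> cnbh G u" if P: "P u v" and y: "y \<in> ?V" and meet: "gap u v \<inter> \<sigma> y \<noteq> {}" for u v y
  proof (rule ccontr)
    assume nu: "y \<notin> cnbh G u"
    then have "y \<in> cnbh G v - cnbh G u" using nmat_CC_D(3)[OF PD(3)[OF P]] y by blast
    then have sub: "cnbh G y \<subset> cnbh G v" using nmat_CC_D(5)[OF PD(3)[OF P]] by blast
    then have "y \<noteq> v" by blast
    then have "gap u v \<inter> \<sigma> y = {}"
      unfolding gap_def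
      using subset_imp_closure_gap_disjoint[OF G \<sigma> y PD(2)[OF P], of "circle - (\<sigma> u \<union> \<sigma> v)"]
        mono[OF y PD(2)[OF P] sub] compact_imp_closed[OF comp[OF y]] by blast
    then show False using meet by simp
  qed
  \<comment> \<open>If u and u' were distinct and not adjacent, type CC would give |N[u']| < |N[v]|
    <= |N[u]| < |N[v']| <= |N[u']|.\<close>
  have gap_gap: "u' \<in> cnbh G u" if P: "P u v" "P u' v'" for u v u' v'
  proof (rule ccontr)
    assume nu: "u' \<notin> cnbh G u"
    then have nu': "u \<notin> cnbh G u'" using cnbh_sym[OF sG, of u u'] by simp
    have "u' \<in> cnbh G v - cnbh G u" using nmat_CC_D(3)[OF PD(3)[OF P(1)]] nu PD(1)[OF P(2)] by blast
    then have "cnbh G u' \<subset> cnbh G v" using nmat_CC_D(5)[OF PD(3)[OF P(1)]] by blast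
    moreover have "u \<in> cnbh G v' - cnbh G u'" using nmat_CC_D(3)[OF PD(3)[OF P(2)]] nu' PD(1)[OF P(1)] by blast
    then have "cnbh G u \<subset> cnbh G v'" using nmat_CC_D(5)[OF PD(3)[OF P(2)]] by blast
    ultimately have "card (cnbh G u') < card (cnbh G v)" "card (cnbh G u) < card (cnbh G v')"
      using card_cnbh_less[OF sG] PD(2)[OF P(1)] PD(2)[OF P(2)] by blast+
    then show False using PD(8)[OF P(1)] PD(8)[OF P(2)] by linarith
  qed
  \<comment> \<open>The complement of the arc of v is connected and covered by the closed gap and
    the arc of u. It meets both, so these two closed sets intersect. Without this, adding the gap to
    u could leave two pieces.\<close>
  have gap_meets: "gap u v \<inter> \<sigma> u \<noteq> {}" if P: "P u v" for u v
  proof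
    assume disj: "gap u v \<inter> \<sigma> u = {}"
    note uv = PD(1,2)[OF P]
    let ?C = "circle - \<sigma> v"
    have "connected ?C" by (rule connected_circle_Diff[OF arc(4,3)[OF uv(2)]])
    moreover have "gap u v \<inter> \<sigma> u \<inter> ?C = {}" using disj by blast
    moreover have "?C \<subseteq> gap u v \<union> \<sigma> u"
      unfolding gap_def using closure_subset[of "circle - (\<sigma> u \<union> \<sigma> v)"] by blast
    moreover have "closed (gap u v)" "closed (\<sigma> u)"
      unfolding gap_def using compact_imp_closed[OF comp[OF uv(1)]] by simp_all
    ultimately have "gap u v \<inter> ?C = {} \<or> \<sigma> u \<inter> ?C = {}" by (rule connected_closedD)
    moreover have "gap u v \<inter> ?C \<noteq> {}"
    proof -
      obtain p where "p \<in> circle" "p \<notin> \<sigma> u \<union> \<sigma> v"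
        using PD(7)[OF P] arc(3)[OF uv(1)] arc(3)[OF uv(2)] by blast
      then have "p \<in> gap u v" "p \<in> ?C"
        unfolding gap_def using closure_subset[of "circle - (\<sigma> u \<union> \<sigma> v)"] by blast+
      then show ?thesis by blast
    qed
    ultimately show False using PD(6)[OF P] arc(3)[OF uv(1)] by blast
  qed
  have gap_conn: "connected (gap u v)" if P: "P u v" for u v
    unfolding gap_def using PD(5)[OF P] arc(3,4)[OF PD(1)[OF P]] arc(3,4)[OF PD(2)[OF P]]
    by (intro connected_imp_connected_closure connected_circle_Diff connected_Un) auto
  \<comment> \<open>The gap also goes to every x whose neighbourhood contains N[u], so that
    monotonicity is kept.\<close>
  define S where "S x = \<sigma> x \<union> (\<Union>(u, v)\<in>{(u, v). P u v \<and> cnbh G u \<subseteq> cnbh G x}. gap u v)" for x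
  have S_iff: "p \<in> S x \<longleftrightarrow> p \<in> \<sigma> x \<or> (\<exists>u v. P u v \<and> cnbh G u \<subseteq> cnbh G x \<and> p \<in> gap u v)" for p x
    unfolding S_def by blast
  have int: "S x \<inter> S y \<noteq> {} \<longleftrightarrow> x \<in> cnbh G y" if xy: "x \<in> ?V" "y \<in> ?V" for x y
  proof
    assume "S x \<inter> S y \<noteq> {}"
    then obtain p where p: "p \<in> S x" "p \<in> S y" by blast
    from p(1)[unfolded S_iff] show "x \<in> cnbh G y"
    proof (elim disjE exE conjE)
      assume px: "p \<in> \<sigma> x"
      from p(2)[unfolded S_iff] show ?thesis
      proof (elim disjE exE conjE)
        assume "p \<in> \<sigma> y" then show ?thesis using px rep_cnbh[OF G \<sigma> xy] by blast
      next
        fix u v assume *: "P u v" "cnbh G u \<subseteq> cnbh G y" "p \<in> gap u v"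
        then show ?thesis using gap_nbr[OF *(1) xy(1)] px by blast
      qed
    next
      fix u v assume *: "P u v" "cnbh G u \<subseteq> cnbh G x" "p \<in> gap u v"
      from p(2)[unfolded S_iff] show ?thesis
      proof (elim disjE exE conjE)
        assume "p \<in> \<sigma> y"
        then have "y \<in> cnbh G u" using gap_nbr[OF *(1) xy(2)] *(3) by blast
        then show ?thesis using *(2) cnbh_sym[OF sG, of x y] by blast
      next
        fix u' v' assume g: "P u' v'" "cnbh G u' \<subseteq> cnbh G y" "p \<in> gap u' v'"
        have "u' \<in> cnbh G u" by (rule gap_gap[OF *(1) g(1)])
        then have "x \<in> cnbh G u'" using *(2) cnbh_sym[OF sG, of x u'] by blast
        then show ?thesis using g(2) by blast
      qed
    qed
  next
    assume "x \<in> cnbh G y"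
    then show "S x \<inter> S y \<noteq> {}" using rep_cnbh[OF G \<sigma> xy] unfolding S_def by blast
  qed
  have S_mono: "S x \<subseteq> S y" if "x \<in> ?V" "y \<in> ?V" "cnbh G x \<subseteq> cnbh G y" for x y
    using mono_sub[OF that] that(3) unfolding S_def by blast
  have finP: "finite {(u, v). P u v \<and> cnbh G u \<subseteq> cnbh G x}" for x
    by (rule finite_subset[of _ "?V \<times> ?V"]) (auto simp: P_def fin)
  have S_conn: "connected (S x)" if x: "x \<in> ?V" for x
    unfolding S_def
  proof (intro connected_Un_Union arc x)
    fix C assume "C \<in> (\<lambda>(u, v). gap u v) ` {(u, v). P u v \<and> cnbh G u \<subseteq> cnbh G x}"
    then obtain u v where uv: "P u v" "cnbh G u \<subseteq> cnbh G x" "C = gap u v" by blast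
    have "\<sigma> x \<inter> gap u v \<noteq> {}"
      using gap_meets[OF uv(1)] mono_sub[OF PD(1)[OF uv(1)] x uv(2)] by blast
    then show "connected C \<and> \<sigma> x \<inter> C \<noteq> {}" using gap_conn[OF uv(1)] uv(3) by simp
  qed
  have S_compact: "compact (S x)" if x: "x \<in> ?V" for x
    unfolding S_def
  proof (intro compact_Un comp x compact_UN finP)
    fix uv assume "uv \<in> {(u, v). P u v \<and> cnbh G u \<subseteq> cnbh G x}"
    have "compact (gap u v)" for u v
      using gap_circle[of u v] unfolding gap_def
      by (metis bounded_subset bounded_sphere closed_closure compact_eq_bounded_closed)
    then show "compact (case uv of (u, v) \<Rightarrow> gap u v)" by (simp add: case_prod_unfold)
  qed
  have S: "compact (S x) \<and> connected (S x) \<and> S x \<subseteq> circle \<and> S x \<noteq> {}" if x: "x \<in> ?V" for x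
  proof (intro conjI S_conn S_compact x)
    show "S x \<subseteq> circle" unfolding S_def using arc(3)[OF x] gap_circle by blast
    show "S x \<noteq> {}" unfolding S_def using arc(1)[OF x] by blast
  qed
  have "\<exists>\<rho>. ca_representation G \<rho> \<and> (\<forall>v \<in> verts G. S v \<subseteq> \<rho> v \<and> compact (\<rho> v)) \<and>
    (\<forall>u \<in> verts G. \<forall>v \<in> verts G. cnbh G u \<subset> cnbh G v \<longrightarrow> \<rho> u \<subset> \<rho> v)"
    by (rule realize_compact_arcs[OF G]) (fact S int S_mono)+
  then obtain \<rho> where \<rho>: "ca_representation G \<rho>" "\<forall>v\<in>?V. S v \<subseteq> \<rho> v"
    "\<forall>u\<in>?V. \<forall>v\<in>?V. cnbh G u \<subset> cnbh G v \<longrightarrow> \<rho> u \<subset> \<rho> v"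
    by metis
  have cover: "\<rho> u \<union> \<rho> v = circle"
    if uv: "u \<in> ?V" "v \<in> ?V" and CC: "nmat G u v = CC" and le: "card (cnbh G v) \<le> card (cnbh G u)" for u v
  proof -
    have "circle \<subseteq> S u \<union> S v"
    proof (cases "\<sigma> u \<union> \<sigma> v = circle")
      case True
      then show ?thesis unfolding S_def by blast
    next
      case False
      then have "P u v" using that by (simp add: P_def)
      then have "gap u v \<subseteq> S u" unfolding S_def by blast
      then show ?thesis
        unfolding gap_def S_def using closure_subset[of "circle - (\<sigma> u \<union> \<sigma> v)"] by blast
    qed
    then show ?thesis
      using bspec[OF \<rho>(2) uv(1)] bspec[OF \<rho>(2) uv(2)] rep_arc(3)[OF G \<rho>(1) uv(1)] rep_arc(3)[OF G \<rho>(1) uv(2)] by blast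
  qed
  have "\<rho> \<in> normalized_reps G"
  proof (rule normalized_repsI[OF G \<rho>(1)])
    show "\<rho> u \<subset> \<rho> v" if "u \<in> ?V" "v \<in> ?V" "cnbh G u \<subset> cnbh G v" for u v
      using \<rho>(3) that by simp
  next
    fix u v assume uv: "u \<in> ?V" "v \<in> ?V" and CC: "nmat G u v = CC"
    have "nmat G v u = CC" using nmat_sym[of G v u] CC by simp
    then show "\<rho> u \<union> \<rho> v = circle"
      using cover[OF uv CC] cover[OF uv(2,1)] by (metis Un_commute linear)
  qed
  then show ?thesis by (rule that)
qed

section \<open>Flip sets at an endpoint\<close>

text \<open>As a is not an endpoint of Y, some neighbourhood of a within the circle lies inside Y or
  avoids Y.\<close>

lemma endpoint_cases:
  assumes "A \<subseteq> circle" "Y \<subseteq> circle" "a \<in> endpoints A" "endpoints A \<inter> endpoints Y = {}"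
  shows "a \<in> circle" "a \<in> closure A" "a \<in> closure (circle - A)"
    "a \<in> Y \<Longrightarrow> a \<notin> closure (circle - Y)" "a \<notin> Y \<Longrightarrow> a \<notin> closure Y"
proof -
  show a: "a \<in> closure A" "a \<in> closure (circle - A)"
    using assms(3) unfolding endpoints_eq[OF assms(1)] by simp_all
  have "closure A \<subseteq> circle" using assms(1) closed_sphere by (rule closure_minimal)
  then show c: "a \<in> circle" using a(1) by (rule subsetD)
  have "a \<notin> endpoints Y" using assms(3,4) by blast
  then have n: "\<not> (a \<in> closure Y \<and> a \<in> closure (circle - Y))"
    unfolding endpoints_eq[OF assms(2)] by simp
  show "a \<notin> closure (circle - Y)" if "a \<in> Y" using n that closure_subset[of Y] by blast
  show "a \<notin> closure Y" if "a \<notin> Y" using n that c closure_subset[of "circle - Y"] by blast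
qed

text \<open>If a point were missed, (X Un Y) Int Z would be connected, as an intersection of arcs
  that do not cover the circle. X and Y would then split it into two nonempty parts although they
  have no common endpoint.\<close>

lemma failing_helly_cover:
  assumes "connected X" "connected Y" "connected Z" "X \<subseteq> circle" "Y \<subseteq> circle" "Z \<subseteq> circle"
    and "endpoints X \<inter> endpoints Y = {}"
    and "X \<inter> Y \<noteq> {}" "X \<inter> Z \<noteq> {}" "Y \<inter> Z \<noteq> {}" "X \<inter> Y \<inter> Z = {}"
  shows "X \<union> Y \<union> Z = circle"
proof (rule ccontr)
  assume "\<not> ?thesis"
  then have "connected ((X \<union> Y) \<inter> Z)"
    using assms by (intro connected_circle_Int connected_Un) auto
  then have "(X \<union> Y) \<inter> Z \<inter> X = {} \<or> (X \<union> Y) \<inter> Z \<inter> Y = {}"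
    using assms by (intro connected_not_split) auto
  then show False using assms(9,10) by blast
qed

text \<open>Let R be the complement of X Un Y. The set A Un (X Int Y) Un R is connected, so its
  complement, the part of the symmetric difference of X and Y outside A, is connected too and lies
  in X or in Y. The endpoint b makes A reach R: arbitrarily close to b there are points of A, but
  none of X or Y.\<close>

lemma same_end_nested:
  assumes conn: "connected A" "connected X" "connected Y"
    and sub: "A \<subseteq> circle" "X \<subseteq> circle" "Y \<subseteq> circle"
    and ends: "endpoints A \<inter> endpoints X = {}" "endpoints A \<inter> endpoints Y = {}"
      "endpoints X \<inter> endpoints Y = {}"
    and ne: "A \<inter> X \<inter> Y \<noteq> {}" and b: "b \<in> endpoints A" "b \<notin> X" "b \<notin> Y"
  shows "X - A \<subseteq> Y \<or> Y - A \<subseteq> X"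
proof -
  have bc: "b \<in> circle" "b \<in> closure A" using endpoint_cases[OF sub(1) sub(2) b(1) ends(1)] by auto
  define R where "R = circle - (X \<union> Y)"
  have XY: "connected (X \<inter> Y)"
    using connected_circle_Int[OF conn(2,3) sub(2,3)] b bc by blast
  have "connected (X \<union> Y)" using conn ne by (intro connected_Un) auto
  then have R: "connected R" unfolding R_def using sub by (intro connected_circle_Diff) auto
  have K: "connected (A \<union> X \<inter> Y)" using conn XY ne by (intro connected_Un) auto
  have "A \<inter> R \<noteq> {}"
  proof
    assume "A \<inter> R = {}"
    then have "A \<subseteq> X \<union> Y" using sub unfolding R_def by blast
    then have "closure A \<subseteq> closure X \<union> closure Y" using closure_mono[of A "X \<union> Y"] by simp
    then show False
      using bc endpoint_cases(5)[OF sub(1) sub(2) b(1) ends(1)]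
        endpoint_cases(5)[OF sub(1) sub(3) b(1) ends(2)] b by blast
  qed
  then have "(A \<union> X \<inter> Y) \<inter> R \<noteq> {}" by blast
  then have "connected ((A \<union> X \<inter> Y) \<union> R)" by (rule connected_Un[OF K R])
  then have M: "connected (circle - ((A \<union> X \<inter> Y) \<union> R))" (is "connected ?M")
    using sub unfolding R_def by (intro connected_circle_Diff) auto
  have "?M \<subseteq> X \<union> Y" "?M \<inter> X \<inter> Y = {}" unfolding R_def by blast+
  then have "?M \<inter> X = {} \<or> ?M \<inter> Y = {}"
    by (rule connected_not_split[OF M _ _ sub(2,3) ends(3)])
  then show ?thesis using sub unfolding R_def by blast
qed

lemma ov_triangle3:
  "ov_triangle G {x, y, z} \<longleftrightarrow> x \<in> verts G \<and> y \<in> verts G \<and> z \<in> verts G \<and>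
     x \<noteq> y \<and> x \<noteq> z \<and> y \<noteq> z \<and> nmat G x y = OV \<and> nmat G x z = OV \<and> nmat G y z = OV"
proof -
  have card: "card {x, y, z} = 3 \<longleftrightarrow> x \<noteq> y \<and> x \<noteq> z \<and> y \<noteq> z"
    by (auto simp: card_insert_if)
  have "(\<forall>u\<in>{x, y, z}. \<forall>v\<in>{x, y, z}. u \<noteq> v \<longrightarrow> nmat G u v = OV) \<longleftrightarrow>
      nmat G x y = OV \<and> nmat G x z = OV \<and> nmat G y z = OV" if "x \<noteq> y" "x \<noteq> z" "y \<noteq> z"
    using that nmat_OV_sym[of G x y] nmat_OV_sym[of G x z] nmat_OV_sym[of G y z] by auto
  then show ?thesis unfolding ov_triangle_def card by auto
qed

lemma nbh_type_D:
  assumes "simple_graph G" "y \<in> nbh_type G t u"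
  shows "u \<in> verts G" "y \<in> verts G" "u \<noteq> y" "adj G u y" "nmat G u y = t"
  using assms adj_verts[of G u y] adj_irrefl[of G u] by (auto simp: nbh_type_def nbh_def)

context
  fixes G :: "'a graph" and \<rho> :: "'a \<Rightarrow> complex set"
  assumes G: "admissible G" and N: "\<rho> \<in> normalized_reps G"
begin

lemma norm_rep: "ca_representation G \<rho>"
  using N by (simp add: normalized_reps_def)

lemma norm_simple: "simple_graph G"
  using G by (simp add: admissible_def)

lemmas norm_arc = rep_arc[OF G norm_rep]
lemmas norm_endpoints = rep_endpoints[OF G norm_rep]
lemmas norm_adj = rep_adj[OF G norm_rep]

lemma norm_itype:
  "u \<in> verts G \<Longrightarrow> v \<in> verts G \<Longrightarrow> u \<noteq> v \<Longrightarrow> has_itype (\<rho> u) (\<rho> v) (nmat G u v)"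
  using N by (simp add: normalized_reps_def)

lemma norm_OV_iff:
  assumes "u \<in> verts G" "v \<in> verts G" "u \<noteq> v"
  shows "nmat G u v = OV \<longleftrightarrow>
    \<rho> u \<inter> \<rho> v \<noteq> {} \<and> \<not> \<rho> u \<subseteq> \<rho> v \<and> \<not> \<rho> v \<subseteq> \<rho> u \<and> \<rho> u \<union> \<rho> v \<noteq> circle"
  using norm_itype[OF assms] by (cases "nmat G u v") (auto simp: overlap_def)

text \<open>Three pairwise overlapping arcs without a common point cover the circle. Hence every
  vertex is dominated by the triangle, and an arc that misses two of them lies in the third.\<close>

lemma norm_nonhelly_imp_Delta:
  assumes ov: "ov_triangle G {x, y, z}" and empty: "\<rho> x \<inter> \<rho> y \<inter> \<rho> z = {}"
  shows "{x, y, z} \<in> Delta G"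
proof -
  have V: "x \<in> verts G" "y \<in> verts G" "z \<in> verts G" and ne: "x \<noteq> y" "x \<noteq> z" "y \<noteq> z"
    and OV: "nmat G x y = OV" "nmat G x z = OV" "nmat G y z = OV"
    using ov unfolding ov_triangle3 by auto
  have cover: "\<rho> x \<union> \<rho> y \<union> \<rho> z = circle"
    using OV norm_OV_iff[OF V(1,2) ne(1)] norm_OV_iff[OF V(1,3) ne(2)] norm_OV_iff[OF V(2,3) ne(3)]
    by (intro failing_helly_cover norm_arc norm_endpoints V ne empty) auto
  have nbr: "\<rho> w \<inter> \<rho> v \<noteq> {} \<longleftrightarrow> w \<in> cnbh G v" if "w \<in> verts G" "v \<in> verts G" for v w
    by (rule rep_cnbh[OF G norm_rep that])
  have "verts G \<subseteq> (\<Union>v\<in>{x, y, z}. cnbh G v)"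
  proof
    fix w assume w: "w \<in> verts G"
    have "\<rho> w \<inter> (\<rho> x \<union> \<rho> y \<union> \<rho> z) \<noteq> {}" using norm_arc(1,3)[OF w] cover by blast
    then have "\<rho> w \<inter> \<rho> x \<noteq> {} \<or> \<rho> w \<inter> \<rho> y \<noteq> {} \<or> \<rho> w \<inter> \<rho> z \<noteq> {}" by blast
    then show "w \<in> (\<Union>v\<in>{x, y, z}. cnbh G v)" unfolding nbr[OF w V(1)] nbr[OF w V(2)] nbr[OF w V(3)] by simp
  qed
  then have "(\<Union>v\<in>{x, y, z}. cnbh G v) = verts G"
    using cnbh_subset_verts[OF V(1)] cnbh_subset_verts[OF V(2)] cnbh_subset_verts[OF V(3)] by auto
  moreover have "nmat G v t = CD" if t: "t \<in> {x, y, z}" and v: "v \<in> excl_nbh G {x, y, z} {t}" for t v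
  proof -
    have vV: "v \<in> verts G" "v \<notin> {x, y, z}" and non: "\<And>s. s \<in> {x, y, z} \<Longrightarrow> s \<noteq> t \<Longrightarrow> \<not> adj G v s"
      using v unfolding excl_nbh_def by auto
    have "\<rho> v \<inter> \<rho> s = {}" if "s \<in> {x, y, z}" "s \<noteq> t" for s
      using non[OF that] norm_adj[of v s] vV that(1) V by blast
    then have "\<rho> v \<subseteq> \<rho> t" using t cover norm_arc(3)[OF vV(1)] ne by blast
    moreover have "t \<in> verts G" "v \<noteq> t" using t V vV by auto
    ultimately show ?thesis using rep_subset_CD[OF G norm_rep vV(1)] by blast
  qed
  ultimately show ?thesis using ov unfolding Delta_def by blast
qed

text \<open>The endpoint a is a limit of the arc of u and of its complement. For each type except
  OV, one of these two sets lies in the arc of y or avoids it, which decides the position of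
  a.\<close>

lemma endpoint_mem_cases:
  assumes "u \<in> verts G" "y \<in> verts G" "u \<noteq> y" and a: "a \<in> endpoints (\<rho> u)"
  shows "nmat G u y = CD \<Longrightarrow> a \<in> \<rho> y" "nmat G u y = CC \<Longrightarrow> a \<in> \<rho> y"
    "nmat G u y = CS \<Longrightarrow> a \<notin> \<rho> y" "nmat G u y = DI \<Longrightarrow> a \<notin> \<rho> y"
proof -
  note sub = norm_arc(3)[OF assms(1)] norm_arc(3)[OF assms(2)]
  note ac = endpoint_cases[OF sub a norm_endpoints[OF assms(1-3)]]
  note it = norm_itype[OF assms(1-3)]
  show "a \<in> \<rho> y" if "nmat G u y = CD"
    using it that ac(2,5) closure_mono[of "\<rho> u" "\<rho> y"] by auto
  show "a \<in> \<rho> y" if "nmat G u y = CC"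
  proof -
    have "circle - \<rho> u \<subseteq> \<rho> y" using it that by auto
    then show ?thesis using ac(3,5) closure_mono by blast
  qed
  show "a \<notin> \<rho> y" if "nmat G u y = CS"
  proof -
    have "circle - \<rho> u \<subseteq> circle - \<rho> y" using it that by auto
    then show ?thesis using ac(3,4) closure_mono by blast
  qed
  show "a \<notin> \<rho> y" if "nmat G u y = DI"
  proof -
    have "\<rho> u \<subseteq> circle - \<rho> y" using it that sub by auto
    then show ?thesis using ac(2,4) closure_mono by blast
  qed
qed

text \<open>The arc of y and its complement are both connected, and each meets the arc of u without
  lying inside it.\<close>

lemma OV_contains_one_endpoint:
  assumes V: "u \<in> verts G" "y \<in> verts G" "u \<noteq> y" and OV: "nmat G u y = OV"
  shows "\<rho> y \<inter> endpoints (\<rho> u) \<noteq> {}" "endpoints (\<rho> u) - \<rho> y \<noteq> {}"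
proof -
  note sub = norm_arc(3)[OF V(1)] norm_arc(3)[OF V(2)]
  have o: "\<rho> u \<inter> \<rho> y \<noteq> {}" "\<not> \<rho> u \<subseteq> \<rho> y" "\<not> \<rho> y \<subseteq> \<rho> u" "\<rho> u \<union> \<rho> y \<noteq> circle"
    using OV norm_OV_iff[OF V] by auto
  show "\<rho> y \<inter> endpoints (\<rho> u) \<noteq> {}"
    using o by (intro connected_meets_endpoints norm_arc V) auto
  have "(circle - \<rho> y) \<inter> endpoints (\<rho> u) \<noteq> {}"
    using o sub by (intro connected_meets_endpoints connected_circle_Diff norm_arc V) auto
  then show "endpoints (\<rho> u) - \<rho> y \<noteq> {}" by blast
qed

text \<open>The endpoint a may lie outside the arc of u when that arc is open at a. The finitely
  many other arcs have no endpoint at a, so membership in each of them is constant near a.\<close>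

lemma point_near_endpoint:
  assumes u: "u \<in> verts G" and a: "a \<in> endpoints (\<rho> u)"
  obtains p where "p \<in> \<rho> u" "\<And>y. y \<in> verts G \<Longrightarrow> y \<noteq> u \<Longrightarrow> p \<in> \<rho> y \<longleftrightarrow> a \<in> \<rho> y"
proof -
  note sub = norm_arc(3)[OF u]
  have "\<forall>\<^sub>F p in nhds a. p \<in> circle \<longrightarrow> (p \<in> \<rho> y \<longleftrightarrow> a \<in> \<rho> y)" if y: "y \<in> verts G - {u}" for y
  proof -
    have uy: "y \<in> verts G" "u \<noteq> y" using y by auto
    note ac = endpoint_cases[OF sub norm_arc(3)[OF uy(1)] a norm_endpoints[OF u uy]]
    show ?thesis
    proof (cases "a \<in> \<rho> y")
      case True
      then have "\<forall>\<^sub>F p in nhds a. p \<in> - closure (circle - \<rho> y)"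
        using ac(4) by (intro eventually_nhds_in_open) auto
      then show ?thesis
      proof eventually_elim
        case (elim p)
        then show ?case using True closure_subset[of "circle - \<rho> y"] by blast
      qed
    next
      case False
      then have "\<forall>\<^sub>F p in nhds a. p \<in> - closure (\<rho> y)"
        using ac(5) by (intro eventually_nhds_in_open) auto
      then show ?thesis
      proof eventually_elim
        case (elim p)
        then show ?case using False closure_subset[of "\<rho> y"] by blast
      qed
    qed
  qed
  then have "\<forall>\<^sub>F p in nhds a. \<forall>y\<in>verts G - {u}. p \<in> circle \<longrightarrow> (p \<in> \<rho> y \<longleftrightarrow> a \<in> \<rho> y)"
    using norm_simple by (intro eventually_ball_finite) (auto simp: simple_graph_def)
  then obtain e where e: "e > 0"
    "\<forall>p. dist p a < e \<longrightarrow> (\<forall>y\<in>verts G - {u}. p \<in> circle \<longrightarrow> (p \<in> \<rho> y \<longleftrightarrow> a \<in> \<rho> y))"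
    unfolding eventually_nhds_metric by blast
  have "a \<in> closure (\<rho> u)" using a unfolding endpoints_eq[OF sub] by simp
  then obtain p where p: "p \<in> \<rho> u" "dist p a < e" using e(1) unfolding closure_approachable by blast
  then have "p \<in> circle" using sub by blast
  then show ?thesis using that[OF p(1)] e(2) p(2) by simp
qed

section \<open>Grouping the OV-neighbours of u by the endpoint they contain\<close>

context
  fixes u a b
  assumes u: "u \<in> verts G" and ab: "endpoints (\<rho> u) \<subseteq> {a, b}"
    and a: "a \<in> endpoints (\<rho> u)" and b: "b \<in> endpoints (\<rho> u)"
    and uniform: "\<And>T. T \<in> Delta G \<Longrightarrow> nonhelly_triangle (\<rho> ` T)"
begin

lemma OV_one_endpoint:
  assumes "y \<in> nbh_type G OV u"
  shows "a \<in> \<rho> y \<longleftrightarrow> b \<notin> \<rho> y"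
proof -
  note y = nbh_type_D[OF norm_simple assms]
  show ?thesis using OV_contains_one_endpoint[OF y(1,2,3,5)] ab by blast
qed

lemma same_side_if_common_endpoint:
  assumes x: "x \<in> nbh_type G OV u" and y: "y \<in> nbh_type G OV u" and axy: "a \<in> \<rho> x" "a \<in> \<rho> y"
  shows "same_side G u x y"
proof (cases "x = y")
  case True
  then show ?thesis using x by (simp add: same_side_def)
next
  case False
  note xD = nbh_type_D[OF norm_simple x] and yD = nbh_type_D[OF norm_simple y]
  note V = xD(1,2) yD(2)
  have bxy: "b \<notin> \<rho> x" "b \<notin> \<rho> y" using OV_one_endpoint x y axy by blast+
  have "b \<in> circle"
    by (rule endpoint_cases(1)[OF norm_arc(3)[OF V(1)] norm_arc(3)[OF V(2)] b norm_endpoints[OF V(1,2) xD(3)]])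
  then have notCC: "\<rho> x \<union> \<rho> y \<noteq> circle" using bxy by blast
  obtain p where p: "p \<in> \<rho> u" "\<And>y. y \<in> verts G \<Longrightarrow> y \<noteq> u \<Longrightarrow> p \<in> \<rho> y \<longleftrightarrow> a \<in> \<rho> y"
    using point_near_endpoint[OF u a] by metis
  have pxy: "p \<in> \<rho> x" "p \<in> \<rho> y" using p(2) V xD(3) yD(3) axy by auto
  have nested: "\<rho> x - \<rho> u \<subseteq> \<rho> y \<or> \<rho> y - \<rho> u \<subseteq> \<rho> x"
    using p(1) pxy by (intro same_end_nested[where b = b] norm_arc norm_endpoints V xD(3) yD(3) False b bxy) auto
  \<comment> \<open>This is where uniformity enters: the arcs of a triangle of Delta have no common
    point.\<close>
  have helly: "T \<notin> Delta G" if "q \<in> \<Inter> (\<rho> ` T)" for T q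
    using uniform[of T] that unfolding nonhelly_triangle_def by auto
  have "nmat G x y = CS \<or> nmat G x y = CD \<or> nmat G x y = OV"
    using norm_itype[OF V(2,3) False] notCC axy by (cases "nmat G x y") auto
  moreover have "{x, y, u} \<notin> Delta G" using p(1) pxy by (intro helly[of p]) auto
  moreover have "\<not> in_between G u x y"
  proof
    assume ib: "in_between G u x y"
    then consider w w' where "w \<in> excl_nbh G {x, u, y} {x}" "w' \<in> excl_nbh G {x, u, y} {y}"
      | z where "z \<in> excl_nbh G {x, u, y} {x, y}" "{x, y, z} \<in> Delta G"
      unfolding in_between_def by blast
    then show False
    proof cases
      \<comment> \<open>The arc of w meets x outside u and y, and that of w' meets y outside u and
        x, against the nesting.\<close>
      case 1
      have w: "w \<in> verts G" "w \<noteq> x" "w \<noteq> u" "w \<noteq> y" "adj G w x" "\<not> adj G w u" "\<not> adj G w y"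
        using 1(1) xD(3) yD(3) False by (auto simp: excl_nbh_def)
      have w': "w' \<in> verts G" "w' \<noteq> x" "w' \<noteq> u" "w' \<noteq> y" "adj G w' y" "\<not> adj G w' u" "\<not> adj G w' x"
        using 1(2) xD(3) yD(3) False by (auto simp: excl_nbh_def)
      have "\<rho> w \<inter> \<rho> x \<noteq> {}" "\<rho> w \<inter> \<rho> u = {}" "\<rho> w \<inter> \<rho> y = {}"
        using w norm_adj[OF w(1) V(2) w(2)] norm_adj[OF w(1) V(1) w(3)] norm_adj[OF w(1) V(3) w(4)]
        by simp_all
      moreover have "\<rho> w' \<inter> \<rho> y \<noteq> {}" "\<rho> w' \<inter> \<rho> u = {}" "\<rho> w' \<inter> \<rho> x = {}"
        using w' norm_adj[OF w'(1) V(2) w'(2)] norm_adj[OF w'(1) V(1) w'(3)] norm_adj[OF w'(1) V(3) w'(4)]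
        by simp_all
      ultimately show False using nested by blast
    next
      \<comment> \<open>The arc of z meets those of x and y outside u. By the nesting, one of these
        meeting points lies in all three arcs.\<close>
      case 2
      have z: "z \<in> verts G" "z \<noteq> x" "z \<noteq> u" "z \<noteq> y" "adj G z x" "\<not> adj G z u" "adj G z y"
        using 2(1) xD(3) yD(3) False by (auto simp: excl_nbh_def)
      have "\<rho> z \<inter> \<rho> x \<noteq> {}" "\<rho> z \<inter> \<rho> u = {}" "\<rho> z \<inter> \<rho> y \<noteq> {}"
        using z norm_adj[OF z(1) V(2) z(2)] norm_adj[OF z(1) V(1) z(3)] norm_adj[OF z(1) V(3) z(4)]
        by simp_all
      then obtain q where "q \<in> \<rho> x" "q \<in> \<rho> y" "q \<in> \<rho> z" using nested by blast
      then show False using helly[of q "{x, y, z}"] 2(2) by simp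
    qed
  qed
  ultimately show ?thesis using x y unfolding same_side_def by blast
qed

text \<open>If u is not in-between x and y, no vertex outside N[u] is adjacent to both. But type OV
  gives each of x and y a neighbour outside N[u]; these are exclusive neighbours and place u
  in-between after all.\<close>

lemma not_same_side_if_distinct_endpoints:
  assumes x: "x \<in> nbh_type G OV u" and y: "y \<in> nbh_type G OV u" and axy: "a \<in> \<rho> x" "a \<notin> \<rho> y"
  shows "\<not> same_side G u x y"
proof
  assume ss: "same_side G u x y"
  note xD = nbh_type_D[OF norm_simple x] and yD = nbh_type_D[OF norm_simple y]
  note V = xD(1,2) yD(2)
  have bxy: "b \<notin> \<rho> x" "b \<in> \<rho> y" using OV_one_endpoint x y axy by blast+
  have xy: "x \<noteq> y" using axy by blast
  have "nmat G x y \<noteq> CD" "nmat G x y \<noteq> CS"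
    using norm_itype[OF V(2,3) xy] axy bxy by auto
  then have OV: "nmat G x y = OV" and nD: "{x, y, u} \<notin> Delta G" and nib: "\<not> in_between G u x y"
    using ss xy unfolding same_side_def by auto
  have ovx: "\<rho> u \<inter> \<rho> x \<noteq> {}" "\<not> \<rho> u \<subseteq> \<rho> x" using norm_OV_iff[OF V(1,2) xD(3)] xD(5) by auto
  have ovy: "\<rho> u \<inter> \<rho> y \<noteq> {}" "\<not> \<rho> u \<subseteq> \<rho> y" using norm_OV_iff[OF V(1,3) yD(3)] yD(5) by auto
  have ovxy: "\<rho> x \<inter> \<rho> y \<noteq> {}" "\<rho> x \<union> \<rho> y \<noteq> circle" using norm_OV_iff[OF V(2,3) xy] OV by auto
  have tri: "ov_triangle G {x, u, y}"
    unfolding ov_triangle3 using V xD(3,5) yD(3,5) xy OV nmat_OV_sym[of G u x] by auto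
  have "ov_triangle G {x, y, u}" using tri by (simp add: insert_commute)
  then have meet: "\<rho> x \<inter> \<rho> y \<inter> \<rho> u \<noteq> {}" using norm_nonhelly_imp_Delta[of x y u] nD by blast
  have conn: "connected (\<rho> x \<inter> \<rho> y)"
    by (rule connected_circle_Int[OF norm_arc(4)[OF V(2)] norm_arc(4)[OF V(3)]
        norm_arc(3)[OF V(2)] norm_arc(3)[OF V(3)] ovxy(2)])
  \<comment> \<open>The endpoint a is missing from y and b from x, so the connected intersection
    meets the arc of u without containing an endpoint of it and cannot leave it.\<close>
  have inside: "\<rho> x \<inter> \<rho> y \<subseteq> \<rho> u"
  proof (rule ccontr)
    assume "\<not> ?thesis"
    then have "(\<rho> x \<inter> \<rho> y) \<inter> endpoints (\<rho> u) \<noteq> {}"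
      using meet norm_arc(3)[OF V(2)]
      by (intro connected_meets_endpoints[OF conn _ norm_arc(3)[OF V(1)]]) auto
    then show False using ab axy bxy by blast
  qed
  \<comment> \<open>Type OV excludes a strict containment of N[v] in N[u], and twin-freeness
    excludes equality.\<close>
  have outside: "\<exists>w. w \<in> verts G \<and> w \<notin> {x, u, y} \<and> adj G w v \<and> \<not> adj G w u"
    if v: "v \<in> nbh_type G OV u" and vxy: "v \<in> {x, y}" for v
  proof -
    note vD = nbh_type_D[OF norm_simple v]
    have OV': "nmat G v u = OV" using vD(5) nmat_OV_sym[of G u v] by simp
    have "adj G v u" using vD(4) adj_sym[of G u v] by simp
    then have "\<not> cnbh G v \<subset> cnbh G u" using OV' nmat_CD_iff[of G v u] by auto
    moreover have "cnbh G v \<noteq> cnbh G u" using cnbh_eqD[OF G vD(2,1)] vD(3) by blast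
    ultimately obtain w where w: "w \<in> cnbh G v" "w \<notin> cnbh G u" by blast
    have "w \<in> verts G" by (rule in_cnbh_verts[OF w(1) vD(2)])
    moreover have "w \<notin> {x, u, y}"
      using w(2) xD(4) yD(4) by (auto simp: in_cnbh_iff[OF norm_simple])
    moreover have "adj G w v" "\<not> adj G w u"
      using w calculation(2) vxy adj_sym[of G v w] adj_sym[of G u w] by (auto simp: in_cnbh_iff[OF norm_simple])
    ultimately show ?thesis by blast
  qed
  have gap: False if z: "z \<in> verts G" "z \<notin> {x, u, y}" "adj G z x" "adj G z y" "\<not> adj G z u" for z
  proof -
    have ne: "z \<noteq> x" "z \<noteq> u" "z \<noteq> y" using z(2) by auto
    have Z: "\<rho> z \<inter> \<rho> x \<noteq> {}" "\<rho> z \<inter> \<rho> u = {}" "\<rho> z \<inter> \<rho> y \<noteq> {}"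
      using z norm_adj[OF z(1) V(2) ne(1)] norm_adj[OF z(1) V(1) ne(2)] norm_adj[OF z(1) V(3) ne(3)]
      by simp_all
    have "nmat G x z = OV"
      unfolding norm_OV_iff[OF V(2) z(1) ne(1)[symmetric]]
    proof (intro conjI)
      show "\<rho> x \<union> \<rho> z \<noteq> circle" using ovx(2) Z(2) norm_arc(3)[OF V(1)] by blast
    qed (use Z inside ovx in blast)+
    moreover have "nmat G y z = OV"
      unfolding norm_OV_iff[OF V(3) z(1) ne(3)[symmetric]]
    proof (intro conjI)
      show "\<rho> y \<union> \<rho> z \<noteq> circle" using ovy(2) Z(2) norm_arc(3)[OF V(1)] by blast
    qed (use Z inside ovy in blast)+
    ultimately have "ov_triangle G {x, y, z}"
      unfolding ov_triangle3 using V z(1) xy ne OV by auto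
    moreover have "\<rho> x \<inter> \<rho> y \<inter> \<rho> z = {}" using inside Z(2) by blast
    ultimately have "{x, y, z} \<in> Delta G" by (rule norm_nonhelly_imp_Delta)
    moreover have "z \<in> excl_nbh G {x, u, y} {x, y}"
      using z by (auto simp: excl_nbh_def)
    moreover have "{x, u, y} \<notin> Delta G" using nD by (simp add: insert_commute)
    ultimately show False using nib tri unfolding in_between_def by blast
  qed
  obtain w where w: "w \<in> verts G" "w \<notin> {x, u, y}" "adj G w x" "\<not> adj G w u"
    using outside[OF x] by blast
  obtain w' where w': "w' \<in> verts G" "w' \<notin> {x, u, y}" "adj G w' y" "\<not> adj G w' u"
    using outside[OF y] by blast
  have "w \<in> excl_nbh G {x, u, y} {x}" using w gap[of w] by (auto simp: excl_nbh_def)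
  moreover have "w' \<in> excl_nbh G {x, u, y} {y}" using w' gap[of w'] by (auto simp: excl_nbh_def)
  moreover have "{x, u, y} \<notin> Delta G" using nD by (simp add: insert_commute)
  ultimately show False using nib tri unfolding in_between_def by blast
qed

lemma flip_set_at_endpoint:
  assumes x: "x \<in> nbh_type G OV u" and ax: "a \<in> \<rho> x"
  shows "flip_set G ({u} \<union> nbh_type G CD u \<union> nbh_type G CC u \<union>
      {y \<in> nbh_type G OV u. same_side G u x y})" (is "flip_set G ?F")
proof -
  obtain p where p: "p \<in> \<rho> u" "\<And>y. y \<in> verts G \<Longrightarrow> y \<noteq> u \<Longrightarrow> p \<in> \<rho> y \<longleftrightarrow> a \<in> \<rho> y"
    using point_near_endpoint[OF u a] by metis
  have "v \<in> ?F \<longleftrightarrow> p \<in> \<rho> v" if v: "v \<in> verts G" for v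
  proof (cases "v = u")
    case True
    then show ?thesis using p(1) by simp
  next
    case False
    have F: "v \<in> ?F \<longleftrightarrow> adj G u v \<and> (nmat G u v = CD \<or> nmat G u v = CC \<or>
        nmat G u v = OV \<and> same_side G u x v)"
      using v False by (auto simp: nbh_type_def nbh_def)
    have uv: "u \<noteq> v" using False by simp
    note em = endpoint_mem_cases[OF u v uv a]
    have "v \<in> ?F \<longleftrightarrow> a \<in> \<rho> v"
    proof (cases "nmat G u v")
      case DI
      then show ?thesis using F em(4) by simp
    next
      case CD
      then have "adj G u v" using nmat_CD_iff[of G u v] by simp
      then show ?thesis using F em(1) CD by simp
    next
      case CS
      then show ?thesis using F em(3) by simp
    next
      case CC
      then show ?thesis using F em(2) nmat_CC_D(1)[OF CC] by simp
    next
      case OV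
      then have adj: "adj G u v" using nmat_DI_iff[of G u v] by auto
      then have "v \<in> nbh_type G OV u" using OV v by (simp add: nbh_type_def nbh_def)
      then have "same_side G u x v \<longleftrightarrow> a \<in> \<rho> v"
        using same_side_if_common_endpoint[OF x _ ax] not_same_side_if_distinct_endpoints[OF x _ ax]
        by blast
      then show ?thesis using F OV adj by simp
    qed
    then show ?thesis using p(2)[OF v False] by simp
  qed
  moreover have "?F \<subseteq> verts G" using u by (auto simp: nbh_type_def nbh_def)
  moreover have "p \<in> circle" using p(1) norm_arc(3)[OF u] by blast
  ultimately show ?thesis using N unfolding flip_set_def by blast
qed

end

end

lemma f_U_contains_flip_set:
  assumes "uniform_ca_graph G" "u \<in> verts G" "nbh_type G OV u \<noteq> {}"
  shows "\<exists>X \<in> f_U G. flip_set G X"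
proof -
  have ca: "ca_graph G" and uni: "\<And>T \<rho>. ov_triangle G T \<Longrightarrow> \<rho> \<in> normalized_reps G \<Longrightarrow>
      T \<in> Delta G \<Longrightarrow> nonhelly_triangle (\<rho> ` T)"
    using assms(1) unfolding uniform_ca_graph_def by auto
  have G: "admissible G" using ca by (simp add: ca_graph_def)
  then have sG: "simple_graph G" by (simp add: admissible_def)
  obtain \<rho> where N: "\<rho> \<in> normalized_reps G" using normalized_reps_nonempty[OF ca] by metis
  obtain x where x: "x \<in> nbh_type G OV u" using assms(3) by blast
  note xD = nbh_type_D[OF sG x]
  have un: "nonhelly_triangle (\<rho> ` T)" if "T \<in> Delta G" for T
    using uni[OF _ N that] that by (simp add: Delta_def)
  note one = OV_contains_one_endpoint[OF G N xD(1,2,3,5)]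
  obtain c d where cd: "endpoints (\<rho> u) \<subseteq> {c, d}"
    using endpoints_card2[OF norm_arc(4)[OF G N assms(2)] norm_arc(2)[OF G N assms(2)]] by metis
  obtain a b where a: "a \<in> endpoints (\<rho> u)" "a \<in> \<rho> x" and b: "b \<in> endpoints (\<rho> u)" "b \<notin> \<rho> x"
    using one by blast
  \<comment> \<open>The arc of x contains a but not b, so the two are distinct and exhaust the at
    most two endpoints of u.\<close>
  have "endpoints (\<rho> u) \<subseteq> {a, b}" using cd a b by auto
  then have "flip_set G ({u} \<union> nbh_type G CD u \<union> nbh_type G CC u \<union>
      {y \<in> nbh_type G OV u. same_side G u x y})"
    using a b by (intro flip_set_at_endpoint[OF G N assms(2) _ a(1) b(1) un x a(2)]) auto
  then show ?thesis using assms(2) x unfolding f_U_def by blast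
qed

section \<open>Label independence\<close>

context
  fixes G H :: "'a graph" and \<pi> :: "'a \<Rightarrow> 'a"
  assumes iso: "isomorphism G H \<pi>"
begin

lemma iso_inj: "inj_on \<pi> (verts G)"
  using iso by (simp add: isomorphism_def bij_betw_def)

lemma iso_verts: "verts H = \<pi> ` verts G"
  using iso by (simp add: isomorphism_def bij_betw_def)

lemma iso_adj: "u \<in> verts G \<Longrightarrow> v \<in> verts G \<Longrightarrow> adj H (\<pi> u) (\<pi> v) \<longleftrightarrow> adj G u v"
  using iso by (simp add: isomorphism_def)

lemma iso_mem_image: "A \<subseteq> verts G \<Longrightarrow> v \<in> verts G \<Longrightarrow> \<pi> v \<in> \<pi> ` A \<longleftrightarrow> v \<in> A"
  using inj_on_image_mem_iff[OF iso_inj] by blast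

lemma iso_image_subset: "A \<subseteq> verts G \<Longrightarrow> B \<subseteq> verts G \<Longrightarrow> \<pi> ` A \<subseteq> \<pi> ` B \<longleftrightarrow> A \<subseteq> B"
  by (rule inj_on_image_subset_iff[OF iso_inj])

lemma iso_image_eq: "A \<subseteq> verts G \<Longrightarrow> B \<subseteq> verts G \<Longrightarrow> \<pi> ` A = \<pi> ` B \<longleftrightarrow> A = B"
  by (rule inj_on_image_eq_iff[OF iso_inj])

lemma iso_image_psubset: "A \<subseteq> verts G \<Longrightarrow> B \<subseteq> verts G \<Longrightarrow> \<pi> ` A \<subset> \<pi> ` B \<longleftrightarrow> A \<subset> B"
  using iso_image_subset iso_image_eq by (simp add: psubset_eq)

lemma iso_image_Int: "A \<subseteq> verts G \<Longrightarrow> B \<subseteq> verts G \<Longrightarrow> \<pi> ` (A \<inter> B) = \<pi> ` A \<inter> \<pi> ` B"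
  by (rule inj_on_image_Int[OF iso_inj])

lemma iso_image_Diff: "A \<subseteq> verts G \<Longrightarrow> B \<subseteq> verts G \<Longrightarrow> \<pi> ` (A - B) = \<pi> ` A - \<pi> ` B"
  by (rule inj_on_image_set_diff[OF iso_inj]) auto

lemma iso_Collect:
  assumes "\<And>v. v \<in> verts G \<Longrightarrow> Q (\<pi> v) \<longleftrightarrow> P v"
  shows "{w \<in> verts H. Q w} = \<pi> ` {v \<in> verts G. P v}"
  unfolding iso_verts using assms by auto

lemma iso_nbh: "v \<in> verts G \<Longrightarrow> nbh H (\<pi> v) = \<pi> ` nbh G v"
  unfolding nbh_def by (rule iso_Collect) (simp add: iso_adj)

lemma iso_cnbh: "v \<in> verts G \<Longrightarrow> cnbh H (\<pi> v) = \<pi> ` cnbh G v"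
  by (simp add: cnbh_def iso_nbh)

lemma iso_overlap:
  "A \<subseteq> verts G \<Longrightarrow> B \<subseteq> verts G \<Longrightarrow> overlap (\<pi> ` A) (\<pi> ` B) \<longleftrightarrow> overlap A B"
  unfolding overlap_def by (simp flip: iso_image_Int iso_image_Diff)

text \<open>All tests in \<open>nmat\<close> compare subsets of the vertex set. Injectivity there
  makes images preserve and reflect containment and equality and commute with intersection and
  difference.\<close>

lemma iso_nmat:
  assumes u: "u \<in> verts G" and v: "v \<in> verts G"
  shows "nmat H (\<pi> u) (\<pi> v) = nmat G u v"
proof -
  note sub = cnbh_subset_verts[OF u] cnbh_subset_verts[OF v]
  have un: "cnbh H (\<pi> u) \<union> cnbh H (\<pi> v) = verts H \<longleftrightarrow> cnbh G u \<union> cnbh G v = verts G"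
    using iso_image_eq[of "cnbh G u \<union> cnbh G v" "verts G"] sub
    by (simp add: iso_cnbh u v iso_verts image_Un)
  have ball: "(\<forall>w\<in>cnbh H (\<pi> x) - cnbh H (\<pi> y). cnbh H w \<subset> cnbh H (\<pi> x)) \<longleftrightarrow>
      (\<forall>w\<in>cnbh G x - cnbh G y. cnbh G w \<subset> cnbh G x)" if x: "x \<in> verts G" and y: "y \<in> verts G" for x y
  proof -
    note sub = cnbh_subset_verts[OF x] cnbh_subset_verts[OF y]
    have "cnbh H (\<pi> w) \<subset> cnbh H (\<pi> x) \<longleftrightarrow> cnbh G w \<subset> cnbh G x" if "w \<in> cnbh G x" for w
    proof -
      have w: "w \<in> verts G" using that sub by blast
      show ?thesis
        unfolding iso_cnbh[OF x] iso_cnbh[OF w] by (rule iso_image_psubset[OF cnbh_subset_verts[OF w] sub(1)])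
    qed
    then show ?thesis
      unfolding iso_cnbh[OF x] iso_cnbh[OF y] iso_image_Diff[OF sub, symmetric] by auto
  qed
  show ?thesis
    unfolding nmat_def un ball[OF u v] ball[OF v u]
    unfolding iso_adj[OF u v] iso_cnbh[OF u] iso_cnbh[OF v] iso_overlap[OF sub]
      iso_image_psubset[OF sub] iso_image_psubset[OF sub(2,1)] ..
qed

lemma iso_nbh_type: "u \<in> verts G \<Longrightarrow> nbh_type H t (\<pi> u) = \<pi> ` nbh_type G t u"
proof -
  assume u: "u \<in> verts G"
  have "nbh_type K t x = {v \<in> verts K. adj K x v \<and> nmat K x v = t}" for x and K :: "'a graph"
    by (auto simp: nbh_type_def nbh_def)
  then show ?thesis using u by (simp only: iso_Collect iso_adj iso_nmat)
qed

lemma iso_ov_triangle: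
  assumes "T \<subseteq> verts G"
  shows "ov_triangle H (\<pi> ` T) \<longleftrightarrow> ov_triangle G T"
proof -
  have inj: "inj_on \<pi> T" using inj_on_subset[OF iso_inj assms] .
  have "nmat H (\<pi> u) (\<pi> v) = nmat G u v" "\<pi> u = \<pi> v \<longleftrightarrow> u = v" if "u \<in> T" "v \<in> T" for u v
    using that assms iso_nmat[of u v] inj_on_eq_iff[OF inj that] by auto
  then show ?thesis
    using assms unfolding ov_triangle_def by (auto simp: card_image[OF inj] iso_verts)
qed

lemma iso_excl_nbh:
  assumes "S \<subseteq> verts G" "S' \<subseteq> S"
  shows "excl_nbh H (\<pi> ` S) (\<pi> ` S') = \<pi> ` excl_nbh G S S'"
proof -
  have *: "excl_nbh K S S' = {v \<in> verts K. v \<notin> S \<and> (\<forall>x\<in>S'. adj K v x) \<and> (\<forall>x\<in>S - S'. \<not> adj K v x)}"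
    for K :: "'a graph" and S S' by (auto simp: excl_nbh_def)
  have S': "S' \<subseteq> verts G" using assms by blast
  have d: "\<pi> ` S - \<pi> ` S' = \<pi> ` (S - S')" by (rule iso_image_Diff[OF assms(1) S', symmetric])
  show ?thesis
    unfolding * d
  proof (rule iso_Collect)
    fix v assume v: "v \<in> verts G"
    have "\<pi> v \<in> \<pi> ` S \<longleftrightarrow> v \<in> S" by (rule iso_mem_image[OF assms(1) v])
    moreover have "(\<forall>x\<in>\<pi> ` S'. adj H (\<pi> v) x) \<longleftrightarrow> (\<forall>x\<in>S'. adj G v x)"
      using iso_adj[OF v] S' by auto
    moreover have "(\<forall>x\<in>\<pi> ` (S - S'). \<not> adj H (\<pi> v) x) \<longleftrightarrow> (\<forall>x\<in>S - S'. \<not> adj G v x)"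
      using iso_adj[OF v] assms(1) by auto
    ultimately show "(\<pi> v \<notin> \<pi> ` S \<and> (\<forall>x\<in>\<pi> ` S'. adj H (\<pi> v) x) \<and> (\<forall>x\<in>\<pi> ` (S - S'). \<not> adj H (\<pi> v) x)) \<longleftrightarrow>
      (v \<notin> S \<and> (\<forall>x\<in>S'. adj G v x) \<and> (\<forall>x\<in>S - S'. \<not> adj G v x))" by simp
  qed
qed

lemma iso_Delta:
  assumes T: "T \<subseteq> verts G"
  shows "\<pi> ` T \<in> Delta H \<longleftrightarrow> T \<in> Delta G"
proof -
  have "(\<Union>v\<in>\<pi> ` T. cnbh H v) = \<pi> ` (\<Union>v\<in>T. cnbh G v)"
    using T by (auto simp: iso_cnbh subset_iff)
  moreover have "(\<Union>v\<in>T. cnbh G v) \<subseteq> verts G" using T cnbh_subset_verts[of _ G] by blast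
  ultimately have "(\<Union>v\<in>\<pi> ` T. cnbh H v) = verts H \<longleftrightarrow> (\<Union>v\<in>T. cnbh G v) = verts G"
    using iso_image_eq[of "\<Union>v\<in>T. cnbh G v" "verts G"] by (simp add: iso_verts)
  moreover have "(\<forall>x\<in>\<pi> ` T. \<forall>v\<in>excl_nbh H (\<pi> ` T) {x}. nmat H v x = CD) \<longleftrightarrow>
      (\<forall>x\<in>T. \<forall>v\<in>excl_nbh G T {x}. nmat G v x = CD)"
  proof -
    have "(\<forall>v\<in>excl_nbh H (\<pi> ` T) {\<pi> x}. nmat H v (\<pi> x) = CD) \<longleftrightarrow>
      (\<forall>v\<in>excl_nbh G T {x}. nmat G v x = CD)" if x: "x \<in> T" for x
    proof -
      have "excl_nbh H (\<pi> ` T) {\<pi> x} = \<pi> ` excl_nbh G T {x}"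
        using iso_excl_nbh[of T "{x}"] T x by simp
      moreover have "nmat H (\<pi> v) (\<pi> x) = nmat G v x" if "v \<in> excl_nbh G T {x}" for v
        using that x T iso_nmat[of v x] by (auto simp: excl_nbh_def)
      ultimately show ?thesis by simp
    qed
    then show ?thesis by simp
  qed
  ultimately show ?thesis unfolding Delta_def by (simp add: iso_ov_triangle[OF T])
qed

lemma iso_in_between:
  assumes V: "a \<in> verts G" "b \<in> verts G" "c \<in> verts G"
  shows "in_between H (\<pi> b) (\<pi> a) (\<pi> c) \<longleftrightarrow> in_between G b a c"
proof -
  have T: "{a, b, c} \<subseteq> verts G" using V by simp
  have im: "{\<pi> a, \<pi> b, \<pi> c} = \<pi> ` {a, b, c}" by simp
  have ex: "excl_nbh H {\<pi> a, \<pi> b, \<pi> c} {\<pi> a} = \<pi> ` excl_nbh G {a, b, c} {a}"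
     "excl_nbh H {\<pi> a, \<pi> b, \<pi> c} {\<pi> c} = \<pi> ` excl_nbh G {a, b, c} {c}"
     "excl_nbh H {\<pi> a, \<pi> b, \<pi> c} {\<pi> a, \<pi> c} = \<pi> ` excl_nbh G {a, b, c} {a, c}"
    using iso_excl_nbh[OF T, of "{a}"] iso_excl_nbh[OF T, of "{c}"] iso_excl_nbh[OF T, of "{a, c}"]
    by simp_all
  have D: "{\<pi> a, \<pi> c, \<pi> z} \<in> Delta H \<longleftrightarrow> {a, c, z} \<in> Delta G" if "z \<in> verts G" for z
    using iso_Delta[of "{a, c, z}"] V that by simp
  have "(\<exists>z\<in>excl_nbh H {\<pi> a, \<pi> b, \<pi> c} {\<pi> a, \<pi> c}. {\<pi> a, \<pi> c, z} \<in> Delta H) \<longleftrightarrow>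
    (\<exists>z\<in>excl_nbh G {a, b, c} {a, c}. {a, c, z} \<in> Delta G)"
  proof -
    have "z \<in> verts G" if "z \<in> excl_nbh G {a, b, c} {a, c}" for z
      using that by (simp add: excl_nbh_def)
    then show ?thesis unfolding ex by (auto simp: D)
  qed
  then show ?thesis
    unfolding in_between_def ex(1,2) unfolding im iso_ov_triangle[OF T] iso_Delta[OF T] by simp
qed

lemma iso_same_side:
  assumes V: "u \<in> verts G" "x \<in> verts G" "y \<in> verts G"
  shows "same_side H (\<pi> u) (\<pi> x) (\<pi> y) \<longleftrightarrow> same_side G u x y"
proof -
  have sub: "nbh_type G OV u \<subseteq> verts G" by (auto simp: nbh_type_def nbh_def)
  have D: "{\<pi> x, \<pi> y, \<pi> u} \<in> Delta H \<longleftrightarrow> {x, y, u} \<in> Delta G"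
    using iso_Delta[of "{x, y, u}"] V by simp
  have eq: "\<pi> x = \<pi> y \<longleftrightarrow> x = y" using inj_on_eq_iff[OF iso_inj] V by simp
  show ?thesis
    unfolding same_side_def iso_nbh_type[OF V(1)] iso_mem_image[OF sub V(2)] iso_mem_image[OF sub V(3)]
      iso_nmat[OF V(2,3)] D eq iso_in_between[OF V(2,1,3)] ..
qed

lemma iso_f_U: "f_U H = {\<pi> ` X | X. X \<in> f_U G}"
proof -
  define F where "F K u x = {u} \<union> nbh_type K CD u \<union> nbh_type K CC u \<union>
    {y \<in> nbh_type K OV u. same_side K u x y}" for K :: "'a graph" and u x
  have f: "f_U K = {F K u x | u x. u \<in> verts K \<and> x \<in> nbh_type K OV u}" for K :: "'a graph"
    unfolding f_U_def F_def by blast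
  have F: "F H (\<pi> u) (\<pi> x) = \<pi> ` F G u x" if u: "u \<in> verts G" and x: "x \<in> verts G" for u x
  proof -
    have "{y \<in> \<pi> ` nbh_type G OV u. same_side H (\<pi> u) (\<pi> x) y} =
        \<pi> ` {y \<in> nbh_type G OV u. same_side G u x y}"
    proof -
      have "y \<in> verts G" if "y \<in> nbh_type G OV u" for y
        using that by (simp add: nbh_type_def nbh_def)
      then show ?thesis using iso_same_side[OF u x] by auto
    qed
    then show ?thesis unfolding F_def iso_nbh_type[OF u] by (simp add: image_Un)
  qed
  have sub: "nbh_type G OV u \<subseteq> verts G" for u by (auto simp: nbh_type_def nbh_def)
  have "f_U H = {F H (\<pi> u) (\<pi> x) | u x. u \<in> verts G \<and> x \<in> nbh_type G OV u}"
    unfolding f iso_verts using iso_nbh_type by (auto 0 3)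
  also have "\<dots> = {\<pi> ` F G u x | u x. u \<in> verts G \<and> x \<in> nbh_type G OV u}"
    using F sub by (metis (no_types, opaque_lifting) subsetD)
  also have "\<dots> = {\<pi> ` X | X. X \<in> f_U G}"
    unfolding f by blast
  finally show ?thesis .
qed

end

lemma label_independent_f_U: "label_independent f_U"
  unfolding label_independent_def using iso_f_U by blast

lemma f_U_subset_Pow: "f_U G \<subseteq> Pow (verts G)"
  by (auto simp: f_U_def nbh_type_def nbh_def)

text \<open>The class is restricted to graphs with a pair in relation OV, since otherwise the family
  is empty and offers no flip set.\<close>

lemma candidate_function_f_U:
  "candidate_function (f_U :: 'a graph \<Rightarrow> 'a set set)
     {G. uniform_ca_graph G \<and> (\<exists>u \<in> verts G. nbh_type G OV u \<noteq> {})}"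
  unfolding candidate_function_def
proof (intro conjI allI impI ballI f_U_subset_Pow label_independent_f_U)
  fix G :: "'a graph"
  assume "G \<in> {G. uniform_ca_graph G \<and> (\<exists>u \<in> verts G. nbh_type G OV u \<noteq> {})}"
  then obtain u where "uniform_ca_graph G" "u \<in> verts G" "nbh_type G OV u \<noteq> {}" by blast
  then show "\<exists>X \<in> f_U G. flip_set G X" by (rule f_U_contains_flip_set)
qed

section \<open>Programs compiled to machines\<close>

text \<open>Programs for machines with one work tape, whose cells hold finite sets of natural numbers.\<close>

datatype prog =
  Act "nat set \<Rightarrow> nat set" direction direction "symbol option"
| Seq prog prog
| If "cell \<Rightarrow> nat set \<Rightarrow> bool" prog prog
| While "cell \<Rightarrow> nat set \<Rightarrow> bool" prog

fun wf_prog :: "nat \<Rightarrow> prog \<Rightarrow> bool" where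
  "wf_prog W (Act f d e x) \<longleftrightarrow> (\<forall>s \<subseteq> {..<W}. f s \<subseteq> {..<W})"
| "wf_prog W (Seq p q) \<longleftrightarrow> wf_prog W p \<and> wf_prog W q"
| "wf_prog W (If b p q) \<longleftrightarrow> wf_prog W p \<and> wf_prog W q"
| "wf_prog W (While b p) \<longleftrightarrow> wf_prog W p"

text \<open>Input head, work head, work tape and output.\<close>

type_synonym store = "nat \<times> nat \<times> (nat \<Rightarrow> nat set) \<times> symbol list"

text \<open>Big-step semantics. Since B bounds the work head after every action, a derivation
  certifies termination and space at once.\<close>

inductive exec :: "symbol list \<Rightarrow> nat \<Rightarrow> prog \<Rightarrow> store \<Rightarrow> store \<Rightarrow> bool" for w B where
  Act: "move_head e h < B \<Longrightarrow> exec w B (Act f d e x) (i, h, t, out)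
    (min (Suc (length w)) (move_head d i), move_head e h, t(h := f (t h)),
     out @ (case x of None \<Rightarrow> [] | Some s \<Rightarrow> [s]))"
| Seq: "exec w B p \<sigma> \<sigma>' \<Longrightarrow> exec w B q \<sigma>' \<sigma>'' \<Longrightarrow> exec w B (Seq p q) \<sigma> \<sigma>''"
| IfT: "b (input_cell w i) (t h) \<Longrightarrow> exec w B p (i, h, t, out) \<sigma> \<Longrightarrow> exec w B (If b p q) (i, h, t, out) \<sigma>"
| IfF: "\<not> b (input_cell w i) (t h) \<Longrightarrow> exec w B q (i, h, t, out) \<sigma> \<Longrightarrow> exec w B (If b p q) (i, h, t, out) \<sigma>"
| WhileF: "\<not> b (input_cell w i) (t h) \<Longrightarrow> exec w B (While b p) (i, h, t, out) (i, h, t, out)"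
| WhileT: "b (input_cell w i) (t h) \<Longrightarrow> exec w B p (i, h, t, out) \<sigma> \<Longrightarrow>
    exec w B (While b p) \<sigma> \<sigma>' \<Longrightarrow> exec w B (While b p) (i, h, t, out) \<sigma>'"

lemma exec_ActI:
  assumes "move_head e h < B" "i' = min (Suc (length w)) (move_head d i)" "h' = move_head e h"
    "t' = t(h := f (t h))" "out' = out @ (case x of None \<Rightarrow> [] | Some s \<Rightarrow> [s])"
  shows "exec w B (Act f d e x) (i, h, t, out) (i', h', t', out')"
  unfolding assms(2-5) using assms(1) by (rule exec.Act)

text \<open>The control state of the compiled machine is the stack of programs still to be run.\<close>

fun next_stack :: "prog list \<Rightarrow> cell \<Rightarrow> nat set \<Rightarrow>
    (prog list \<times> direction \<times> nat set \<times> direction \<times> symbol option) option" where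
  "next_stack [] c s = None"
| "next_stack (Act f d e x # ks) c s = Some (ks, d, f s, e, x)"
| "next_stack (Seq p q # ks) c s = Some (p # q # ks, Stay, s, Stay, None)"
| "next_stack (If b p q # ks) c s = Some ((if b c s then p else q) # ks, Stay, s, Stay, None)"
| "next_stack (While b p # ks) c s =
     Some (if b c s then p # While b p # ks else ks, Stay, s, Stay, None)"

text \<open>The control states met while p runs above the continuation ks, excluding ks itself.
  There are finitely many because a loop returns to its own stack.\<close>

fun stacks :: "prog \<Rightarrow> prog list \<Rightarrow> prog list set" where
  "stacks (Act f d e x) ks = {Act f d e x # ks}"
| "stacks (Seq p q) ks = insert (Seq p q # ks) (stacks p (q # ks) \<union> stacks q ks)"
| "stacks (If b p q) ks = insert (If b p q # ks) (stacks p ks \<union> stacks q ks)"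
| "stacks (While b p) ks = insert (While b p # ks) (stacks p (While b p # ks))"

lemma finite_stacks: "finite (stacks p ks)"
  by (induction p ks rule: stacks.induct) auto

lemma Cons_in_stacks: "p # ks \<in> stacks p ks"
  by (cases p) auto

lemma stacks_closed:
  "S \<in> stacks p ks \<Longrightarrow> next_stack S c s = Some (S', a) \<Longrightarrow> S' \<in> insert ks (stacks p ks)"
proof (induction p ks arbitrary: S rule: stacks.induct)
  case (2 p q ks)
  then show ?case using Cons_in_stacks[of p "q # ks"] Cons_in_stacks[of q ks] by auto
next
  case (3 b p q ks)
  then show ?case using Cons_in_stacks[of p ks] Cons_in_stacks[of q ks] by (auto split: if_splits)
next
  case (4 b p ks)
  then show ?case using Cons_in_stacks[of p "While b p # ks"] by (auto split: if_splits)
qed auto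

lemma stacks_wf:
  "wf_prog W p \<Longrightarrow> list_all (wf_prog W) ks \<Longrightarrow> S \<in> stacks p ks \<Longrightarrow> list_all (wf_prog W) S"
  by (induction p ks arbitrary: S rule: stacks.induct) auto

lemma next_stack_wf:
  assumes "list_all (wf_prog W) S" "s \<subseteq> {..<W}" "next_stack S c s = Some (S', d, s', e, x)"
  shows "s' \<subseteq> {..<W}"
  using assms by (induction S c s rule: next_stack.induct) (auto split: if_splits)

text \<open>Stacks are numbered by \<open>enc\<close> and cell contents by
  \<open>set_encode\<close>, which sends the empty set to 0, the blank. The empty stack is the
  halting state.\<close>

definition machine_of :: "nat \<Rightarrow> prog \<Rightarrow> (prog list \<Rightarrow> nat) \<Rightarrow> machine" where
  "machine_of W p enc = (let Q = insert [] (stacks p []) in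
     \<lparr>num_tapes = 1, states = enc ` Q, work_symbols = set_encode ` Pow {..<W},
      init_state = enc [p],
      transition = (\<lambda>q c ss. case next_stack (inv_into Q enc q) c (set_decode (hd ss)) of
         None \<Rightarrow> None
       | Some (S, d, s, e, x) \<Rightarrow> Some (enc S, d, [(set_encode s, e)], x))\<rparr>)"

context
  fixes W :: nat and p0 :: prog and enc :: "prog list \<Rightarrow> nat"
  assumes wf: "wf_prog W p0" and inj: "inj_on enc (insert [] (stacks p0 []))"
begin

abbreviation states0 :: "prog list set" where "states0 \<equiv> insert [] (stacks p0 [])"

lemma states_closed:
  "S \<in> states0 \<Longrightarrow> next_stack S c s = Some (S', a) \<Longrightarrow> S' \<in> states0"
  using stacks_closed[of S p0 "[]" c s S' a] by (cases "S = []") simp_all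

lemma states_wf: "S \<in> states0 \<Longrightarrow> list_all (wf_prog W) S"
  using stacks_wf[OF wf, of "[]" S] by auto

lemma set_decode_symbol: "a \<in> set_encode ` Pow {..<W} \<Longrightarrow> set_decode a \<subseteq> {..<W}"
  using finite_subset[of _ "{..<W}"] by auto

lemma wf_machine_of: "wf_machine (machine_of W p0 enc)"
  unfolding wf_machine_def
proof (intro conjI allI impI)
  show "finite (states (machine_of W p0 enc))"
    by (simp add: machine_of_def Let_def finite_stacks)
  show "init_state (machine_of W p0 enc) \<in> states (machine_of W p0 enc)"
    using Cons_in_stacks[of p0 "[]"] by (auto simp: machine_of_def Let_def)
  show "finite (work_symbols (machine_of W p0 enc))"
    by (simp add: machine_of_def Let_def)
  show "0 \<in> work_symbols (machine_of W p0 enc)"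
    by (auto simp: machine_of_def Let_def image_iff intro!: bexI[of _ "{}"])
  fix q c ss q' d acts out
  assume q: "q \<in> states (machine_of W p0 enc)"
    and len: "length ss = num_tapes (machine_of W p0 enc)"
    and ss: "set ss \<subseteq> work_symbols (machine_of W p0 enc)"
    and tr: "transition (machine_of W p0 enc) q c ss = Some (q', d, acts, out)"
  obtain S where S: "S \<in> states0" "q = enc S"
    using q by (auto simp: machine_of_def Let_def)
  have inv: "inv_into states0 enc q = S"
    using S inj by (simp add: inv_into_f_f)
  obtain S' s' e where n: "next_stack S c (set_decode (hd ss)) = Some (S', d, s', e, out)"
    "q' = enc S'" "acts = [(set_encode s', e)]"
    using tr by (auto simp: machine_of_def Let_def inv split: option.splits)
  have "hd ss \<in> set ss" using len by (cases ss) (auto simp: machine_of_def Let_def)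
  then have "set_decode (hd ss) \<subseteq> {..<W}"
    using ss by (intro set_decode_symbol) (auto simp: machine_of_def Let_def)
  then have "s' \<subseteq> {..<W}" by (rule next_stack_wf[OF states_wf[OF S(1)] _ n(1)])
  then show "fst ` set acts \<subseteq> work_symbols (machine_of W p0 enc)"
    using n(3) by (simp add: machine_of_def Let_def)
  show "q' \<in> states (machine_of W p0 enc)"
    using states_closed[OF S(1) n(1)] n(2) by (auto simp: machine_of_def Let_def)
  show "length acts = num_tapes (machine_of W p0 enc)"
    using n(3) by (simp add: machine_of_def Let_def)
qed

fun conf :: "prog list \<Rightarrow> store \<Rightarrow> config" where
  "conf S (i, h, t, out) = (enc S, i, [(h, \<lambda>k. set_encode (t k))], out)"

definition ok :: "nat \<Rightarrow> store \<Rightarrow> bool" where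
  "ok B \<sigma> \<longleftrightarrow> (case \<sigma> of (i, h, t, out) \<Rightarrow> h < B \<and> (\<forall>k. t k \<subseteq> {..<W}))"

lemma step_conf:
  assumes S: "S \<in> states0" and t: "\<And>k. t k \<subseteq> {..<W}"
  shows "step (machine_of W p0 enc) w (conf S (i, h, t, out)) =
    (case next_stack S (input_cell w i) (t h) of
       None \<Rightarrow> None
     | Some (S', d, s, e, x) \<Rightarrow>
         Some (conf S' (min (Suc (length w)) (move_head d i), move_head e h, t(h := s),
           out @ (case x of None \<Rightarrow> [] | Some s \<Rightarrow> [s]))))"
proof -
  have "finite (t h)" using t finite_subset by blast
  then show ?thesis
    using inj S
    by (auto simp: machine_of_def Let_def inv_into_f_f fun_eq_iff split: option.split)
qed

definition bounded_step :: "symbol list \<Rightarrow> nat \<Rightarrow> config \<Rightarrow> config \<Rightarrow> bool" where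
  "bounded_step w B c c' \<longleftrightarrow> step (machine_of W p0 enc) w c = Some c' \<and>
     (\<forall>(h, t) \<in> set (fst (snd (snd c))). h < B)"

lemma bounded_stepI:
  assumes "S \<in> states0" "ok B (i, h, t, out)"
    "next_stack S (input_cell w i) (t h) = Some (S', d, s, e, x)"
  shows "bounded_step w B (conf S (i, h, t, out))
    (conf S' (min (Suc (length w)) (move_head d i), move_head e h, t(h := s),
       out @ (case x of None \<Rightarrow> [] | Some s \<Rightarrow> [s])))"
  using assms(2,3) step_conf[OF assms(1), of t w i h out]
  unfolding bounded_step_def ok_def by auto

lemma bounded_step_silentI:
  assumes "S \<in> states0" "ok B (i, h, t, out)" "i \<le> Suc (length w)"
    "next_stack S (input_cell w i) (t h) = Some (S', Stay, t h, Stay, None)"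
  shows "bounded_step w B (conf S (i, h, t, out)) (conf S' (i, h, t, out))"
  using bounded_stepI[OF assms(1,2,4)] assms(3)
  by (simp only: move_head.simps min_absorb2 fun_upd_triv option.case append_Nil2)

text \<open>Rule induction turns a big-step derivation into a chain of machine steps. The hypothesis
  on \<open>stacks\<close> keeps all intermediate stacks among the numbered states.\<close>

lemma exec_imp_bounded_steps:
  assumes "exec w B p \<sigma> \<sigma>'" "stacks p ks \<subseteq> stacks p0 []" "ks \<in> states0"
    "wf_prog W p" "ok B \<sigma>" "fst \<sigma> \<le> Suc (length w)"
  shows "(bounded_step w B)\<^sup>*\<^sup>* (conf (p # ks) \<sigma>) (conf ks \<sigma>') \<and> ok B \<sigma>' \<and> fst \<sigma>' \<le> Suc (length w)"
  using assms
proof (induction arbitrary: ks rule: exec.induct)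
  case (Act e h f d x i t out)
  have "Act f d e x # ks \<in> states0" using Act by auto
  then have "bounded_step w B (conf (Act f d e x # ks) (i, h, t, out))
    (conf ks (min (Suc (length w)) (move_head d i), move_head e h, t(h := f (t h)),
       out @ (case x of None \<Rightarrow> [] | Some s \<Rightarrow> [s])))"
    using Act by (intro bounded_stepI) auto
  moreover have "ok B (min (Suc (length w)) (move_head d i), move_head e h, t(h := f (t h)),
       out @ (case x of None \<Rightarrow> [] | Some s \<Rightarrow> [s]))"
    using Act unfolding ok_def by simp
  ultimately show ?case by auto
next
  case (Seq p \<sigma> \<sigma>' q \<sigma>'')
  obtain i h t out where \<sigma>: "\<sigma> = (i, h, t, out)" by (cases \<sigma>)
  have sub: "stacks p (q # ks) \<subseteq> stacks p0 []" "stacks q ks \<subseteq> stacks p0 []"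
    "Seq p q # ks \<in> states0" "q # ks \<in> states0"
    using Seq.prems(1) Cons_in_stacks[of q ks] by auto
  have "bounded_step w B (conf (Seq p q # ks) \<sigma>) (conf (p # q # ks) \<sigma>)"
    unfolding \<sigma> using Seq.prems(4,5) sub(3) \<sigma> by (intro bounded_step_silentI) auto
  moreover have 1: "(bounded_step w B)\<^sup>*\<^sup>* (conf (p # q # ks) \<sigma>) (conf (q # ks) \<sigma>') \<and>
      ok B \<sigma>' \<and> fst \<sigma>' \<le> Suc (length w)"
    using Seq.prems sub by (intro Seq.IH(1)) auto
  moreover have "(bounded_step w B)\<^sup>*\<^sup>* (conf (q # ks) \<sigma>') (conf ks \<sigma>'') \<and>
      ok B \<sigma>'' \<and> fst \<sigma>'' \<le> Suc (length w)"
    using Seq.prems sub 1 by (intro Seq.IH(2)) auto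
  ultimately show ?case by (meson converse_rtranclp_into_rtranclp rtranclp_trans)
next
  case (IfT b i t h p out \<sigma> q)
  have sub: "stacks p ks \<subseteq> stacks p0 []" "If b p q # ks \<in> states0"
    using IfT.prems(1) by auto
  have "bounded_step w B (conf (If b p q # ks) (i, h, t, out)) (conf (p # ks) (i, h, t, out))"
    using IfT.prems(4,5) IfT.hyps(1) sub(2) by (intro bounded_step_silentI) auto
  moreover have "(bounded_step w B)\<^sup>*\<^sup>* (conf (p # ks) (i, h, t, out)) (conf ks \<sigma>) \<and>
      ok B \<sigma> \<and> fst \<sigma> \<le> Suc (length w)"
    using IfT.prems sub by (intro IfT.IH) auto
  ultimately show ?case by (meson converse_rtranclp_into_rtranclp)
next
  case (IfF b i t h q out \<sigma> p)
  have sub: "stacks q ks \<subseteq> stacks p0 []" "If b p q # ks \<in> states0"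
    using IfF.prems(1) by auto
  have "bounded_step w B (conf (If b p q # ks) (i, h, t, out)) (conf (q # ks) (i, h, t, out))"
    using IfF.prems(4,5) IfF.hyps(1) sub(2) by (intro bounded_step_silentI) auto
  moreover have "(bounded_step w B)\<^sup>*\<^sup>* (conf (q # ks) (i, h, t, out)) (conf ks \<sigma>) \<and>
      ok B \<sigma> \<and> fst \<sigma> \<le> Suc (length w)"
    using IfF.prems sub by (intro IfF.IH) auto
  ultimately show ?case by (meson converse_rtranclp_into_rtranclp)
next
  case (WhileF b i t h p out)
  have sub: "While b p # ks \<in> states0" using WhileF.prems(1) by auto
  have "bounded_step w B (conf (While b p # ks) (i, h, t, out)) (conf ks (i, h, t, out))"
    using WhileF.prems(4,5) WhileF.hyps(1) sub by (intro bounded_step_silentI) auto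
  then show ?case using WhileF.prems(4,5) by auto
next
  case (WhileT b i t h p out \<sigma> \<sigma>')
  have sub: "While b p # ks \<in> states0" "stacks p (While b p # ks) \<subseteq> stacks p0 []"
    using WhileT.prems(1) by auto
  have "bounded_step w B (conf (While b p # ks) (i, h, t, out)) (conf (p # While b p # ks) (i, h, t, out))"
    using WhileT.prems(4,5) WhileT.hyps(1) sub(1) by (intro bounded_step_silentI) auto
  moreover have 1: "(bounded_step w B)\<^sup>*\<^sup>* (conf (p # While b p # ks) (i, h, t, out))
        (conf (While b p # ks) \<sigma>) \<and> ok B \<sigma> \<and> fst \<sigma> \<le> Suc (length w)"
    using WhileT.prems sub by (intro WhileT.IH(1)) auto
  moreover have "(bounded_step w B)\<^sup>*\<^sup>* (conf (While b p # ks) \<sigma>) (conf ks \<sigma>') \<and>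
      ok B \<sigma>' \<and> fst \<sigma>' \<le> Suc (length w)"
    using WhileT.prems 1 by (intro WhileT.IH(2)) auto
  ultimately show ?case by (meson converse_rtranclp_into_rtranclp rtranclp_trans)
qed

lemma exec_imp_halts:
  assumes ex: "exec w B p0 (0, 0, \<lambda>_. {}, []) (i, h, t, out)" and B: "0 < B"
  shows "halts_with (machine_of W p0 enc) w out \<and> within_space (machine_of W p0 enc) w B"
proof -
  let ?M = "machine_of W p0 enc"
  have init: "init_config ?M = conf [p0] (0, 0, \<lambda>_. {}, [])"
    by (simp add: init_config_def machine_of_def Let_def)
  have run: "(bounded_step w B)\<^sup>*\<^sup>* (init_config ?M) (conf [] (i, h, t, out))" and ok: "ok B (i, h, t, out)"
    using exec_imp_bounded_steps[OF ex, of "[]"] wf B unfolding init by (auto simp: ok_def)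
  have fin: "step ?M w (conf [] (i, h, t, out)) = None"
    using step_conf[of "[]" t w i h out] ok by (simp add: ok_def)
  have "reachable ?M w (conf [] (i, h, t, out))"
    unfolding reachable_def using run
    by (rule mono_rtranclp[rule_format, rotated]) (simp add: bounded_step_def)
  then have "halts_with ?M w out"
    unfolding halts_with_def using fin by (auto simp del: step.simps)
  \<comment> \<open>The machine is deterministic and the final configuration has no successor, so
    every reachable configuration lies on the run to it. The space bound of the run thus holds for
    all reachable configurations.\<close>
  moreover have path: "(bounded_step w B)\<^sup>*\<^sup>* c (conf [] (i, h, t, out))" if "reachable ?M w c" for c
    using that unfolding reachable_def
  proof (induction rule: rtranclp_induct)
    case base
    then show ?case by (rule run)
  next
    case (step c c')
    from step.IH obtain c'' where "bounded_step w B c c''" "(bounded_step w B)\<^sup>*\<^sup>* c'' (conf [] (i, h, t, out))"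
    proof (cases rule: converse_rtranclpE)
      case base
      then show ?thesis using step.hyps(2) fin by simp
    qed blast
    then show ?case using step.hyps(2) unfolding bounded_step_def by auto
  qed
  have "within_space ?M w B"
    unfolding within_space_def
  proof (intro allI impI)
    fix q i' tps out' assume "reachable ?M w (q, i', tps, out')"
    from path[OF this] show "\<forall>(h, t)\<in>set tps. h < B"
    proof (cases rule: converse_rtranclpE)
      case base
      then show ?thesis using ok by (auto simp: ok_def)
    next
      case (step c)
      then show ?thesis unfolding bounded_step_def by simp
    qed
  qed
  ultimately show ?thesis by blast
qed

end

lemma logspace_computableI:
  assumes "wf_prog W p"
    and "\<And>x. x \<in> D \<Longrightarrow> \<exists>i h t out. spec x out \<and>
      exec (enc x) (c * Suc (floorlog 2 (length (enc x)))) p (0, 0, \<lambda>_. {}, []) (i, h, t, out)"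
    and "c > 0"
  shows "logspace_computable D enc spec"
proof -
  have "finite (insert [] (stacks p []))" by (simp add: finite_stacks)
  then obtain f :: "prog list \<Rightarrow> nat" where f: "inj_on f (insert [] (stacks p []))"
    using finite_imp_inj_to_nat_seg by metis
  show ?thesis
    unfolding logspace_computable_def
  proof (intro exI[of _ "machine_of W p f"] exI[of _ c] conjI ballI)
    show "wf_machine (machine_of W p f)" by (rule wf_machine_of[OF assms(1) f])
    fix x assume "x \<in> D"
    then obtain i h t out where *: "spec x out"
      "exec (enc x) (c * Suc (floorlog 2 (length (enc x)))) p (0, 0, \<lambda>_. {}, []) (i, h, t, out)"
      using assms(2) by blast
    have "0 < c * Suc (floorlog 2 (length (enc x)))" using assms(3) by simp
    from exec_imp_halts[OF assms(1) f *(2) this]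
    show "within_space (machine_of W p f) (enc x) (c * Suc (floorlog 2 (length (enc x))))"
      "\<exists>out. halts_with (machine_of W p f) (enc x) out \<and> spec x out"
      using *(1) by blast+
  qed
qed

section \<open>Binary counters on the work tape\<close>

lemma not_bit_if_less: "(n::nat) < 2 ^ K \<Longrightarrow> K \<le> k \<Longrightarrow> \<not> bit n k"
  by (metis bit_iff_odd div_less even_zero order.strict_trans2 power_increasing one_le_numeral)

text \<open>Here j is the lowest zero bit of n, where the carry of the increment stops.\<close>

lemma bit_Suc_carry:
  "(\<forall>i<j. bit n i) \<Longrightarrow> \<not> bit n j \<Longrightarrow> bit (Suc n) k \<longleftrightarrow> (if k < j then False else k = j \<or> bit n k)"
proof (induction j arbitrary: n k)
  case 0
  then have ev: "even n" by (simp add: bit_0)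
  then have "Suc n div 2 = n div 2" by simp
  then show ?case using ev by (cases k) (auto simp: bit_0 bit_Suc)
next
  case (Suc j)
  have odd: "odd n" using Suc.prems(1) by (auto simp: bit_0)
  then have half: "Suc n div 2 = Suc (n div 2)" by simp
  have "\<forall>i<j. bit (n div 2) i" "\<not> bit (n div 2) j"
    using Suc.prems by (auto simp flip: bit_Suc)
  then have IH: "bit (Suc (n div 2)) k = (if k < j then False else k = j \<or> bit (n div 2) k)" for k
    by (rule Suc.IH)
  show ?case using odd by (cases k) (auto simp: bit_0 bit_Suc half IH)
qed

text \<open>Cells \<open>0..<K\<close> form a ruler: element \<open>0\<close> marks them, element \<open>1\<close> marks the first of them,
  element \<open>2\<close> of the first one is a flag, and elements \<open>r + 3\<close> spell the binary representation of
  register \<open>r\<close>, least significant bit first.\<close>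

definition tape :: "nat \<Rightarrow> nat \<Rightarrow> (nat \<Rightarrow> nat) \<Rightarrow> bool \<Rightarrow> nat \<Rightarrow> nat set" where
  "tape R K e b k = (if k < K then insert 0 ((if k = 0 then {1} else {}) \<union>
     (if k = 0 \<and> b then {2} else {}) \<union> {r + 3 | r. r < R \<and> bit (e r) k}) else {})"

lemma in_tape [simp]:
  "0 \<in> tape R K e b k \<longleftrightarrow> k < K"
  "Suc 0 \<in> tape R K e b k \<longleftrightarrow> k < K \<and> k = 0"
  "2 \<in> tape R K e b k \<longleftrightarrow> k < K \<and> k = 0 \<and> b"
  "Suc (Suc (Suc r)) \<in> tape R K e b k \<longleftrightarrow> k < K \<and> r < R \<and> bit (e r) k"
  "r + 3 \<in> tape R K e b k \<longleftrightarrow> k < K \<and> r < R \<and> bit (e r) k"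
  by (auto simp: tape_def)

lemma tape_eqI:
  assumes "0 \<in> X \<longleftrightarrow> k < K" "Suc 0 \<in> X \<longleftrightarrow> k < K \<and> k = 0" "2 \<in> X \<longleftrightarrow> k < K \<and> k = 0 \<and> b"
    "\<And>r. r + 3 \<in> X \<longleftrightarrow> k < K \<and> r < R \<and> bit (e r) k"
  shows "X = tape R K e b k"
proof (rule set_eqI)
  fix m
  consider "m = 0" | "m = Suc 0" | "m = 2" | r where "m = r + 3"
    by (metis One_nat_def add.commute le_Suc_ex less_2_cases not_less numeral_3_eq_3 numeral_2_eq_2 less_antisym)
  then show "m \<in> X \<longleftrightarrow> m \<in> tape R K e b k" using assms by cases simp_all
qed

definition skip :: prog where "skip = Act (\<lambda>s. s) Stay Stay None"

definition rewind :: prog where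
  "rewind = While (\<lambda>c s. Suc 0 \<notin> s) (Act (\<lambda>s. s) Stay GoLeft None)"

definition set_flag :: "bool \<Rightarrow> prog" where
  "set_flag b = Act (\<lambda>s. if b then insert 2 s else s - {2}) Stay Stay None"

definition negate_flag :: prog where
  "negate_flag = Act (\<lambda>s. if 2 \<in> s then s - {2} else insert 2 s) Stay Stay None"

definition clear :: "nat \<Rightarrow> prog" where
  "clear r = Seq (While (\<lambda>c s. 0 \<in> s) (Act (\<lambda>s. s - {r + 3}) Stay GoRight None)) rewind"

text \<open>On an overflow the ruler is extended by one cell.\<close>

definition incr :: "nat \<Rightarrow> prog" where
  "incr r = Seq (While (\<lambda>c s. r + 3 \<in> s) (Act (\<lambda>s. s - {r + 3}) Stay GoRight None))
     (Seq (Act (\<lambda>s. insert 0 (insert (r + 3) s)) Stay Stay None) rewind)"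

text \<open>The scan stops at the first difference or just past the ruler. The outcome is visible
  only there, so it is remembered by the branch taken while the head rewinds to the flag.\<close>

definition eq_test :: "nat \<Rightarrow> nat \<Rightarrow> prog" where
  "eq_test r r' = Seq
     (While (\<lambda>c s. 0 \<in> s \<and> (r + 3 \<in> s \<longleftrightarrow> r' + 3 \<in> s)) (Act (\<lambda>s. s) Stay GoRight None))
     (If (\<lambda>c s. 0 \<in> s) (Seq rewind (set_flag False)) (Seq rewind (set_flag True)))"

definition emit :: "symbol \<Rightarrow> prog" where "emit s = Act (\<lambda>s. s) Stay Stay (Some s)"

definition input_right :: prog where "input_right = Act (\<lambda>s. s) GoRight Stay None"

definition rewind_input :: prog where
  "rewind_input = While (\<lambda>c s. c \<noteq> LeftEnd) (Act (\<lambda>s. s) GoLeft Stay None)"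

definition seek_sep :: prog where
  "seek_sep = While (\<lambda>c s. c \<noteq> Letter Sep) input_right"

definition input_test :: prog where
  "input_test = If (\<lambda>c s. c = Letter One) (set_flag True) (set_flag False)"

definition if_flag :: "prog \<Rightarrow> prog \<Rightarrow> prog" where "if_flag p q = If (\<lambda>c s. 2 \<in> s) p q"

definition until_flag :: "prog \<Rightarrow> prog" where "until_flag p = While (\<lambda>c s. 2 \<notin> s) p"

text \<open>The test before the loop takes care of the bound 0.\<close>

definition upto :: "nat \<Rightarrow> nat \<Rightarrow> prog \<Rightarrow> prog" where
  "upto v r p = Seq (clear v) (Seq (eq_test v r)
     (until_flag (Seq p (Seq (incr v) (eq_test v r)))))"

text \<open>The row is reached by passing as many separators as register r says, the column by
  stepping over as many letters as register r' says, with v as the counter. The first move leaves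
  the left end marker.\<close>

definition read_entry :: "nat \<Rightarrow> nat \<Rightarrow> nat \<Rightarrow> prog" where
  "read_entry v r r' = Seq input_right (Seq (upto v r (Seq seek_sep input_right))
     (Seq (upto v r' input_right) (Seq input_test rewind_input)))"

section \<open>Execution of the basic tape operations\<close>

lemma exec_sweep:
  assumes "h + m < B" "i \<le> Suc (length w)" "\<And>k. h \<le> k \<Longrightarrow> k < h + m \<Longrightarrow> b (input_cell w i) (t k)"
    "\<not> b (input_cell w i) (t (h + m))"
  shows "exec w B (While b (Act f Stay GoRight None)) (i, h, t, out)
    (i, h + m, \<lambda>k. if h \<le> k \<and> k < h + m then f (t k) else t k, out)"
  using assms
proof (induction m arbitrary: h t)
  case 0
  have "(\<lambda>k. if h \<le> k \<and> k < h + 0 then f (t k) else t k) = t" by (rule ext) auto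
  then show ?case using 0 by (simp add: exec.WhileF)
next
  case (Suc m)
  let ?t = "t(h := f (t h))"
  have 1: "exec w B (Act f Stay GoRight None) (i, h, t, out) (i, Suc h, ?t, out)"
    using Suc.prems(1,2) by (intro exec_ActI) (simp_all add: min_absorb2)
  have 2: "exec w B (While b (Act f Stay GoRight None)) (i, Suc h, ?t, out)
    (i, Suc h + m, \<lambda>k. if Suc h \<le> k \<and> k < Suc h + m then f (?t k) else ?t k, out)"
    using Suc.prems by (intro Suc.IH) auto
  have 3: "(\<lambda>k. if Suc h \<le> k \<and> k < Suc h + m then f (?t k) else ?t k) =
    (\<lambda>k. if h \<le> k \<and> k < h + Suc m then f (t k) else t k)" by (rule ext) (auto simp: Suc_le_eq)
  show ?case
    using exec.WhileT[OF _ 1 2] Suc.prems(3)[of h] unfolding 3 by simp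
qed

lemma exec_rewind:
  assumes "h < B" "i \<le> Suc (length w)" "\<And>k. Suc 0 \<in> t k \<longleftrightarrow> k = 0"
  shows "exec w B rewind (i, h, t, out) (i, 0, t, out)"
  using assms(1)
proof (induction h)
  case 0
  then show ?case unfolding rewind_def by (intro exec.WhileF) (simp add: assms)
next
  case (Suc h)
  have 1: "exec w B (Act (\<lambda>s. s) Stay GoLeft None) (i, Suc h, t, out) (i, h, t, out)"
    using Suc.prems assms(2) by (intro exec_ActI) (simp_all add: min_absorb2)
  have 2: "exec w B rewind (i, h, t, out) (i, 0, t, out)" using Suc by simp
  show ?case
    using 1 2 assms(3)[of "Suc h"] unfolding rewind_def by (intro exec.WhileT) auto
qed

lemma exec_incr:
  assumes K: "0 < K" "K < B" and i: "i \<le> Suc (length w)" and r: "r < R"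
    and e: "\<And>r. e r < 2 ^ K"
  shows "exec w B (incr r) (i, 0, tape R K e b, out)
    (i, 0, tape R (if Suc (e r) < 2 ^ K then K else Suc K) (e(r := Suc (e r))) b, out)"
proof -
  \<comment> \<open>The lowest zero bit. It is at most K, as all bits from K on vanish, and it
    equals K exactly when the ruler overflows.\<close>
  define j where "j = (LEAST j. \<not> bit (e r) j)"
  have nK: "\<not> bit (e r') k" if "K \<le> k" for r' k using e that by (rule not_bit_if_less)
  have j: "\<not> bit (e r) j" "\<And>k. k < j \<Longrightarrow> bit (e r) k" "j \<le> K"
    unfolding j_def
    using LeastI[of "\<lambda>j. \<not> bit (e r) j" K] Least_le[of "\<lambda>j. \<not> bit (e r) j" K] nK[of K r]
    by (simp, blast dest: not_less_Least, simp)
  have carry: "bit (Suc (e r)) k \<longleftrightarrow> (if k < j then False else k = j \<or> bit (e r) k)" for k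
    by (rule bit_Suc_carry) (use j in auto)
  let ?K = "if Suc (e r) < 2 ^ K then K else Suc K"
  have K': "?K = (if j < K then K else Suc K)"
  proof (cases "j < K")
    case True
    have "\<not> bit (2 ^ K :: nat) j" using True by (simp add: bit_exp_iff)
    then have "Suc (e r) \<noteq> 2 ^ K" using carry[of j] by auto
    then show ?thesis using True e[of r] by simp
  next
    case False
    then have "bit (Suc (e r)) K" using carry[of K] j(3) by simp
    then have "\<not> Suc (e r) < 2 ^ K" using not_bit_if_less by blast
    then show ?thesis using False by simp
  qed
  let ?t1 = "\<lambda>k. if 0 \<le> k \<and> k < 0 + j then tape R K e b k - {r + 3} else tape R K e b k"
  let ?t2 = "?t1(j := insert 0 (insert (r + 3) (?t1 j)))"
  have 1: "exec w B (While (\<lambda>c s. r + 3 \<in> s) (Act (\<lambda>s. s - {r + 3}) Stay GoRight None))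
    (i, 0, tape R K e b, out) (i, 0 + j, ?t1, out)"
    using j K i r by (intro exec_sweep) auto
  have 2: "exec w B (Act (\<lambda>s. insert 0 (insert (r + 3) s)) Stay Stay None) (i, 0 + j, ?t1, out)
    (i, j, ?t2, out)"
    using j(3) K i by (intro exec_ActI) (simp_all add: min_absorb2)
  have t2: "?t2 = tape R ?K (e(r := Suc (e r))) b"
  proof
    fix k
    show "?t2 k = tape R ?K (e(r := Suc (e r))) b k"
      unfolding K' using K j(3) r nK carry[of k] j(1) by (intro tape_eqI) auto
  qed
  have 3: "exec w B rewind (i, j, ?t2, out) (i, 0, ?t2, out)"
    using j(3) K i by (intro exec_rewind) (auto simp: t2)
  show ?thesis
    using exec.Seq[OF 1 exec.Seq[OF 2 3]] unfolding incr_def t2 .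
qed

section \<open>Hoare triples for total correctness\<close>

locale register_machine =
  fixes w :: "symbol list" and B R K :: nat
  assumes K: "0 < K" "K < B"
begin

type_synonym assertion = "(nat \<Rightarrow> nat) \<Rightarrow> bool \<Rightarrow> nat \<Rightarrow> symbol list \<Rightarrow> bool"

text \<open>Programs start and end with the work head on the first cell and a ruler of fixed length
  K, so assertions mention only registers, flag, input head and output.\<close>

definition reaches :: "prog \<Rightarrow> (nat \<Rightarrow> nat) \<Rightarrow> bool \<Rightarrow> nat \<Rightarrow> symbol list \<Rightarrow> assertion \<Rightarrow> bool" where
  "reaches p e b i out Q \<longleftrightarrow> (\<exists>e' b' i' out'.
     exec w B p (i, 0, tape R K e b, out) (i', 0, tape R K e' b', out') \<and>
     (\<forall>r. e' r < 2 ^ K) \<and> i' \<le> Suc (length w) \<and> Q e' b' i' out')"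

definition triple :: "assertion \<Rightarrow> prog \<Rightarrow> assertion \<Rightarrow> bool" where
  "triple P p Q \<longleftrightarrow> (\<forall>e b i out. P e b i out \<longrightarrow> (\<forall>r. e r < 2 ^ K) \<longrightarrow> i \<le> Suc (length w) \<longrightarrow>
     reaches p e b i out Q)"

lemma reachesI:
  assumes "exec w B p (i, 0, tape R K e b, out) (i', 0, tape R K e' b', out')"
    "\<And>r. e' r < 2 ^ K" "i' \<le> Suc (length w)" "Q e' b' i' out'"
  shows "reaches p e b i out Q"
  using assms unfolding reaches_def by blast

lemma tripleI:
  assumes "\<And>e b i out. P e b i out \<Longrightarrow> (\<And>r. e r < 2 ^ K) \<Longrightarrow> i \<le> Suc (length w) \<Longrightarrow>
    reaches p e b i out Q"
  shows "triple P p Q"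
  unfolding triple_def using assms by blast

lemma tripleD:
  assumes "triple P p Q" "P e b i out" "\<And>r. e r < 2 ^ K" "i \<le> Suc (length w)"
  obtains e' b' i' out' where "exec w B p (i, 0, tape R K e b, out) (i', 0, tape R K e' b', out')"
    "\<And>r. e' r < 2 ^ K" "i' \<le> Suc (length w)" "Q e' b' i' out'"
  using assms unfolding triple_def reaches_def by metis

lemma triple_pre:
  assumes "triple P p Q"
    "\<And>e b i out. P' e b i out \<Longrightarrow> (\<And>r. e r < 2 ^ K) \<Longrightarrow> i \<le> Suc (length w) \<Longrightarrow> P e b i out"
  shows "triple P' p Q"
  using assms unfolding triple_def by blast

lemma triple_post:
  assumes "triple P p Q" "\<And>e b i out. Q e b i out \<Longrightarrow> (\<And>r. e r < 2 ^ K) \<Longrightarrow> Q' e b i out"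
  shows "triple P p Q'"
  using assms unfolding triple_def reaches_def by meson

text \<open>Freezes the initial state, so that later assertions can refer to it.\<close>

lemma triple_ghost:
  assumes "\<And>e0 b0 i0 out0. P e0 b0 i0 out0 \<Longrightarrow> (\<And>r. e0 r < 2 ^ K) \<Longrightarrow>
    triple (\<lambda>e b i out. e = e0 \<and> b = b0 \<and> i = i0 \<and> out = out0) p Q"
  shows "triple P p Q"
  using assms unfolding triple_def by blast

lemma triple_Seq: "triple P p Q \<Longrightarrow> triple Q q S \<Longrightarrow> triple P (Seq p q) S"
  unfolding triple_def reaches_def by (meson exec.Seq)

text \<open>The hypothesis asks that rewriting the first cell amount to replacing the flag b by
  \<open>g b\<close>.\<close>

lemma triple_Act:
  assumes "\<And>e b i out. P e b i out \<Longrightarrow> (\<And>r. e r < 2 ^ K) \<Longrightarrow> i \<le> Suc (length w) \<Longrightarrow>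
    (tape R K e b)(0 := f (tape R K e b 0)) = tape R K e (g b) \<and>
    Q e (g b) (min (Suc (length w)) (move_head d i)) (out @ (case x of None \<Rightarrow> [] | Some s \<Rightarrow> [s]))"
  shows "triple P (Act f d Stay x) Q"
proof (rule tripleI)
  fix e b i out assume *: "P e b i out" "\<And>r. e r < 2 ^ K" "i \<le> Suc (length w)"
  have "exec w B (Act f d Stay x) (i, 0, tape R K e b, out) (min (Suc (length w)) (move_head d i), 0,
      tape R K e (g b), out @ (case x of None \<Rightarrow> [] | Some s \<Rightarrow> [s]))"
    using K assms[OF *] by (intro exec_ActI) simp_all
  then show "reaches (Act f d Stay x) e b i out Q"
    using assms[OF *] *(2) by (intro reachesI) auto
qed

lemma triple_skip: "triple Q skip Q"
  unfolding skip_def by (rule triple_Act[where g = "\<lambda>b. b"]) (simp add: min_absorb2)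

lemma triple_emit: "triple (\<lambda>e b i out. Q e b i (out @ [s])) (emit s) Q"
  unfolding emit_def by (rule triple_Act[where g = "\<lambda>b. b"]) (simp add: min_absorb2)

lemma triple_input_right:
  "triple (\<lambda>e b i out. Suc i \<le> Suc (length w) \<and> Q e b (Suc i) out) input_right Q"
  unfolding input_right_def by (rule triple_Act[where g = "\<lambda>b. b"]) (simp add: min_absorb2)

lemma tape_set_flag:
  "(tape R K e b)(0 := (if c then insert 2 (tape R K e b 0) else tape R K e b 0 - {2})) = tape R K e c"
  using K by (intro ext tape_eqI) auto

lemma triple_set_flag: "triple (\<lambda>e b i out. Q e c i out) (set_flag c) Q"
  unfolding set_flag_def
  by (rule triple_Act[where g = "\<lambda>b. c"]) (use tape_set_flag[of _ _ c] in \<open>simp add: min_absorb2\<close>)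

lemma triple_negate_flag: "triple (\<lambda>e b i out. Q e (\<not> b) i out) negate_flag Q"
  unfolding negate_flag_def
proof (rule triple_Act[where g = Not])
  fix e b i out
  assume "Q e (\<not> b) i out" "i \<le> Suc (length w)"
  then show "(tape R K e b)(0 := (if 2 \<in> tape R K e b 0 then tape R K e b 0 - {2}
        else insert 2 (tape R K e b 0))) = tape R K e (\<not> b) \<and>
      Q e (\<not> b) (min (Suc (length w)) (move_head Stay i)) (out @ (case None of None \<Rightarrow> [] | Some s \<Rightarrow> [s]))"
    using tape_set_flag[of e b True] tape_set_flag[of e b False] K by (cases b) (simp_all add: min_absorb2)
qed

lemma triple_if_flag:
  assumes "triple (\<lambda>e b i out. P e b i out \<and> b) p Q" "triple (\<lambda>e b i out. P e b i out \<and> \<not> b) q Q"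
  shows "triple P (if_flag p q) Q"
proof (rule tripleI)
  fix e b i out assume *: "P e b i out" "\<And>r. e r < 2 ^ K" "i \<le> Suc (length w)"
  show "reaches (if_flag p q) e b i out Q"
  proof (cases b)
    case True
    then have "2 \<in> tape R K e b 0" using K by simp
    moreover obtain e' b' i' out' where "exec w B p (i, 0, tape R K e b, out) (i', 0, tape R K e' b', out')"
      "\<And>r. e' r < 2 ^ K" "i' \<le> Suc (length w)" "Q e' b' i' out'"
      by (rule tripleD[OF assms(1), of e b i out]) (use * True in auto)
    ultimately show ?thesis unfolding if_flag_def reaches_def by (metis exec.IfT)
  next
    case False
    then have "2 \<notin> tape R K e b 0" by simp
    moreover obtain e' b' i' out' where "exec w B q (i, 0, tape R K e b, out) (i', 0, tape R K e' b', out')"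
      "\<And>r. e' r < 2 ^ K" "i' \<le> Suc (length w)" "Q e' b' i' out'"
      by (rule tripleD[OF assms(2), of e b i out]) (use * False in auto)
    ultimately show ?thesis unfolding if_flag_def reaches_def by (metis exec.IfF)
  qed
qed

text \<open>The loop terminates because the measure drops in every round that leaves the flag
  unset.\<close>

lemma triple_until_flag:
  fixes \<mu> :: "(nat \<Rightarrow> nat) \<Rightarrow> nat"
  assumes body: "\<And>m. triple (\<lambda>e b i out. I e b i out \<and> \<not> b \<and> \<mu> e = m) p
    (\<lambda>e b i out. I e b i out \<and> (\<not> b \<longrightarrow> \<mu> e < m))"
  shows "triple I (until_flag p) (\<lambda>e b i out. I e b i out \<and> b)"
proof (rule tripleI)
  fix e b i out
  assume "I e b i out" "\<And>r. e r < 2 ^ K" "i \<le> Suc (length w)"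
  then show "reaches (until_flag p) e b i out (\<lambda>e b i out. I e b i out \<and> b)"
  \<comment> \<open>A set flag gets the value 0, below every running value, so that the round that
    sets it also counts as a decrease.\<close>
  proof (induction "if b then 0 else Suc (\<mu> e)" arbitrary: e b i out rule: less_induct)
    case less
    show ?case
    proof (cases b)
      case True
      then have "exec w B (until_flag p) (i, 0, tape R K e b, out) (i, 0, tape R K e b, out)"
        unfolding until_flag_def using K by (intro exec.WhileF) simp
      then show ?thesis using less.prems True unfolding reaches_def by blast
    next
      case False
      obtain e1 b1 i1 out1 where 1: "exec w B p (i, 0, tape R K e b, out) (i1, 0, tape R K e1 b1, out1)"
        "\<And>r. e1 r < 2 ^ K" "i1 \<le> Suc (length w)" "I e1 b1 i1 out1" "\<not> b1 \<longrightarrow> \<mu> e1 < \<mu> e"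
        by (rule tripleD[OF body[of "\<mu> e"], of e b i out]) (use less.prems False in auto)
      obtain e2 b2 i2 out2 where 2:
        "exec w B (until_flag p) (i1, 0, tape R K e1 b1, out1) (i2, 0, tape R K e2 b2, out2)"
        "\<forall>r. e2 r < 2 ^ K" "i2 \<le> Suc (length w)" "I e2 b2 i2 out2" "b2"
      proof -
        have "(if b1 then 0 else Suc (\<mu> e1)) < (if b then 0 else Suc (\<mu> e))" using 1(5) False by simp
        from less.hyps[OF this 1(4,2,3)] show ?thesis using that unfolding reaches_def by blast
      qed
      have "2 \<notin> tape R K e b 0" using False by simp
      then have "exec w B (until_flag p) (i, 0, tape R K e b, out) (i2, 0, tape R K e2 b2, out2)"
        using 1(1) 2(1) unfolding until_flag_def by (intro exec.WhileT) auto
      then show ?thesis using 2 unfolding reaches_def by blast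
    qed
  qed
qed

lemma triple_clear:
  assumes r: "r < R"
  shows "triple (\<lambda>e b i out. Q (e(r := 0)) b i out) (clear r) Q"
proof (rule tripleI)
  fix e b i out assume *: "Q (e(r := 0)) b i out" "\<And>r. e r < 2 ^ K" "i \<le> Suc (length w)"
  let ?t = "\<lambda>k. if 0 \<le> k \<and> k < 0 + K then tape R K e b k - {r + 3} else tape R K e b k"
  have 1: "exec w B (While (\<lambda>c s. 0 \<in> s) (Act (\<lambda>s. s - {r + 3}) Stay GoRight None))
     (i, 0, tape R K e b, out) (i, 0 + K, ?t, out)"
    using K * by (intro exec_sweep) auto
  have t: "?t = tape R K (e(r := 0)) b"
    using K by (intro ext tape_eqI) auto
  have "exec w B rewind (i, 0 + K, ?t, out) (i, 0, ?t, out)"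
    using K * by (intro exec_rewind) (auto simp: t)
  from exec.Seq[OF 1 this] have "exec w B (clear r) (i, 0, tape R K e b, out) (i, 0, ?t, out)"
    unfolding clear_def .
  then show "reaches (clear r) e b i out Q"
    unfolding t using * by (intro reachesI) auto
qed

lemma triple_incr:
  assumes r: "r < R"
  shows "triple (\<lambda>e b i out. Suc (e r) < 2 ^ K \<and> Q (e(r := Suc (e r))) b i out) (incr r) Q"
proof (rule tripleI)
  fix e b i out
  assume *: "Suc (e r) < 2 ^ K \<and> Q (e(r := Suc (e r))) b i out" "\<And>r. e r < 2 ^ K" "i \<le> Suc (length w)"
  have "exec w B (incr r) (i, 0, tape R K e b, out) (i, 0, tape R K (e(r := Suc (e r))) b, out)"
    using exec_incr[OF K *(3) r, where e = e and b = b and out = out] *(1,2) by simp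
  then show "reaches (incr r) e b i out Q"
    using * by (intro reachesI) auto
qed

lemma triple_eq_test:
  assumes r: "r < R" "r' < R"
  shows "triple (\<lambda>e b i out. Q e (e r = e r') i out) (eq_test r r') Q"
proof (rule tripleI)
  fix e b i out assume *: "Q e (e r = e r') i out" "\<And>r. e r < 2 ^ K" "i \<le> Suc (length w)"
  \<comment> \<open>The first position off the ruler or with differing bits; K qualifies, so it
    exists.\<close>
  define j where "j = (LEAST j. j \<ge> K \<or> (bit (e r) j \<longleftrightarrow> \<not> bit (e r') j))"
  have j0: "j \<ge> K \<or> (bit (e r) j \<longleftrightarrow> \<not> bit (e r') j)"
    unfolding j_def by (rule LeastI[of _ K]) simp
  have jK: "j \<le> K" unfolding j_def by (rule Least_le) simp
  have j1: "bit (e r) k \<longleftrightarrow> bit (e r') k" "k < K" if "k < j" for k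
    using not_less_Least[OF that[unfolded j_def]] by auto
  have eq: "e r = e r' \<longleftrightarrow> j = K"
  proof
    assume "e r = e r'"
    then show "j = K" using j0 jK by simp
  next
    assume j: "j = K"
    have "bit (e r) k = bit (e r') k" for k
    proof (cases "k < K")
      case True
      then show ?thesis using j1(1)[of k] j by simp
    next
      case False
      then show ?thesis
        using not_bit_if_less[OF *(2)[of r], of k] not_bit_if_less[OF *(2)[of r'], of k] by simp
    qed
    then show "e r = e r'" by (simp add: bit_eq_iff)
  qed
  \<comment> \<open>Both branches agree; the shape is that of \<open>exec_sweep\<close> with the
    identity as action.\<close>
  let ?t = "\<lambda>k. if 0 \<le> k \<and> k < 0 + j then tape R K e b k else tape R K e b k"
  have t: "?t = tape R K e b" by auto
  have 1: "exec w B (While (\<lambda>c s. 0 \<in> s \<and> (r + 3 \<in> s \<longleftrightarrow> r' + 3 \<in> s)) (Act (\<lambda>s. s) Stay GoRight None))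
     (i, 0, tape R K e b, out) (i, 0 + j, ?t, out)"
    using K * r j0 jK j1 by (intro exec_sweep) auto
  have rew: "exec w B rewind (i, j, tape R K e b, out) (i, 0, tape R K e b, out)"
    using K * jK by (intro exec_rewind) auto
  have fl: "exec w B (set_flag c) (i, 0, tape R K e b, out) (i, 0, tape R K e c, out)" for c
    unfolding set_flag_def
    by (intro exec_ActI) (use K *(3) tape_set_flag in \<open>simp_all add: min_absorb2\<close>)
  have 2: "exec w B (If (\<lambda>c s. 0 \<in> s) (Seq rewind (set_flag False)) (Seq rewind (set_flag True)))
      (i, j, tape R K e b, out) (i, 0, tape R K e (e r = e r'), out)"
  proof (cases "j < K")
    case True
    then show ?thesis
      using eq exec.Seq[OF rew fl[of False]] by (intro exec.IfT) auto
  next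
    case False
    then show ?thesis
      using eq jK exec.Seq[OF rew fl[of True]] by (intro exec.IfF) auto
  qed
  have "exec w B (eq_test r r') (i, 0, tape R K e b, out) (i, 0, tape R K e (e r = e r'), out)"
    using exec.Seq[OF 1[unfolded t, unfolded add_0] 2] unfolding eq_test_def .
  then show "reaches (eq_test r r') e b i out Q" using * by (intro reachesI) auto
qed

lemma triple_rewind_input: "triple (\<lambda>e b i out. Q e b 0 out) rewind_input Q"
proof (rule tripleI)
  fix e b i out assume *: "Q e b 0 out" "\<And>r. e r < 2 ^ K" "i \<le> Suc (length w)"
  have "exec w B rewind_input (i, 0, tape R K e b, out) (0, 0, tape R K e b, out)"
    using *(3)
  proof (induction i)
    case 0
    then show ?case unfolding rewind_input_def by (intro exec.WhileF) (simp add: input_cell_def)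
  next
    case (Suc i)
    have "exec w B (Act (\<lambda>s. s) GoLeft Stay None) (Suc i, 0, tape R K e b, out)
      (i, 0, tape R K e b, out)"
      using K Suc.prems by (intro exec_ActI) (simp_all add: min_absorb2)
    then show ?case
      using Suc unfolding rewind_input_def by (intro exec.WhileT) (auto simp: input_cell_def)
  qed
  then show "reaches rewind_input e b i out Q" using * by (intro reachesI) auto
qed

lemma triple_seek_sep:
  "triple (\<lambda>e b i out. \<exists>m. (\<forall>j<m. input_cell w (i + j) \<noteq> Letter Sep) \<and>
     input_cell w (i + m) = Letter Sep \<and> i + m \<le> Suc (length w) \<and> Q e b (i + m) out) seek_sep Q"
proof (rule tripleI)
  fix e b i out
  assume "\<exists>m. (\<forall>j<m. input_cell w (i + j) \<noteq> Letter Sep) \<and>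
     input_cell w (i + m) = Letter Sep \<and> i + m \<le> Suc (length w) \<and> Q e b (i + m) out"
  and e: "\<And>r. e r < 2 ^ K"
  then obtain m where m: "\<forall>j<m. input_cell w (i + j) \<noteq> Letter Sep"
    "input_cell w (i + m) = Letter Sep" "i + m \<le> Suc (length w)" "Q e b (i + m) out" by blast
  have "exec w B seek_sep (i, 0, tape R K e b, out) (i + m, 0, tape R K e b, out)"
    using m(1-3)
  proof (induction m arbitrary: i)
    case 0
    then show ?case unfolding seek_sep_def by (simp add: exec.WhileF)
  next
    case (Suc m)
    have 1: "exec w B input_right (i, 0, tape R K e b, out) (Suc i, 0, tape R K e b, out)"
      unfolding input_right_def
      using K Suc.prems by (intro exec_ActI) (simp_all add: min_absorb2)
    have 2: "exec w B seek_sep (Suc i, 0, tape R K e b, out) (Suc i + m, 0, tape R K e b, out)"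
      using Suc.prems by (intro Suc.IH) auto
    show ?case
      using 1 2 Suc.prems(1) unfolding seek_sep_def by (intro exec.WhileT[of _ w i]) auto
  qed
  then show "reaches seek_sep e b i out Q"
    using m e by (intro reachesI) auto
qed

lemma triple_input_test:
  "triple (\<lambda>e b i out. Q e (input_cell w i = Letter One) i out) input_test Q"
proof (rule tripleI)
  fix e b i out assume *: "Q e (input_cell w i = Letter One) i out" "\<And>r. e r < 2 ^ K" "i \<le> Suc (length w)"
  let ?c = "input_cell w i = Letter One"
  obtain e' b' i' out' where 1:
    "exec w B (set_flag ?c) (i, 0, tape R K e b, out) (i', 0, tape R K e' b', out')"
    "\<And>r. e' r < 2 ^ K" "i' \<le> Suc (length w)" "Q e' b' i' out'"
    by (rule tripleD[OF triple_set_flag, of Q e ?c i out b]) (use * in auto)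
  have "exec w B input_test (i, 0, tape R K e b, out) (i', 0, tape R K e' b', out')"
  proof (cases ?c)
    case True
    then show ?thesis using 1(1) unfolding input_test_def by (intro exec.IfT) simp_all
  next
    case False
    then show ?thesis using 1(1) unfolding input_test_def by (intro exec.IfF) simp_all
  qed
  then show "reaches input_test e b i out Q" using 1(2-) by (rule reachesI)
qed

text \<open>\<open>J k\<close> is the invariant before round k. The body establishes the next one
  for the updated register, since v is incremented only after the body.\<close>

lemma triple_upto:
  assumes vr: "v < R" "r < R" "v \<noteq> r"
    and body: "\<And>k. k < N \<Longrightarrow> triple (\<lambda>e b i out. e v = k \<and> e r = N \<and> J k e i out) p
      (\<lambda>e b i out. e v = k \<and> e r = N \<and> J (Suc k) (e(v := Suc k)) i out)"
    and init: "\<And>e b i out. P e b i out \<Longrightarrow> e r = N \<and> J 0 (e(v := 0)) i out"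
  shows "triple P (upto v r p) (\<lambda>e b i out. e v = N \<and> e r = N \<and> J N e i out)"
proof -
  define I where "I e b i out \<longleftrightarrow> e v \<le> N \<and> e r = N \<and> J (e v) e i out \<and> (b \<longleftrightarrow> e v = N)" for e b i out
  have "triple I (until_flag (Seq p (Seq (incr v) (eq_test v r)))) (\<lambda>e b i out. I e b i out \<and> b)"
  proof (rule triple_until_flag[where \<mu> = "\<lambda>e. N - e v"])
    fix m
    let ?Q = "\<lambda>e b i out. I e b i out \<and> (\<not> b \<longrightarrow> N - e v < m)"
    show "triple (\<lambda>e b i out. I e b i out \<and> \<not> b \<and> N - e v = m) (Seq p (Seq (incr v) (eq_test v r))) ?Q"
    \<comment> \<open>An unset flag means e v < N, so outside this range of m the precondition is
      contradictory.\<close>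
    proof (cases "0 < m \<and> m \<le> N")
      case False
      have "triple (\<lambda>e b i out. False) (Seq p (Seq (incr v) (eq_test v r))) ?Q"
        by (simp add: triple_def)
      then show ?thesis by (rule triple_pre) (use False in \<open>auto simp: I_def\<close>)
    next
      case True
      define k where "k = N - m"
      have k: "k < N" "m = N - k" using True by (auto simp: k_def)
      have 1: "triple (\<lambda>e b i out. I e b i out \<and> \<not> b \<and> N - e v = m) p
        (\<lambda>e b i out. e v = k \<and> e r = N \<and> J (Suc k) (e(v := Suc k)) i out)"
        by (rule triple_pre[OF body[OF k(1)]]) (auto simp: I_def k_def)
      have 3: "triple (\<lambda>e b i out. ?Q e (e v = e r) i out) (eq_test v r) ?Q"
        by (rule triple_eq_test[OF vr(1,2)])
      have 2: "triple (\<lambda>e b i out. e v = k \<and> e r = N \<and> J (Suc k) (e(v := Suc k)) i out) (incr v)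
        (\<lambda>e b i out. ?Q e (e v = e r) i out)"
      proof (rule triple_pre[OF triple_incr[OF vr(1)]])
        fix e b i out
        assume *: "e v = k \<and> e r = N \<and> J (Suc k) (e(v := Suc k)) i out" "\<And>r. e r < 2 ^ K"
        have "Suc (e v) < 2 ^ K" using * k(1) *(2)[of r] by simp
        then show "Suc (e v) < 2 ^ K \<and> ?Q (e(v := Suc (e v)))
            ((e(v := Suc (e v))) v = (e(v := Suc (e v))) r) i out"
          using * k vr(3) by (auto simp: I_def)
      qed
      show ?thesis by (rule triple_Seq[OF 1 triple_Seq[OF 2 3]])
    qed
  qed
  then have 3: "triple I (until_flag (Seq p (Seq (incr v) (eq_test v r))))
      (\<lambda>e b i out. e v = N \<and> e r = N \<and> J N e i out)"
    by (rule triple_post) (auto simp: I_def)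
  have 2: "triple (\<lambda>e b i out. I e (e v = e r) i out) (eq_test v r) I"
    by (rule triple_eq_test[OF vr(1,2)])
  have 1: "triple P (clear v) (\<lambda>e b i out. I e (e v = e r) i out)"
    by (rule triple_pre[OF triple_clear[OF vr(1)]]) (use init vr(3) in \<open>auto simp: I_def\<close>)
  show ?thesis unfolding upto_def by (rule triple_Seq[OF 1 triple_Seq[OF 2 3]])
qed

end

section \<open>First-order definable families\<close>

text \<open>First-order formulas over a graph. Variables are register numbers, and a quantifier at depth
  \<open>d\<close> binds register \<open>d\<close>. Register \<open>0\<close> holds the number of vertices, register \<open>1\<close> is scratch space.\<close>

datatype fm = EqF nat nat | AdjF nat nat | NegF fm | ConjF fm fm | ExF fm

primrec sat :: "nat \<Rightarrow> (nat \<Rightarrow> nat \<Rightarrow> bool) \<Rightarrow> nat \<Rightarrow> (nat \<Rightarrow> nat) \<Rightarrow> fm \<Rightarrow> bool" where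
  "sat n A d e (EqF i j) \<longleftrightarrow> e i = e j"
| "sat n A d e (AdjF i j) \<longleftrightarrow> A (e i) (e j)"
| "sat n A d e (NegF \<phi>) \<longleftrightarrow> \<not> sat n A d e \<phi>"
| "sat n A d e (ConjF \<phi> \<psi>) \<longleftrightarrow> sat n A d e \<phi> \<and> sat n A d e \<psi>"
| "sat n A d e (ExF \<phi>) \<longleftrightarrow> (\<exists>v<n. sat n A (Suc d) (e(d := v)) \<phi>)"

primrec wf_fm :: "nat \<Rightarrow> fm \<Rightarrow> bool" where
  "wf_fm d (EqF i j) \<longleftrightarrow> i \<in> {2..<d} \<and> j \<in> {2..<d}"
| "wf_fm d (AdjF i j) \<longleftrightarrow> i \<in> {2..<d} \<and> j \<in> {2..<d}"
| "wf_fm d (NegF \<phi>) \<longleftrightarrow> wf_fm d \<phi>"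
| "wf_fm d (ConjF \<phi> \<psi>) \<longleftrightarrow> wf_fm d \<phi> \<and> wf_fm d \<psi>"
| "wf_fm d (ExF \<phi>) \<longleftrightarrow> wf_fm (Suc d) \<phi>"

primrec registers :: "nat \<Rightarrow> fm \<Rightarrow> nat" where
  "registers d (EqF i j) = d"
| "registers d (AdjF i j) = d"
| "registers d (NegF \<phi>) = registers d \<phi>"
| "registers d (ConjF \<phi> \<psi>) = max (registers d \<phi>) (registers d \<psi>)"
| "registers d (ExF \<phi>) = registers (Suc d) \<phi>"

lemma registers_ge: "d \<le> registers d \<phi>"
  by (induction \<phi> arbitrary: d) (auto simp: le_max_iff_disj intro: Suc_leD)

text \<open>The truth value is left in the flag. The search for a witness ends with the value \<open>n\<close> in
  register \<open>d\<close> if there is none.\<close>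

primrec eval_prog :: "nat \<Rightarrow> fm \<Rightarrow> prog" where
  "eval_prog d (EqF i j) = eq_test i j"
| "eval_prog d (AdjF i j) = read_entry 1 i j"
| "eval_prog d (NegF \<phi>) = Seq (eval_prog d \<phi>) negate_flag"
| "eval_prog d (ConjF \<phi> \<psi>) = Seq (eval_prog d \<phi>) (if_flag (eval_prog d \<psi>) skip)"
| "eval_prog d (ExF \<phi>) = Seq (clear d) (Seq (eq_test d 0)
     (Seq (until_flag (Seq (eval_prog (Suc d) \<phi>) (if_flag skip (Seq (incr d) (eq_test d 0)))))
       (Seq (eq_test d 0) negate_flag)))"

lemma sat_cong:
  assumes "wf_fm d \<phi>" "\<And>j. 2 \<le> j \<Longrightarrow> j < d \<Longrightarrow> e j = e' j"
  shows "sat n A d e \<phi> \<longleftrightarrow> sat n A d e' \<phi>"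
  using assms
proof (induction \<phi> arbitrary: d e e')
  case (ExF \<phi>)
  have "sat n A (Suc d) (e(d := v)) \<phi> \<longleftrightarrow> sat n A (Suc d) (e'(d := v)) \<phi>" for v
    using ExF.prems by (intro ExF.IH) (auto simp: less_Suc_eq)
  then show ?case by simp
next
  case (ConjF \<phi> \<psi>)
  have "sat n A d e \<phi> \<longleftrightarrow> sat n A d e' \<phi>" using ConjF.prems by (intro ConjF.IH) auto
  moreover have "sat n A d e \<psi> \<longleftrightarrow> sat n A d e' \<psi>" using ConjF.prems by (intro ConjF.IH) auto
  ultimately show ?case by simp
next
  case (NegF \<phi>)
  have "sat n A d e \<phi> \<longleftrightarrow> sat n A d e' \<phi>" using NegF.prems by (intro NegF.IH) auto
  then show ?case by simp
qed auto

lemma wf_prog_clear: "r < R \<Longrightarrow> wf_prog (R + 3) (clear r)"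
  and wf_prog_incr: "r < R \<Longrightarrow> wf_prog (R + 3) (incr r)"
  and wf_prog_eq_test: "wf_prog (R + 3) (eq_test r r')"
  and wf_prog_set_flag: "wf_prog (R + 3) (set_flag b)"
  and wf_prog_negate_flag: "wf_prog (R + 3) negate_flag"
  and wf_prog_input: "wf_prog (R + 3) input_right" "wf_prog (R + 3) rewind_input"
    "wf_prog (R + 3) seek_sep" "wf_prog (R + 3) input_test"
  and wf_prog_emit: "wf_prog (R + 3) (emit s)"
  and wf_prog_skip: "wf_prog (R + 3) skip"
  by (auto simp: skip_def rewind_def set_flag_def negate_flag_def clear_def incr_def eq_test_def
      emit_def input_right_def rewind_input_def seek_sep_def input_test_def)

lemma wf_prog_if_flag: "wf_prog W p \<Longrightarrow> wf_prog W q \<Longrightarrow> wf_prog W (if_flag p q)"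
  by (simp add: if_flag_def)

lemma wf_prog_until_flag: "wf_prog W p \<Longrightarrow> wf_prog W (until_flag p)"
  by (simp add: until_flag_def)

lemma wf_prog_upto: "v < R \<Longrightarrow> wf_prog (R + 3) p \<Longrightarrow> wf_prog (R + 3) (upto v r p)"
  by (simp add: upto_def wf_prog_clear wf_prog_eq_test wf_prog_until_flag wf_prog_incr)

lemmas wf_prog_simps = wf_prog_clear wf_prog_incr wf_prog_eq_test wf_prog_set_flag
  wf_prog_negate_flag wf_prog_input wf_prog_emit wf_prog_skip wf_prog_if_flag wf_prog_until_flag
  wf_prog_upto

lemma wf_eval_prog: "2 \<le> d \<Longrightarrow> registers d \<phi> \<le> R \<Longrightarrow> wf_prog (R + 3) (eval_prog d \<phi>)"
proof (induction \<phi> arbitrary: d)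
  case (ExF \<phi>)
  then have "d < R" using registers_ge[of "Suc d" \<phi>] by simp
  then show ?case using ExF by (simp add: wf_prog_simps)
qed (auto simp: wf_prog_simps read_entry_def)

text \<open>A row occupies n letters and a separator, and positions are shifted by one because 0 is
  the left end marker. The ruler is long enough to hold n itself, the value at which counting loops
  stop.\<close>

locale matrix_machine = register_machine +
  fixes n :: nat and A :: "nat \<Rightarrow> nat \<Rightarrow> bool"
  assumes len: "length w = n * Suc n"
    and cell: "\<And>a c. a < n \<Longrightarrow> c \<le> n \<Longrightarrow> input_cell w (Suc (a * Suc n + c)) =
      Letter (if c = n then Sep else if A a c then One else Zero)"
    and n_less: "n < 2 ^ K"
begin

lemma triple_read_entry:
  assumes r: "v < R" "r < R" "r' < R" "v \<noteq> r" "v \<noteq> r'"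
  shows "triple (\<lambda>e b i out. i = 0 \<and> e r < n \<and> e r' < n \<and>
    Q (e(v := e r')) (A (e r) (e r')) 0 out) (read_entry v r r') Q"
proof (rule triple_ghost)
  fix e0 b0 and i0 :: nat and out0
  assume *: "i0 = 0 \<and> e0 r < n \<and> e0 r' < n \<and> Q (e0(v := e0 r')) (A (e0 r) (e0 r')) 0 out0"
  \<comment> \<open>The separator that ends row k still lies within the input.\<close>
  have bound: "k * Suc n + n < n * Suc n" if "k < n" for k
  proof -
    have "Suc k * Suc n \<le> n * Suc n" using that by (intro mult_le_mono1) simp
    then show ?thesis by simp
  qed
  have 1: "triple (\<lambda>e b i out. e = e0 \<and> b = b0 \<and> i = i0 \<and> out = out0) input_right
    (\<lambda>e b i out. e = e0 \<and> i = Suc 0 \<and> out = out0)"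
    by (rule triple_pre[OF triple_input_right]) (use * bound[of "e0 r"] in \<open>auto simp: len\<close>)
  \<comment> \<open>After k rows the head is on the first letter of row k, and v is the only
    register that has changed.\<close>
  define J1 where "J1 k e i out \<longleftrightarrow> e = e0(v := k) \<and> i = Suc (k * Suc n) \<and> out = out0"
    for k e i and out :: "symbol list"
  have 2: "triple (\<lambda>e b i out. e = e0 \<and> i = Suc 0 \<and> out = out0) (upto v r (Seq seek_sep input_right))
    (\<lambda>e b i out. e v = e0 r \<and> e r = e0 r \<and> J1 (e0 r) e i out)"
  proof (rule triple_upto[OF r(1,2,4)])
    fix k assume "k < e0 r"
    then have k: "k < n" using * by simp
    have "triple (\<lambda>e b i out. e v = k \<and> e r = e0 r \<and> J1 k e i out) seek_sep
      (\<lambda>e b i out. e = e0(v := k) \<and> i = Suc (k * Suc n + n) \<and> out = out0)"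
    proof (rule triple_pre[OF triple_seek_sep])
      fix e b i out
      assume J: "e v = k \<and> e r = e0 r \<and> J1 k e i out"
      have "input_cell w (i + j) \<noteq> Letter Sep" if "j < n" for j
        using J cell[OF k, of j] that by (simp add: J1_def)
      moreover have "input_cell w (i + n) = Letter Sep"
        using J cell[OF k, of n] by (simp add: J1_def)
      ultimately show "\<exists>m. (\<forall>j<m. input_cell w (i + j) \<noteq> Letter Sep) \<and>
          input_cell w (i + m) = Letter Sep \<and> i + m \<le> Suc (length w) \<and>
          e = e0(v := k) \<and> i + m = Suc (k * Suc n + n) \<and> out = out0"
        using J bound[OF k] by (intro exI[of _ n]) (auto simp: J1_def len)
    qed
    moreover have "triple (\<lambda>e b i out. e = e0(v := k) \<and> i = Suc (k * Suc n + n) \<and> out = out0) input_right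
      (\<lambda>e b i out. e v = k \<and> e r = e0 r \<and> J1 (Suc k) (e(v := Suc k)) i out)"
      by (rule triple_pre[OF triple_input_right]) (use r bound[OF k] in \<open>auto simp: J1_def len\<close>)
    ultimately show "triple (\<lambda>e b i out. e v = k \<and> e r = e0 r \<and> J1 k e i out) (Seq seek_sep input_right)
      (\<lambda>e b i out. e v = k \<and> e r = e0 r \<and> J1 (Suc k) (e(v := Suc k)) i out)"
      by (rule triple_Seq)
  qed (use r in \<open>auto simp: J1_def\<close>)
  define J2 where "J2 k e i out \<longleftrightarrow> e = e0(v := k) \<and> i = Suc (e0 r * Suc n + k) \<and> out = out0"
    for k e i and out :: "symbol list"
  have 3: "triple (\<lambda>e b i out. e v = e0 r \<and> e r = e0 r \<and> J1 (e0 r) e i out) (upto v r' input_right)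
    (\<lambda>e b i out. e v = e0 r' \<and> e r' = e0 r' \<and> J2 (e0 r') e i out)"
  proof (rule triple_upto[OF r(1,3,5)])
    fix k assume "k < e0 r'"
    then show "triple (\<lambda>e b i out. e v = k \<and> e r' = e0 r' \<and> J2 k e i out) input_right
      (\<lambda>e b i out. e v = k \<and> e r' = e0 r' \<and> J2 (Suc k) (e(v := Suc k)) i out)"
      by (intro triple_pre[OF triple_input_right]) (use * bound[of "e0 r"] in \<open>auto simp: J2_def len\<close>)
  qed (use r in \<open>auto simp: J1_def J2_def\<close>)
  have 4: "triple (\<lambda>e b i out. e v = e0 r' \<and> e r' = e0 r' \<and> J2 (e0 r') e i out) input_test
    (\<lambda>e b i out. Q e b 0 out)"
    by (rule triple_pre[OF triple_input_test])
      (use * cell[of "e0 r" "e0 r'"] in \<open>auto simp: J2_def split: if_splits\<close>)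
  show "triple (\<lambda>e b i out. e = e0 \<and> b = b0 \<and> i = i0 \<and> out = out0) (read_entry v r r') Q"
    unfolding read_entry_def
    by (rule triple_Seq[OF 1 triple_Seq[OF 2 triple_Seq[OF 3 triple_Seq[OF 4 triple_rewind_input[of Q]]]]])
qed

definition env_ok :: "nat \<Rightarrow> (nat \<Rightarrow> nat) \<Rightarrow> bool" where
  "env_ok d e \<longleftrightarrow> e 0 = n \<and> (\<forall>j. 2 \<le> j \<and> j < d \<longrightarrow> e j < n)"

text \<open>Register 1 is exempt as scratch space, and registers from d on may be overwritten by
  quantifiers inside the formula.\<close>

definition agree :: "nat \<Rightarrow> (nat \<Rightarrow> nat) \<Rightarrow> (nat \<Rightarrow> nat) \<Rightarrow> bool" where
  "agree d e e' \<longleftrightarrow> (\<forall>j<d. j \<noteq> 1 \<longrightarrow> e' j = e j)"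

lemma agree_env_ok: "agree d e e' \<Longrightarrow> 2 \<le> d \<Longrightarrow> env_ok d e \<Longrightarrow> env_ok d e'"
  unfolding agree_def env_ok_def by auto

lemma agree_trans: "agree d e e' \<Longrightarrow> agree d e' e'' \<Longrightarrow> agree d e e''"
  unfolding agree_def by auto

lemma agree_Suc: "agree (Suc d) e e' \<Longrightarrow> agree d e e'"
  unfolding agree_def by auto

lemma agree_sat: "wf_fm d \<phi> \<Longrightarrow> agree d e e' \<Longrightarrow> sat n A d e' \<phi> \<longleftrightarrow> sat n A d e \<phi>"
  unfolding agree_def by (rule sat_cong) auto

text \<open>Stated like a weakest precondition: Q has to hold for every final register content that
  agrees with the initial one. As Q is arbitrary in the induction, it can be instantiated with the
  precondition of the program that follows.\<close>

lemma triple_eval_prog: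
  assumes "wf_fm d \<phi>" "registers d \<phi> \<le> R" "2 \<le> d"
  shows "triple (\<lambda>e b i out. i = 0 \<and> env_ok d e \<and>
    (\<forall>e'. agree d e e' \<longrightarrow> Q e' (sat n A d e \<phi>) 0 out)) (eval_prog d \<phi>) Q"
  using assms
proof (induction \<phi> arbitrary: d Q)
  case (EqF i j)
  have "triple (\<lambda>e b i' out. Q e (e i = e j) i' out) (eq_test i j) Q"
    using EqF by (intro triple_eq_test) auto
  then show ?case unfolding eval_prog.simps
    by (rule triple_pre) (auto simp: agree_def)
next
  case (AdjF i j)
  have "triple (\<lambda>e b i' out. i' = 0 \<and> e i < n \<and> e j < n \<and> Q (e(1 := e j)) (A (e i) (e j)) 0 out)
    (read_entry 1 i j) Q"
    using AdjF by (intro triple_read_entry) auto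
  then show ?case unfolding eval_prog.simps
    by (rule triple_pre) (use AdjF in \<open>auto simp: agree_def env_ok_def\<close>)
next
  case (NegF \<phi>)
  have "triple (\<lambda>e b i out. i = 0 \<and> env_ok d e \<and>
     (\<forall>e'. agree d e e' \<longrightarrow> Q e' (\<not> sat n A d e \<phi>) 0 out)) (eval_prog d \<phi>) (\<lambda>e b i out. Q e (\<not> b) i out)"
    using NegF by (intro NegF.IH) auto
  from triple_Seq[OF this triple_negate_flag] show ?case by simp
next
  case (ConjF \<phi> \<psi>)
  \<comment> \<open>After the first conjunct: if it holds, the verdict is that of the second;
    otherwise the unset flag already is the verdict.\<close>
  define M where "M e b i out \<longleftrightarrow> i = 0 \<and> env_ok d e \<and>
    (if b then \<forall>e'. agree d e e' \<longrightarrow> Q e' (sat n A d e \<psi>) 0 out else Q e False 0 out)" for e b and i :: nat and out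
  have 1: "triple (\<lambda>e b i out. i = 0 \<and> env_ok d e \<and>
     (\<forall>e'. agree d e e' \<longrightarrow> M e' (sat n A d e \<phi>) 0 out)) (eval_prog d \<phi>) M"
    using ConjF by (intro ConjF.IH) auto
  have "triple (\<lambda>e b i out. i = 0 \<and> env_ok d e \<and>
     (\<forall>e'. agree d e e' \<longrightarrow> Q e' (sat n A d e \<psi>) 0 out)) (eval_prog d \<psi>) Q"
    using ConjF by (intro ConjF.IH) auto
  then have 2: "triple (\<lambda>e b i out. M e b i out \<and> b) (eval_prog d \<psi>) Q"
    by (rule triple_pre) (simp add: M_def)
  have 3: "triple (\<lambda>e b i out. M e b i out \<and> \<not> b) skip Q"
    by (rule triple_pre[OF triple_skip]) (simp add: M_def)
  have wf: "wf_fm d \<psi>" using ConjF.prems by simp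
  show ?case unfolding eval_prog.simps
  proof (rule triple_pre[OF triple_Seq[OF 1 triple_if_flag[OF 2 3]]])
    fix e b i out
    assume *: "i = 0 \<and> env_ok d e \<and>
      (\<forall>e'. agree d e e' \<longrightarrow> Q e' (sat n A d e (ConjF \<phi> \<psi>)) 0 out)"
    have "M e' (sat n A d e \<phi>) 0 out" if e': "agree d e e'" for e'
    proof -
      have "Q e'' (sat n A d e (ConjF \<phi> \<psi>)) 0 out" if "agree d e' e''" for e''
        using * agree_trans[OF e' that] by blast
      moreover have "Q e' (sat n A d e (ConjF \<phi> \<psi>)) 0 out" using * e' by blast
      ultimately show ?thesis
        using agree_env_ok[OF e' ConjF.prems(3)] * agree_sat[OF wf e'] unfolding M_def by auto
    qed
    then show "i = 0 \<and> env_ok d e \<and> (\<forall>e'. agree d e e' \<longrightarrow> M e' (sat n A d e \<phi>) 0 out)"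
      using * by blast
  qed
next
  case (ExF \<phi>)
  have dR: "d < R" "0 < R" using ExF.prems registers_ge[of "Suc d" \<phi>] by auto
  have wf: "wf_fm (Suc d) \<phi>" using ExF.prems by simp
  show ?case unfolding eval_prog.simps
  proof (rule triple_ghost)
    fix e0 b0 and i0 :: nat and out0
    assume *: "i0 = 0 \<and> env_ok d e0 \<and> (\<forall>e'. agree d e0 e' \<longrightarrow> Q e' (sat n A d e0 (ExF \<phi>)) 0 out0)"
    define S where "S v \<longleftrightarrow> sat n A (Suc d) (e0(d := v)) \<phi>" for v
    \<comment> \<open>No value below e d is a witness. A set flag means that the search has ended,
      at a witness or at n.\<close>
    define I where "I e b i out \<longleftrightarrow> i = 0 \<and> out = out0 \<and> agree d e0 e \<and> e d \<le> n \<and>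
      (\<forall>v<e d. \<not> S v) \<and> (if b then e d = n \<or> S (e d) else e d < n)" for e b and i :: nat and out
    have agree_upd: "agree d e0 (e(d := v)) \<longleftrightarrow> agree d e0 e" for e v
      unfolding agree_def by auto
    have zero: "e 0 = n" if "agree d e0 e" for e
      using that * ExF.prems(3) unfolding agree_def env_ok_def by simp
    have 1: "triple (\<lambda>e b i out. e = e0 \<and> b = b0 \<and> i = i0 \<and> out = out0) (clear d)
      (\<lambda>e b i out. I e (e d = e 0) i out)"
    proof (rule triple_pre[OF triple_clear[OF dR(1)]])
      fix e b i out assume e: "e = e0 \<and> b = b0 \<and> i = i0 \<and> out = out0"
      have "agree d e0 (e0(d := 0))" unfolding agree_def by simp
      then show "I (e(d := 0)) ((e(d := 0)) d = (e(d := 0)) 0) i out"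
        using e * zero[of "e0(d := 0)"] unfolding I_def by auto
    qed
    have 2: "triple (\<lambda>e b i out. I e (e d = e 0) i out) (eq_test d 0) I"
      by (rule triple_eq_test[OF dR])
    have 3: "triple I (until_flag (Seq (eval_prog (Suc d) \<phi>) (if_flag skip (Seq (incr d) (eq_test d 0)))))
      (\<lambda>e b i out. I e b i out \<and> b)"
    proof (rule triple_until_flag[where \<mu> = "\<lambda>e. n - e d"])
      fix m
      let ?Q = "\<lambda>e b i out. I e b i out \<and> (\<not> b \<longrightarrow> n - e d < m)"
      define M where "M e b i out \<longleftrightarrow> i = 0 \<and> out = out0 \<and> agree d e0 e \<and> e d < n \<and> n - e d = m \<and>
        (\<forall>v<e d. \<not> S v) \<and> b = S (e d)" for e b and i :: nat and out
      have a: "triple (\<lambda>e b i out. i = 0 \<and> env_ok (Suc d) e \<and>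
         (\<forall>e'. agree (Suc d) e e' \<longrightarrow> M e' (sat n A (Suc d) e \<phi>) 0 out)) (eval_prog (Suc d) \<phi>) M"
        using ExF.prems by (intro ExF.IH) auto
      have a': "triple (\<lambda>e b i out. I e b i out \<and> \<not> b \<and> n - e d = m) (eval_prog (Suc d) \<phi>) M"
      proof (rule triple_pre[OF a])
        fix e b i out assume e: "I e b i out \<and> \<not> b \<and> n - e d = m"
        then have ag: "agree d e0 e" and ed: "e d < n" by (auto simp: I_def)
        have "env_ok d e" using agree_env_ok[OF ag ExF.prems(3)] * by blast
        then have "env_ok (Suc d) e" using ed by (auto simp: env_ok_def less_Suc_eq)
        moreover have sat: "sat n A (Suc d) e \<phi> \<longleftrightarrow> S (e d)"
          unfolding S_def using ag by (intro sat_cong[OF wf]) (auto simp: agree_def less_Suc_eq)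
        moreover have "M e' (sat n A (Suc d) e \<phi>) 0 out" if e': "agree (Suc d) e e'" for e'
        proof -
          have "e' d = e d" using e' ExF.prems(3) by (auto simp: agree_def)
          then show ?thesis
            using e sat agree_trans[OF ag agree_Suc[OF e']] ed by (auto simp: M_def I_def)
        qed
        ultimately show "i = 0 \<and> env_ok (Suc d) e \<and>
          (\<forall>e'. agree (Suc d) e e' \<longrightarrow> M e' (sat n A (Suc d) e \<phi>) 0 out)"
          using e by (auto simp: I_def)
      qed
      have b: "triple (\<lambda>e b i out. M e b i out \<and> b) skip ?Q"
        by (rule triple_pre[OF triple_skip]) (auto simp: M_def I_def)
      have c2: "triple (\<lambda>e b i out. ?Q e (e d = e 0) i out) (eq_test d 0) ?Q"
        by (rule triple_eq_test[OF dR])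
      have c1: "triple (\<lambda>e b i out. M e b i out \<and> \<not> b) (incr d) (\<lambda>e b i out. ?Q e (e d = e 0) i out)"
      proof (rule triple_pre[OF triple_incr[OF dR(1)]])
        fix e b i out assume e: "M e b i out \<and> \<not> b"
        then have ag: "agree d e0 e" and ed: "e d < n" by (auto simp: M_def)
        let ?e = "e(d := Suc (e d))"
        have "agree d e0 ?e" using ag agree_upd by simp
        then have "?e 0 = n" by (rule zero)
        then show "Suc (e d) < 2 ^ K \<and> ?Q ?e (?e d = ?e 0) i out"
          using e ed n_less \<open>agree d e0 ?e\<close> by (auto simp: M_def I_def less_Suc_eq)
      qed
      show "triple (\<lambda>e b i out. I e b i out \<and> \<not> b \<and> n - e d = m)
        (Seq (eval_prog (Suc d) \<phi>) (if_flag skip (Seq (incr d) (eq_test d 0)))) ?Q"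
        by (rule triple_Seq[OF a' triple_if_flag[OF b triple_Seq[OF c1 c2]]])
    qed
    \<comment> \<open>The search ends at n exactly when there is no witness, hence the final
      negation.\<close>
    have 4: "triple (\<lambda>e b i out. I e b i out \<and> b) (eq_test d 0) (\<lambda>e b i out. Q e (\<not> b) i out)"
    proof (rule triple_pre[OF triple_eq_test[OF dR]])
      fix e b i out assume e: "I e b i out \<and> b"
      then have ag: "agree d e0 e" by (simp add: I_def)
      have "e d \<le> n" "\<forall>v<e d. \<not> S v" "e d = n \<or> S (e d)" using e by (auto simp: I_def)
      then have "(\<exists>v<n. S v) \<longleftrightarrow> e d \<noteq> n" by (metis le_neq_implies_less)
      then have "sat n A d e0 (ExF \<phi>) \<longleftrightarrow> e d \<noteq> e 0" using zero[OF ag] by (simp add: S_def)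
      then show "Q e (\<not> e d = e 0) i out" using * e ag by (auto simp: I_def)
    qed
    show "triple (\<lambda>e b i out. e = e0 \<and> b = b0 \<and> i = i0 \<and> out = out0)
      (Seq (clear d) (Seq (eq_test d 0)
     (Seq (until_flag (Seq (eval_prog (Suc d) \<phi>) (if_flag skip (Seq (incr d) (eq_test d 0)))))
       (Seq (eq_test d 0) negate_flag)))) Q"
      by (rule triple_Seq[OF 1 triple_Seq[OF 2 triple_Seq[OF 3 triple_Seq[OF 4 triple_negate_flag]]]])
  qed
qed

end

section \<open>Listing a definable family of sets\<close>

definition env3 :: "nat \<Rightarrow> nat \<Rightarrow> nat \<Rightarrow> nat \<Rightarrow> nat" where
  "env3 u x y j = (if j = 2 then u else if j = 3 then x else y)"

definition set_prog :: "fm \<Rightarrow> prog" where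
  "set_prog \<psi> = upto 4 0 (Seq (eval_prog 5 \<psi>) (if_flag (emit One) (emit Zero)))"

definition guarded_set_prog :: "fm \<Rightarrow> fm \<Rightarrow> prog" where
  "guarded_set_prog \<gamma> \<psi> = Seq (eval_prog 4 \<gamma>) (if_flag (Seq (set_prog \<psi>) (emit Sep)) skip)"

definition sets_prog :: "fm \<Rightarrow> fm \<Rightarrow> prog" where
  "sets_prog \<gamma> \<psi> = upto 2 0 (upto 3 0 (guarded_set_prog \<gamma> \<psi>))"

lemma enc_sets_snoc:
  "enc_sets n (Xs @ [X]) = enc_sets n Xs @ map (\<lambda>v. if v \<in> X then One else Zero) [0..<n] @ [Sep]"
  by (simp add: enc_sets_def)

context matrix_machine
begin

lemma triple_sets_prog:
  assumes wf: "wf_fm 4 \<gamma>" "wf_fm 5 \<psi>" and R: "registers 4 \<gamma> \<le> R" "registers 5 \<psi> \<le> R"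
  defines "g \<equiv> \<lambda>u x. sat n A 4 (env3 u x 0) \<gamma>"
    and "X \<equiv> \<lambda>u x. {y. y < n \<and> sat n A 5 (env3 u x y) \<psi>}"
  shows "triple (\<lambda>e b i out. e 0 = n \<and> i = 0 \<and> out = []) (sets_prog \<gamma> \<psi>)
    (\<lambda>e b i out. \<exists>Xs. out = enc_sets n Xs \<and> set Xs = {X u x | u x. u < n \<and> x < n \<and> g u x})"
proof -
  have R5: "5 \<le> R" using registers_ge[of 5 \<psi>] R(2) by simp
  define J where "J k e i out \<longleftrightarrow> i = 0 \<and> e 0 = n \<and>
    (\<exists>Xs. out = enc_sets n Xs \<and> set Xs = {X u x | u x. u < k \<and> x < n \<and> g u x})"
    for k :: nat and e :: "nat \<Rightarrow> nat" and i :: nat and out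
  have "triple (\<lambda>e b i out. e 0 = n \<and> i = 0 \<and> out = []) (sets_prog \<gamma> \<psi>)
      (\<lambda>e b i out. e 2 = n \<and> e 0 = n \<and> J n e i out)"
    unfolding sets_prog_def
  proof (rule triple_upto)
    show "2 < R" "0 < R" "2 \<noteq> (0::nat)" using R5 by auto
    show "e 0 = n \<and> J 0 (e(2 := 0)) i out" if "e 0 = n \<and> i = 0 \<and> out = []" for e i out
      using that by (auto simp: J_def enc_sets_def)
    fix u assume u: "u < n"
    \<comment> \<open>All sets of earlier vertices are written, and those of the current u for x <
      k.\<close>
    define J' where "J' k e i out \<longleftrightarrow> i = 0 \<and> e 0 = n \<and> e 2 = u \<and>
      (\<exists>Xs. out = enc_sets n Xs \<and>
        set Xs = {X a x | a x. a < u \<and> x < n \<and> g a x} \<union> {X u x | x. x < k \<and> g u x})"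
      for k :: nat and e :: "nat \<Rightarrow> nat" and i :: nat and out
    have inner: "triple (\<lambda>e b i out. e 2 = u \<and> e 0 = n \<and> J u e i out)
       (upto 3 0 (guarded_set_prog \<gamma> \<psi>))
       (\<lambda>e b i out. e 3 = n \<and> e 0 = n \<and> J' n e i out)"
    proof (rule triple_upto)
      show "3 < R" "0 < R" "3 \<noteq> (0::nat)" using R5 by auto
      show "e 0 = n \<and> J' 0 (e(3 := 0)) i out" if "e 2 = u \<and> e 0 = n \<and> J u e i out" for e i out
        using that by (auto simp: J_def J'_def)
      fix x assume x: "x < n"
      show "triple (\<lambda>e b i out. e 3 = x \<and> e 0 = n \<and> J' x e i out)
         (guarded_set_prog \<gamma> \<psi>)
         (\<lambda>e b i out. e 3 = x \<and> e 0 = n \<and> J' (Suc x) (e(3 := Suc x)) i out)"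
      proof (rule triple_ghost)
        fix e0 b0 and i0 :: nat and out0
        assume *: "e0 3 = x \<and> e0 0 = n \<and> J' x e0 i0 out0"
        then obtain Xs where Xs: "out0 = enc_sets n Xs"
          "set Xs = {X a x | a x. a < u \<and> x < n \<and> g a x} \<union> {X u y | y. y < x \<and> g u y}"
          unfolding J'_def by blast
        define M where "M e i \<longleftrightarrow> i = 0 \<and> e 0 = n \<and> e 2 = u \<and> e 3 = x"
          for e :: "nat \<Rightarrow> nat" and i :: nat
        let ?Q = "\<lambda>e b i out. e 3 = x \<and> e 0 = n \<and> J' (Suc x) (e(3 := Suc x)) i out"
        have 1: "triple (\<lambda>e b i out. e = e0 \<and> b = b0 \<and> i = i0 \<and> out = out0) (eval_prog 4 \<gamma>)
          (\<lambda>e b i out. M e i \<and> b = g u x \<and> out = out0)"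
        proof (rule triple_pre[OF triple_eval_prog[OF wf(1) R(1)]])
          fix e b i out assume e: "e = e0 \<and> b = b0 \<and> i = i0 \<and> out = out0"
          have env: "e0 2 = u" "e0 3 = x" "e0 0 = n" "i0 = 0" using * by (auto simp: J'_def)
          have "sat n A 4 e0 \<gamma> \<longleftrightarrow> g u x"
            unfolding g_def
          proof (rule sat_cong[OF wf(1)])
            fix j :: nat assume "2 \<le> j" "j < 4"
            then have "j = 2 \<or> j = 3" by auto
            then show "e0 j = env3 u x 0 j" using env by (auto simp: env3_def)
          qed
          moreover have "env_ok 4 e0"
            unfolding env_ok_def
          proof (intro conjI allI impI)
            fix j :: nat assume "2 \<le> j \<and> j < 4"
            then have "j = 2 \<or> j = 3" by auto
            then show "e0 j < n" using env u x by auto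
          qed (use env in simp)
          ultimately show "i = 0 \<and> env_ok 4 e \<and> (\<forall>e'. agree 4 e e' \<longrightarrow>
              M e' 0 \<and> sat n A 4 e \<gamma> = g u x \<and> out = out0)"
            using e env by (auto simp: M_def agree_def)
        qed simp
        \<comment> \<open>The output followed by the first k letters of the characteristic vector of
          \<open>X u x\<close>.\<close>
        define out1 where "out1 k = out0 @ map (\<lambda>v. if v \<in> X u x then One else Zero) [0..<k]" for k
        have 2: "triple (\<lambda>e b i out. (M e i \<and> b = g u x \<and> out = out0) \<and> b)
           (set_prog \<psi>) (\<lambda>e b i out. e 4 = n \<and> e 0 = n \<and> (M e i \<and> g u x \<and> out = out1 n))"
          unfolding set_prog_def
        proof (rule triple_upto)
          show "4 < R" "0 < R" "4 \<noteq> (0::nat)" using R5 by auto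
          show "e 0 = n \<and> (M (e(4 := 0)) i \<and> g u x \<and> out = out1 0)"
            if "(M e i \<and> b = g u x \<and> out = out0) \<and> b" for e b i out
            using that by (auto simp: M_def out1_def)
          fix y assume y: "y < n"
          let ?Q' = "\<lambda>e b i out. e 4 = y \<and> e 0 = n \<and> (M (e(4 := Suc y)) i \<and> g u x \<and> out = out1 (Suc y))"
          define s where "s \<longleftrightarrow> sat n A 5 (env3 u x y) \<psi>"
          have out1: "out1 (Suc y) = out1 y @ [if s then One else Zero]"
            using y by (simp add: out1_def X_def s_def)
          have a: "triple (\<lambda>e b i out. e 4 = y \<and> e 0 = n \<and> (M e i \<and> g u x \<and> out = out1 y)) (eval_prog 5 \<psi>)
            (\<lambda>e b i out. e 4 = y \<and> M e i \<and> g u x \<and> b = s \<and> out = out1 y)"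
          proof (rule triple_pre[OF triple_eval_prog[OF wf(2) R(2)]])
            fix e b i out assume e: "e 4 = y \<and> e 0 = n \<and> (M e i \<and> g u x \<and> out = out1 y)"
            then have env: "e 2 = u" "e 3 = x" "e 4 = y" "e 0 = n" "i = 0" by (auto simp: M_def)
            have "sat n A 5 e \<psi> \<longleftrightarrow> s"
              unfolding s_def
            proof (rule sat_cong[OF wf(2)])
              fix j :: nat assume "2 \<le> j" "j < 5"
              then have "j = 2 \<or> j = 3 \<or> j = 4" by auto
              then show "e j = env3 u x y j" using env by (auto simp: env3_def)
            qed
            moreover have "env_ok 5 e"
              unfolding env_ok_def
            proof (intro conjI allI impI)
              fix j :: nat assume "2 \<le> j \<and> j < 5"
              then have "j = 2 \<or> j = 3 \<or> j = 4" by auto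
              then show "e j < n" using env u x y by auto
            qed (use env in simp)
            ultimately show "i = 0 \<and> env_ok 5 e \<and> (\<forall>e'. agree 5 e e' \<longrightarrow>
                e' 4 = y \<and> M e' 0 \<and> g u x \<and> sat n A 5 e \<psi> = s \<and> out = out1 y)"
              using e env by (auto simp: M_def agree_def)
          qed simp
          have b: "triple (\<lambda>e b i out. (e 4 = y \<and> M e i \<and> g u x \<and> b = s \<and> out = out1 y) \<and> b) (emit One) ?Q'"
            by (rule triple_pre[OF triple_emit]) (auto simp: out1 M_def)
          have c: "triple (\<lambda>e b i out. (e 4 = y \<and> M e i \<and> g u x \<and> b = s \<and> out = out1 y) \<and> \<not> b) (emit Zero) ?Q'"
            by (rule triple_pre[OF triple_emit]) (auto simp: out1 M_def)
          show "triple (\<lambda>e b i out. e 4 = y \<and> e 0 = n \<and> (M e i \<and> g u x \<and> out = out1 y))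
            (Seq (eval_prog 5 \<psi>) (if_flag (emit One) (emit Zero))) ?Q'"
            by (rule triple_Seq[OF a triple_if_flag[OF b c]])
        qed
        have 3: "triple (\<lambda>e b i out. e 4 = n \<and> e 0 = n \<and> (M e i \<and> g u x \<and> out = out1 n)) (emit Sep) ?Q"
        proof (rule triple_pre[OF triple_emit])
          fix e b i out assume e: "e 4 = n \<and> e 0 = n \<and> (M e i \<and> g u x \<and> out = out1 n)"
          have "out @ [Sep] = enc_sets n (Xs @ [X u x])"
            using e Xs(1) by (simp add: out1_def enc_sets_snoc)
          moreover have "set (Xs @ [X u x]) = {X a x | a x. a < u \<and> x < n \<and> g a x} \<union>
              {X u y | y. y < Suc x \<and> g u y}"
            using Xs(2) e by (auto simp: less_Suc_eq)
          ultimately have "\<exists>Ys. out @ [Sep] = enc_sets n Ys \<and> set Ys =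
              {X a x | a x. a < u \<and> x < n \<and> g a x} \<union> {X u y | y. y < Suc x \<and> g u y}" by blast
          then show "e 3 = x \<and> e 0 = n \<and> J' (Suc x) (e(3 := Suc x)) i (out @ [Sep])"
            using e unfolding J'_def M_def by simp
        qed
        have 4: "triple (\<lambda>e b i out. (M e i \<and> b = g u x \<and> out = out0) \<and> \<not> b) skip ?Q"
        proof (rule triple_pre[OF triple_skip])
          fix e b i out assume e: "(M e i \<and> b = g u x \<and> out = out0) \<and> \<not> b"
          have "set Xs = {X a x | a x. a < u \<and> x < n \<and> g a x} \<union> {X u y | y. y < Suc x \<and> g u y}"
            using Xs(2) e by (auto simp: less_Suc_eq)
          then show "e 3 = x \<and> e 0 = n \<and> J' (Suc x) (e(3 := Suc x)) i out"
            using e Xs(1) unfolding J'_def M_def by auto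
        qed
        show "triple (\<lambda>e b i out. e = e0 \<and> b = b0 \<and> i = i0 \<and> out = out0)
         (guarded_set_prog \<gamma> \<psi>) ?Q"
          unfolding guarded_set_prog_def by (rule triple_Seq[OF 1 triple_if_flag[OF triple_Seq[OF 2 3] 4]])
      qed
    qed
    show "triple (\<lambda>e b i out. e 2 = u \<and> e 0 = n \<and> J u e i out)
       (upto 3 0 (guarded_set_prog \<gamma> \<psi>))
       (\<lambda>e b i out. e 2 = u \<and> e 0 = n \<and> J (Suc u) (e(2 := Suc u)) i out)"
    proof (rule triple_post[OF inner])
      fix e b i out assume e: "e 3 = n \<and> e 0 = n \<and> J' n e i out"
      have "{X a x | a x. a < u \<and> x < n \<and> g a x} \<union> {X u y | y. y < n \<and> g u y} =
        {X a x | a x. a < Suc u \<and> x < n \<and> g a x}"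
        by (auto simp: less_Suc_eq)
      then show "e 2 = u \<and> e 0 = n \<and> J (Suc u) (e(2 := Suc u)) i out"
        using e unfolding J_def J'_def by auto
    qed
  qed
  then show ?thesis by (rule triple_post) (auto simp: J_def)
qed

end

section \<open>Encoded graphs and the number of vertices\<close>

lemma length_enc_sets: "length (enc_sets n Xs) = length Xs * Suc n"
  by (induction Xs) (simp_all add: enc_sets_def)

lemma enc_sets_nth:
  "a < length Xs \<Longrightarrow> c \<le> n \<Longrightarrow> enc_sets n Xs ! (a * Suc n + c) =
     (if c = n then Sep else if c \<in> Xs ! a then One else Zero)"
proof (induction Xs arbitrary: a)
  case (Cons X Xs)
  let ?r = "map (\<lambda>v. if v \<in> X then One else Zero) [0..<n] @ [Sep]"
  have split: "enc_sets n (X # Xs) = ?r @ enc_sets n Xs" by (simp add: enc_sets_def)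
  show ?case
  proof (cases a)
    case 0
    then show ?thesis unfolding split using Cons.prems by (auto simp: nth_append)
  next
    case (Suc a')
    have "enc_sets n (X # Xs) ! (a * Suc n + c) = enc_sets n Xs ! (a' * Suc n + c)"
      unfolding split Suc by (simp add: nth_append add.assoc)
    then show ?thesis using Cons Suc by simp
  qed
qed simp

text \<open>The first row has as many letters as there are vertices. The right end marker is the
  stop for the empty graph, whose code is empty. The first action makes a ruler of one cell, which
  the increments extend.\<close>

definition count_prog :: prog where
  "count_prog = Seq (Act (\<lambda>s. {0, Suc 0}) Stay Stay None) (Seq input_right
     (While (\<lambda>c s. c \<noteq> Letter Sep \<and> c \<noteq> RightEnd) (Seq (incr 0) input_right)))"

lemma exec_count_prog:
  assumes stop: "input_cell w (Suc n) = Letter Sep \<or> input_cell w (Suc n) = RightEnd"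
    and cells: "\<And>c. c < n \<Longrightarrow> input_cell w (Suc c) \<noteq> Letter Sep \<and> input_cell w (Suc c) \<noteq> RightEnd"
    and len: "n \<le> length w" and B: "Suc (floorlog 2 n) < B" and R: "0 < R"
  obtains K where "0 < K" "K < B" "n < 2 ^ K"
    "exec w B count_prog (0, 0, \<lambda>_. {}, []) (Suc n, 0, tape R K ((\<lambda>_. 0)(0 := n)) False, [])"
proof -
  let ?loop = "While (\<lambda>c s. c \<noteq> Letter Sep \<and> c \<noteq> RightEnd) (Seq (incr 0) input_right)"
  have right: "exec w B input_right (i, 0, t, out) (Suc i, 0, t, out)" if "i \<le> length w" for i t out
    unfolding input_right_def
    using B that by (intro exec_ActI) (simp_all add: min_absorb2)
  \<comment> \<open>The last condition says that the ruler is no longer than the count m requires;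
    it keeps the final length below B.\<close>
  have loop: "\<exists>K. 0 < K \<and> K < B \<and> n < 2 ^ K \<and>
      exec w B ?loop (Suc m, 0, tape R K0 ((\<lambda>_. 0)(0 := m)) False, [])
        (Suc n, 0, tape R K ((\<lambda>_. 0)(0 := n)) False, [])"
    if "m \<le> n" "0 < K0" "m < 2 ^ K0" "K0 = 1 \<or> 2 ^ (K0 - 1) \<le> m" for m K0
    using that
  proof (induction "n - m" arbitrary: m K0)
    have small: "K < B" if "K = 1 \<or> 2 ^ (K - 1) \<le> n" for K
      using that floorlog_geI[of 2 K n] B by auto
    case 0
    then have m: "m = n" by simp
    have "K0 < B" using small 0 m by auto
    moreover have "exec w B ?loop (Suc n, 0, tape R K0 ((\<lambda>_. 0)(0 := n)) False, [])
        (Suc n, 0, tape R K0 ((\<lambda>_. 0)(0 := n)) False, [])"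
      using stop by (intro exec.WhileF) auto
    ultimately show ?case using 0 m by blast
  next
    case (Suc d)
    have small: "K < B" if "K = 1 \<or> 2 ^ (K - 1) \<le> n" for K
      using that floorlog_geI[of 2 K n] B by auto
    have m: "m < n" using Suc.hyps(2) by simp
    have "K0 = 1 \<or> 2 ^ (K0 - 1) \<le> n" using Suc.prems m by auto
    then have KB: "K0 < B" by (rule small)
    define K1 where "K1 = (if Suc m < 2 ^ K0 then K0 else Suc K0)"
    have upd: "((\<lambda>_. 0)(0 := m))(0 := Suc (((\<lambda>_. 0)(0 := m)) 0)) = (\<lambda>_. 0 :: nat)(0 := Suc m)" by auto
    have "exec w B (incr 0) (Suc m, 0, tape R K0 ((\<lambda>_. 0)(0 := m)) False, [])
      (Suc m, 0, tape R K1 ((\<lambda>_. 0)(0 := Suc m)) False, [])"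
      using exec_incr[OF Suc.prems(2) KB _ R, of "Suc m" w "(\<lambda>_. 0)(0 := m)" False "[]"]
        m len Suc.prems(3) unfolding upd K1_def by simp
    then have body: "exec w B (Seq (incr 0) input_right) (Suc m, 0, tape R K0 ((\<lambda>_. 0)(0 := m)) False, [])
      (Suc (Suc m), 0, tape R K1 ((\<lambda>_. 0)(0 := Suc m)) False, [])"
      using right[of "Suc m"] m len by (intro exec.Seq) auto
    have K1: "0 < K1" "Suc m < 2 ^ K1" "K1 = 1 \<or> 2 ^ (K1 - 1) \<le> Suc m"
      using Suc.prems unfolding K1_def by auto
    have "d = n - Suc m" "Suc m \<le> n" using Suc.hyps(2) m by auto
    then obtain K where K: "0 < K" "K < B" "n < 2 ^ K"
      "exec w B ?loop (Suc (Suc m), 0, tape R K1 ((\<lambda>_. 0)(0 := Suc m)) False, [])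
        (Suc n, 0, tape R K ((\<lambda>_. 0)(0 := n)) False, [])"
      using Suc.hyps(1)[OF _ _ K1] by blast
    have "exec w B ?loop (Suc m, 0, tape R K0 ((\<lambda>_. 0)(0 := m)) False, [])
        (Suc n, 0, tape R K ((\<lambda>_. 0)(0 := n)) False, [])"
      using cells[OF m] by (intro exec.WhileT[OF _ body K(4)]) simp
    then show ?case using K by blast
  qed
  obtain K where K: "0 < K" "K < B" "n < 2 ^ K"
      "exec w B ?loop (Suc 0, 0, tape R 1 ((\<lambda>_. 0)(0 := 0)) False, [])
        (Suc n, 0, tape R K ((\<lambda>_. 0)(0 := n)) False, [])"
    using loop[of 0 1] by auto
  have "(\<lambda>_. {})(0 := {0, Suc 0}) = tape R 1 ((\<lambda>_. 0)(0 := 0)) False"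
    by (intro ext tape_eqI) auto
  then have 1: "exec w B (Act (\<lambda>s. {0, Suc 0}) Stay Stay None) (0, 0, \<lambda>_. {}, [])
    (0, 0, tape R 1 ((\<lambda>_. 0)(0 := 0)) False, [])"
    using B by (intro exec_ActI) simp_all
  have "exec w B count_prog (0, 0, \<lambda>_. {}, []) (Suc n, 0, tape R K ((\<lambda>_. 0)(0 := n)) False, [])"
    unfolding count_prog_def by (rule exec.Seq[OF 1 exec.Seq[OF right[of 0] K(4)]]) simp
  then show ?thesis using K(1-3) that by blast
qed

lemma enc_graph_cell:
  assumes "verts G = {0..<n}" "a < n" "c \<le> n"
  shows "input_cell (enc_graph G) (Suc (a * Suc n + c)) =
    Letter (if c = n then Sep else if adj G a c then One else Zero)"
proof -
  have "a * Suc n + c < n * Suc n"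
  proof -
    have "Suc a * Suc n \<le> n * Suc n" using assms(2) by (intro mult_le_mono1) simp
    then show ?thesis using assms(3) by simp
  qed
  moreover have "enc_graph G = enc_sets n (map (nbh G) [0..<n])"
    using assms(1) by (simp add: enc_graph_def Let_def)
  ultimately show ?thesis
    using enc_sets_nth[of a "map (nbh G) [0..<n]" c n] assms
    by (auto simp: input_cell_def length_enc_sets nbh_def)
qed

text \<open>The formula \<gamma> selects index pairs, and \<psi> the members of the set for a pair.
  The number of registers depends on the formulas only, not on the graph, so the registers fit into
  finitely many tracks of one tape.\<close>

theorem logspace_computable_definable_family:
  assumes wf: "wf_fm 4 \<gamma>" "wf_fm 5 \<psi>"
    and f: "\<And>G n. admissible G \<Longrightarrow> verts G = {0..<n} \<Longrightarrow>
      f G = {{y. y < n \<and> sat n (adj G) 5 (env3 u x y) \<psi>} | u x.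
        u < n \<and> x < n \<and> sat n (adj G) 4 (env3 u x 0) \<gamma>}"
  shows "logspace_computable_family f"
  unfolding logspace_computable_family_def
proof (rule logspace_computableI)
  define R where "R = max (registers 4 \<gamma>) (registers 5 \<psi>)"
  have R5: "5 \<le> R" using registers_ge[of 5 \<psi>] by (simp add: R_def)
  show "wf_prog (R + 3) (Seq count_prog (Seq rewind_input (sets_prog \<gamma> \<psi>)))"
    using R5 by (auto simp: count_prog_def sets_prog_def guarded_set_prog_def set_prog_def wf_prog_simps wf_eval_prog R_def)
  show "0 < (2 :: nat)" by simp
  fix G :: "nat graph"
  assume "G \<in> {G. admissible G \<and> (\<exists>n. verts G = {0..<n})}"
  then obtain n where G: "admissible G" and V: "verts G = {0..<n}" by blast
  let ?w = "enc_graph G"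
  \<comment> \<open>A ruler for n fits because n is at most the input length; the factor 2 makes the
    inequality strict, also for the empty input.\<close>
  let ?B = "2 * Suc (floorlog 2 (length ?w))"
  have len: "length ?w = n * Suc n"
    using V by (simp add: enc_graph_def Let_def length_enc_sets)
  have stop: "input_cell ?w (Suc n) = Letter Sep \<or> input_cell ?w (Suc n) = RightEnd"
    using enc_graph_cell[OF V, of 0 n] len by (cases "n = 0") (auto simp: input_cell_def)
  have cells: "input_cell ?w (Suc c) \<noteq> Letter Sep \<and> input_cell ?w (Suc c) \<noteq> RightEnd" if "c < n" for c
    using enc_graph_cell[OF V, of 0 c] that by auto
  have n_le: "n \<le> length ?w" unfolding len by simp
  then have "floorlog 2 n \<le> floorlog 2 (length ?w)" by (rule floorlog_mono)
  then have B: "Suc (floorlog 2 n) < ?B" by simp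
  obtain K where K: "0 < K" "K < ?B" "n < 2 ^ K"
    and count: "exec ?w ?B count_prog (0, 0, \<lambda>_. {}, []) (Suc n, 0, tape R K ((\<lambda>_. 0)(0 := n)) False, [])"
    by (rule exec_count_prog[of ?w n ?B R]) (use stop cells n_le B R5 in auto)
  interpret matrix_machine ?w ?B R K n "adj G"
    by unfold_locales (use K len enc_graph_cell[OF V] in auto)
  have sets: "triple (\<lambda>e b i out. e 0 = n \<and> i = 0 \<and> out = []) (sets_prog \<gamma> \<psi>)
    (\<lambda>e b i out. \<exists>Xs. out = enc_sets n Xs \<and> set Xs = f G)"
    using triple_sets_prog[OF wf, unfolded f[OF G V, symmetric]] by (simp add: R_def)
  \<comment> \<open>The trivial equation is the condition i = 0 of the postcondition, taken at the
    rewound head position.\<close>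
  have rw: "triple (\<lambda>e b i out. e 0 = n \<and> (0::nat) = 0 \<and> out = []) rewind_input
     (\<lambda>e b i out. e 0 = n \<and> i = 0 \<and> out = [])"
    by (rule triple_rewind_input)
  obtain e b i out where run: "exec ?w ?B (Seq rewind_input (sets_prog \<gamma> \<psi>))
      (Suc n, 0, tape R K ((\<lambda>_. 0)(0 := n)) False, []) (i, 0, tape R K e b, out)"
    "\<exists>Xs. out = enc_sets n Xs \<and> set Xs = f G"
    by (rule tripleD[OF triple_Seq[OF rw sets], of "(\<lambda>_. 0)(0 := n)" "[]" "Suc n" False])
      (use n_less len in auto)
  show "\<exists>i h t out. (\<exists>Xs. set Xs = f G \<and> out = enc_sets (card (verts G)) Xs) \<and>
      exec ?w ?B (Seq count_prog (Seq rewind_input (sets_prog \<gamma> \<psi>))) (0, 0, \<lambda>_. {}, []) (i, h, t, out)"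
  proof -
    obtain Xs where Xs: "out = enc_sets n Xs" "set Xs = f G" using run(2) by blast
    show ?thesis
    proof (intro exI conjI)
      show "exec ?w ?B (Seq count_prog (Seq rewind_input (sets_prog \<gamma> \<psi>))) (0, 0, \<lambda>_. {}, [])
          (i, 0, tape R K e b, out)"
        by (rule exec.Seq[OF count run(1)])
      show "set Xs = f G" by (rule Xs(2))
      show "out = enc_sets (card (verts G)) Xs" using Xs(1) V by simp
    qed
  qed
qed

section \<open>Defining formulas\<close>

definition disjF :: "fm \<Rightarrow> fm \<Rightarrow> fm" where "disjF \<phi> \<psi> = NegF (ConjF (NegF \<phi>) (NegF \<psi>))"

definition impF :: "fm \<Rightarrow> fm \<Rightarrow> fm" where "impF \<phi> \<psi> = NegF (ConjF \<phi> (NegF \<psi>))"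

definition allF :: "fm \<Rightarrow> fm" where "allF \<phi> = NegF (ExF (NegF \<phi>))"

definition cnbhF :: "nat \<Rightarrow> nat \<Rightarrow> fm" where "cnbhF w v = disjF (EqF w v) (AdjF v w)"

text \<open>The argument d is the current quantifier depth and hence the register bound by the next
  quantifier.\<close>

definition subF :: "nat \<Rightarrow> nat \<Rightarrow> nat \<Rightarrow> fm" where
  "subF d i j = allF (impF (cnbhF d i) (cnbhF d j))"

definition psubF :: "nat \<Rightarrow> nat \<Rightarrow> nat \<Rightarrow> fm" where
  "psubF d i j = ConjF (subF d i j) (NegF (subF d j i))"

definition privateF :: "nat \<Rightarrow> nat \<Rightarrow> nat \<Rightarrow> fm" where
  "privateF d i j = allF (impF (ConjF (cnbhF d i) (NegF (cnbhF d j))) (psubF (Suc d) d i))"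

text \<open>The condition that tells CC from OV once adjacency holds and both strict containments
  fail.\<close>

definition coverF :: "nat \<Rightarrow> nat \<Rightarrow> nat \<Rightarrow> fm" where
  "coverF d i j = ConjF (ExF (ConjF (cnbhF d i) (cnbhF d j)))
     (ConjF (ConjF (NegF (subF d i j)) (NegF (subF d j i)))
     (ConjF (allF (disjF (cnbhF d i) (cnbhF d j))) (ConjF (privateF d i j) (privateF d j i))))"

fun nmatF :: "itype \<Rightarrow> nat \<Rightarrow> nat \<Rightarrow> nat \<Rightarrow> fm" where
  "nmatF DI d i j = NegF (AdjF i j)"
| "nmatF CD d i j = ConjF (AdjF i j) (psubF d i j)"
| "nmatF CS d i j = ConjF (AdjF i j) (psubF d j i)"
| "nmatF CC d i j = ConjF (ConjF (AdjF i j) (ConjF (NegF (psubF d i j)) (NegF (psubF d j i)))) (coverF d i j)"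
| "nmatF OV d i j = ConjF (ConjF (AdjF i j) (ConjF (NegF (psubF d i j)) (NegF (psubF d j i)))) (NegF (coverF d i j))"

definition ov_triangleF :: "nat \<Rightarrow> nat \<Rightarrow> nat \<Rightarrow> nat \<Rightarrow> fm" where
  "ov_triangleF d i j k =
     ConjF (ConjF (NegF (EqF i j)) (ConjF (NegF (EqF i k)) (NegF (EqF j k))))
       (ConjF (nmatF OV d i j) (ConjF (nmatF OV d i k) (nmatF OV d j k)))"

definition excl1F :: "nat \<Rightarrow> nat \<Rightarrow> nat \<Rightarrow> nat \<Rightarrow> fm" where
  "excl1F w i j k = ConjF (ConjF (NegF (EqF w i)) (ConjF (NegF (EqF w j)) (NegF (EqF w k))))
     (ConjF (AdjF w i) (ConjF (NegF (AdjF w j)) (NegF (AdjF w k))))"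

text \<open>The non-neighbour k comes last, so the in-between formula passes its middle vertex in
  that place.\<close>

definition excl2F :: "nat \<Rightarrow> nat \<Rightarrow> nat \<Rightarrow> nat \<Rightarrow> fm" where
  "excl2F w i j k = ConjF (ConjF (NegF (EqF w i)) (ConjF (NegF (EqF w j)) (NegF (EqF w k))))
     (ConjF (AdjF w i) (ConjF (AdjF w j) (NegF (AdjF w k))))"

definition excl_CDF :: "nat \<Rightarrow> nat \<Rightarrow> nat \<Rightarrow> nat \<Rightarrow> fm" where
  "excl_CDF d i j k = allF (impF (excl1F d i j k) (nmatF CD (Suc d) d i))"

definition DeltaF :: "nat \<Rightarrow> nat \<Rightarrow> nat \<Rightarrow> nat \<Rightarrow> fm" where
  "DeltaF d i j k = ConjF (ov_triangleF d i j k)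
     (ConjF (allF (disjF (cnbhF d i) (disjF (cnbhF d j) (cnbhF d k))))
       (ConjF (excl_CDF d i j k) (ConjF (excl_CDF d j i k) (excl_CDF d k i j))))"

definition in_betweenF :: "nat \<Rightarrow> nat \<Rightarrow> nat \<Rightarrow> nat \<Rightarrow> fm" where
  "in_betweenF d b a c = ConjF (ov_triangleF d a b c) (ConjF (NegF (DeltaF d a b c))
     (disjF (ConjF (ExF (excl1F d a b c)) (ExF (excl1F d c a b)))
       (ExF (ConjF (excl2F d a c b) (DeltaF (Suc d) a c d)))))"

definition same_sideF :: "nat \<Rightarrow> nat \<Rightarrow> nat \<Rightarrow> nat \<Rightarrow> fm" where
  "same_sideF d u x y = ConjF (ConjF (nmatF OV d u x) (nmatF OV d u y))
     (disjF (EqF x y) (disjF (nmatF CS d x y) (disjF (nmatF CD d x y)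
       (ConjF (nmatF OV d x y) (ConjF (NegF (DeltaF d x y u)) (NegF (in_betweenF d u x y)))))))"

definition memberF :: "nat \<Rightarrow> nat \<Rightarrow> nat \<Rightarrow> nat \<Rightarrow> fm" where
  "memberF d u x y = disjF (EqF y u) (disjF (nmatF CD d u y) (disjF (nmatF CC d u y)
     (same_sideF d u x y)))"

lemmas base_fm_defs = disjF_def impF_def allF_def cnbhF_def subF_def psubF_def privateF_def coverF_def

lemma wf_nmatF: "2 \<le> i \<Longrightarrow> 2 \<le> j \<Longrightarrow> i < d \<Longrightarrow> j < d \<Longrightarrow> wf_fm d (nmatF t d i j)"
  by (cases t) (auto simp: base_fm_defs)

lemma wf_DeltaF:
  "2 \<le> i \<Longrightarrow> 2 \<le> j \<Longrightarrow> 2 \<le> k \<Longrightarrow> i < d \<Longrightarrow> j < d \<Longrightarrow> k < d \<Longrightarrow> wf_fm d (DeltaF d i j k)"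
  by (simp add: DeltaF_def ov_triangleF_def excl_CDF_def excl1F_def allF_def impF_def disjF_def
      cnbhF_def wf_nmatF del: nmatF.simps)

lemma wf_memberF:
  "2 \<le> u \<Longrightarrow> 2 \<le> x \<Longrightarrow> 2 \<le> y \<Longrightarrow> u < d \<Longrightarrow> x < d \<Longrightarrow> y < d \<Longrightarrow> wf_fm d (memberF d u x y)"
  by (simp add: memberF_def same_sideF_def in_betweenF_def ov_triangleF_def excl1F_def excl2F_def
      disjF_def wf_nmatF wf_DeltaF del: nmatF.simps)

lemma sat_disjF [simp]: "sat n A d e (disjF \<phi> \<psi>) \<longleftrightarrow> sat n A d e \<phi> \<or> sat n A d e \<psi>"
  by (simp add: disjF_def)

lemma sat_impF [simp]: "sat n A d e (impF \<phi> \<psi>) \<longleftrightarrow> (sat n A d e \<phi> \<longrightarrow> sat n A d e \<psi>)"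
  by (simp add: impF_def)

lemma sat_allF [simp]: "sat n A d e (allF \<phi>) \<longleftrightarrow> (\<forall>v<n. sat n A (Suc d) (e(d := v)) \<phi>)"
  by (simp add: allF_def)

section \<open>Correctness of the defining formulas\<close>

lemma excl_nbh_1:
  assumes "i \<noteq> j" "i \<noteq> k"
  shows "excl_nbh G {i, j, k} {i} =
    {w \<in> verts G. w \<noteq> i \<and> w \<noteq> j \<and> w \<noteq> k \<and> adj G w i \<and> \<not> adj G w j \<and> \<not> adj G w k}"
  using assms by (auto simp: excl_nbh_def)

lemma excl_nbh_2:
  assumes "i \<noteq> k" "j \<noteq> k"
  shows "excl_nbh G {i, k, j} {i, j} =
    {w \<in> verts G. w \<noteq> i \<and> w \<noteq> j \<and> w \<noteq> k \<and> adj G w i \<and> adj G w j \<and> \<not> adj G w k}"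
  using assms by (auto simp: excl_nbh_def)

text \<open>Each vertex is moved to the front in turn, so that a single formula serves all three
  conditions on exclusive neighbours.\<close>

lemma Delta_3:
  "{i, j, k} \<in> Delta G \<longleftrightarrow> ov_triangle G {i, j, k} \<and> cnbh G i \<union> cnbh G j \<union> cnbh G k = verts G \<and>
     (\<forall>w\<in>excl_nbh G {i, j, k} {i}. nmat G w i = CD) \<and>
     (\<forall>w\<in>excl_nbh G {j, i, k} {j}. nmat G w j = CD) \<and>
     (\<forall>w\<in>excl_nbh G {k, i, j} {k}. nmat G w k = CD)"
proof -
  have "{j, i, k} = {i, j, k}" "{k, i, j} = {i, j, k}" by auto
  then show ?thesis unfolding Delta_def by (auto simp: Un_assoc)
qed

context
  fixes G :: "nat graph" and n :: nat
  assumes G: "simple_graph G" and V: "verts G = {0..<n}"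
begin

abbreviation holds :: "nat \<Rightarrow> (nat \<Rightarrow> nat) \<Rightarrow> fm \<Rightarrow> bool" where
  "holds \<equiv> sat n (adj G)"

lemma holds_cnbhF: "holds d e (cnbhF i j) \<longleftrightarrow> e i \<in> cnbh G (e j)"
  by (auto simp: cnbhF_def in_cnbh_iff[OF G])

lemma cnbh_bound: "v < n \<Longrightarrow> w \<in> cnbh G v \<Longrightarrow> w < n"
  using in_cnbh_verts[of w G v] V by simp

lemma holds_subF:
  "i < d \<Longrightarrow> j < d \<Longrightarrow> e i < n \<Longrightarrow> holds d e (subF d i j) \<longleftrightarrow> cnbh G (e i) \<subseteq> cnbh G (e j)"
  using cnbh_bound[of "e i"] by (auto simp: subF_def holds_cnbhF)

lemma holds_psubF:
  "i < d \<Longrightarrow> j < d \<Longrightarrow> e i < n \<Longrightarrow> e j < n \<Longrightarrow>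
     holds d e (psubF d i j) \<longleftrightarrow> cnbh G (e i) \<subset> cnbh G (e j)"
  by (auto simp: psubF_def holds_subF)

lemma holds_privateF:
  assumes "i < d" "j < d" "e i < n"
  shows "holds d e (privateF d i j) \<longleftrightarrow> (\<forall>w \<in> cnbh G (e i) - cnbh G (e j). cnbh G w \<subset> cnbh G (e i))"
proof -
  have "holds (Suc d) (e(d := w)) (psubF (Suc d) d i) \<longleftrightarrow> cnbh G w \<subset> cnbh G (e i)" if "w < n" for w
    using holds_psubF[of d "Suc d" i "e(d := w)"] assms that by simp
  then have "holds d e (privateF d i j) \<longleftrightarrow>
      (\<forall>w<n. w \<in> cnbh G (e i) \<and> w \<notin> cnbh G (e j) \<longrightarrow> cnbh G w \<subset> cnbh G (e i))"
    using assms by (simp add: privateF_def holds_cnbhF)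
  then show ?thesis using cnbh_bound[OF assms(3)] by blast
qed

lemma holds_coverF:
  assumes "i < d" "j < d" "e i < n" "e j < n"
  shows "holds d e (coverF d i j) \<longleftrightarrow>
    overlap (cnbh G (e i)) (cnbh G (e j)) \<and> cnbh G (e i) \<union> cnbh G (e j) = verts G \<and>
    (\<forall>w \<in> cnbh G (e i) - cnbh G (e j). cnbh G w \<subset> cnbh G (e i)) \<and>
    (\<forall>w \<in> cnbh G (e j) - cnbh G (e i). cnbh G w \<subset> cnbh G (e j))"
proof -
  have 1: "holds d e (ExF (ConjF (cnbhF d i) (cnbhF d j))) \<longleftrightarrow> cnbh G (e i) \<inter> cnbh G (e j) \<noteq> {}"
    using assms cnbh_bound[OF assms(3)] by (auto simp: holds_cnbhF)
  have 2: "holds d e (allF (disjF (cnbhF d i) (cnbhF d j))) \<longleftrightarrow>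
      cnbh G (e i) \<union> cnbh G (e j) = verts G"
  proof -
    have "holds d e (allF (disjF (cnbhF d i) (cnbhF d j))) \<longleftrightarrow> {0..<n} \<subseteq> cnbh G (e i) \<union> cnbh G (e j)"
      using assms by (auto simp: holds_cnbhF)
    moreover have "cnbh G (e i) \<union> cnbh G (e j) \<subseteq> {0..<n}"
      using cnbh_bound[OF assms(3)] cnbh_bound[OF assms(4)] by auto
    ultimately show ?thesis using V by auto
  qed
  have 3: "overlap X Y \<longleftrightarrow> X \<inter> Y \<noteq> {} \<and> \<not> X \<subseteq> Y \<and> \<not> Y \<subseteq> X" for X Y :: "nat set"
    by (auto simp: overlap_def)
  show ?thesis
    unfolding coverF_def sat.simps(3,4) 1 2 3 holds_privateF[of i d j e, OF assms(1-3)]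
      holds_privateF[of j d i e, OF assms(2,1,4)] holds_subF[of i d j e, OF assms(1-3)]
      holds_subF[of j d i e, OF assms(2,1,4)] by (simp only: conj_assoc)
qed

lemma holds_nmatF:
  assumes "i < d" "j < d" "e i < n" "e j < n"
  shows "holds d e (nmatF t d i j) \<longleftrightarrow> nmat G (e i) (e j) = t"
  by (cases t) (auto simp: nmat_def holds_psubF holds_coverF assms)

lemma holds_ov_triangleF:
  assumes "i < d" "j < d" "k < d" "e i < n" "e j < n" "e k < n"
  shows "holds d e (ov_triangleF d i j k) \<longleftrightarrow> ov_triangle G {e i, e j, e k}"
  unfolding ov_triangle3 ov_triangleF_def sat.simps
  using assms by (simp add: holds_nmatF V del: nmatF.simps)

lemma holds_excl1F:
  assumes "i < d" "j < d" "k < d" "w < n" "e i \<noteq> e j" "e i \<noteq> e k"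
  shows "holds d' (e(d := w)) (excl1F d i j k) \<longleftrightarrow> w \<in> excl_nbh G {e i, e j, e k} {e i}"
  using assms by (auto simp: excl_nbh_1 excl1F_def V)

lemma holds_excl2F:
  assumes "i < d" "j < d" "k < d" "w < n" "e i \<noteq> e k" "e j \<noteq> e k"
  shows "holds d' (e(d := w)) (excl2F d i j k) \<longleftrightarrow> w \<in> excl_nbh G {e i, e k, e j} {e i, e j}"
  using assms by (auto simp: excl_nbh_2 excl2F_def V)

lemma excl_nbh_bound: "w \<in> excl_nbh G S T \<Longrightarrow> w < n"
  by (simp add: excl_nbh_def V)

lemma holds_excl_CDF:
  assumes "i < d" "j < d" "k < d" "e i < n" "e i \<noteq> e j" "e i \<noteq> e k"
  shows "holds d e (excl_CDF d i j k) \<longleftrightarrow> (\<forall>w\<in>excl_nbh G {e i, e j, e k} {e i}. nmat G w (e i) = CD)"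
proof -
  have "holds (Suc d) (e(d := w)) (nmatF CD (Suc d) d i) \<longleftrightarrow> nmat G w (e i) = CD" if "w < n" for w
    using holds_nmatF[of d "Suc d" i "e(d := w)" CD] assms that by simp
  then have "holds d e (excl_CDF d i j k) \<longleftrightarrow>
      (\<forall>w<n. w \<in> excl_nbh G {e i, e j, e k} {e i} \<longrightarrow> nmat G w (e i) = CD)"
    unfolding excl_CDF_def sat_allF sat_impF using holds_excl1F[OF assms(1-3) _ assms(5,6)] by simp
  then show ?thesis using excl_nbh_bound by blast
qed

text \<open>The formulas for exclusive neighbours are faithful only for distinct vertices, hence the
  case distinction: without an ov-triangle both sides are false.\<close>

lemma holds_DeltaF:
  assumes "i < d" "j < d" "k < d" "e i < n" "e j < n" "e k < n"
  shows "holds d e (DeltaF d i j k) \<longleftrightarrow> {e i, e j, e k} \<in> Delta G"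
proof (cases "ov_triangle G {e i, e j, e k}")
  case True
  then have ne: "e i \<noteq> e j" "e i \<noteq> e k" "e j \<noteq> e k" by (simp_all add: ov_triangle3)
  have "holds d e (allF (disjF (cnbhF d i) (disjF (cnbhF d j) (cnbhF d k)))) \<longleftrightarrow>
      {0..<n} \<subseteq> cnbh G (e i) \<union> cnbh G (e j) \<union> cnbh G (e k)"
    using assms by (auto simp: holds_cnbhF)
  moreover have "cnbh G (e i) \<union> cnbh G (e j) \<union> cnbh G (e k) \<subseteq> {0..<n}"
    using cnbh_bound[OF assms(4)] cnbh_bound[OF assms(5)] cnbh_bound[OF assms(6)] by auto
  ultimately have "holds d e (allF (disjF (cnbhF d i) (disjF (cnbhF d j) (cnbhF d k)))) \<longleftrightarrow>
      cnbh G (e i) \<union> cnbh G (e j) \<union> cnbh G (e k) = verts G" using V by auto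
  then show ?thesis
    unfolding Delta_3 DeltaF_def sat.simps(4) holds_ov_triangleF[OF assms]
    using assms ne holds_excl_CDF[of i d j k e] holds_excl_CDF[of j d i k e] holds_excl_CDF[of k d i j e]
    by auto
next
  case False
  then show ?thesis unfolding Delta_3 DeltaF_def sat.simps(4) holds_ov_triangleF[OF assms] by simp
qed

lemma holds_in_betweenF:
  assumes "a < d" "b < d" "c < d" "e a < n" "e b < n" "e c < n"
  shows "holds d e (in_betweenF d b a c) \<longleftrightarrow> in_between G (e b) (e a) (e c)"
proof (cases "ov_triangle G {e a, e b, e c}")
  case True
  then have ne: "e a \<noteq> e b" "e a \<noteq> e c" "e b \<noteq> e c" by (simp_all add: ov_triangle3)
  have cab: "{e c, e a, e b} = {e a, e b, e c}" by auto
  have 1: "holds d e (ExF (excl1F d a b c)) \<longleftrightarrow> excl_nbh G {e a, e b, e c} {e a} \<noteq> {}"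
  proof -
    have "holds d e (ExF (excl1F d a b c)) \<longleftrightarrow> (\<exists>w<n. w \<in> excl_nbh G {e a, e b, e c} {e a})"
      using holds_excl1F[of a d b c _ e "Suc d"] assms ne by (simp cong: conj_cong)
    then show ?thesis using excl_nbh_bound[of _ "{e a, e b, e c}" "{e a}"] by blast
  qed
  have 2: "holds d e (ExF (excl1F d c a b)) \<longleftrightarrow> excl_nbh G {e a, e b, e c} {e c} \<noteq> {}"
  proof -
    have "holds d e (ExF (excl1F d c a b)) \<longleftrightarrow> (\<exists>w<n. w \<in> excl_nbh G {e a, e b, e c} {e c})"
      using holds_excl1F[of c d a b _ e "Suc d"] assms ne unfolding cab by (simp cong: conj_cong)
    then show ?thesis using excl_nbh_bound[of _ "{e a, e b, e c}" "{e c}"] by blast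
  qed
  have "holds (Suc d) (e(d := z)) (DeltaF (Suc d) a c d) \<longleftrightarrow> {e a, e c, z} \<in> Delta G" if "z < n" for z
    using holds_DeltaF[of a "Suc d" c d "e(d := z)"] assms that by simp
  then have "holds d e (ExF (ConjF (excl2F d a c b) (DeltaF (Suc d) a c d))) \<longleftrightarrow>
      (\<exists>z<n. z \<in> excl_nbh G {e a, e b, e c} {e a, e c} \<and> {e a, e c, z} \<in> Delta G)"
    using holds_excl2F[of a d c b _ e "Suc d"] assms ne by (simp cong: conj_cong)
  then have 3: "holds d e (ExF (ConjF (excl2F d a c b) (DeltaF (Suc d) a c d))) \<longleftrightarrow>
      (\<exists>z\<in>excl_nbh G {e a, e b, e c} {e a, e c}. {e a, e c, z} \<in> Delta G)"
    using excl_nbh_bound[of _ "{e a, e b, e c}" "{e a, e c}"] by blast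
  show ?thesis
    unfolding in_between_def in_betweenF_def sat_disjF sat.simps(3,4) 1 2 3
      holds_ov_triangleF[OF assms] holds_DeltaF[OF assms] by blast
next
  case False
  then show ?thesis
    unfolding in_between_def in_betweenF_def sat.simps(4) holds_ov_triangleF[OF assms] by simp
qed

text \<open>Adjacency is implied, since the matrix entry of a non-adjacent pair is DI.\<close>

lemma nbh_type_OV_iff: "u < n \<Longrightarrow> y < n \<Longrightarrow> y \<in> nbh_type G OV u \<longleftrightarrow> nmat G u y = OV"
  using nmat_DI_iff[of G u y] by (auto simp: nbh_type_def nbh_def V)

lemma holds_memberF:
  assumes "u < d" "x < d" "y < d" "e u < n" "e x < n" "e y < n"
  shows "holds d e (memberF d u x y) \<longleftrightarrow> e y \<in> {e u} \<union> nbh_type G CD (e u) \<union> nbh_type G CC (e u) \<union>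
    {y \<in> nbh_type G OV (e u). same_side G (e u) (e x) y}"
proof -
  have ss: "holds d e (same_sideF d u x y) \<longleftrightarrow> same_side G (e u) (e x) (e y)"
    unfolding same_side_def same_sideF_def sat_disjF sat.simps(1,3,4)
      holds_DeltaF[OF assms(2,3,1,5,6,4)] holds_in_betweenF[OF assms(2,1,3,5,4,6)]
      nbh_type_OV_iff[OF assms(4,5)] nbh_type_OV_iff[OF assms(4,6)]
      holds_nmatF[OF assms(1,2,4,5)] holds_nmatF[OF assms(1,3,4,6)] holds_nmatF[OF assms(2,3,5,6)]
    by blast
  have "nmat G (e u) (e y) = t \<longleftrightarrow> e y \<in> nbh_type G t (e u)" if "t \<noteq> DI" for t
    using that nmat_DI_iff[of G "e u" "e y"] assms by (auto simp: nbh_type_def nbh_def V)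
  then have "nmat G (e u) (e y) = CD \<longleftrightarrow> e y \<in> nbh_type G CD (e u)"
    "nmat G (e u) (e y) = CC \<longleftrightarrow> e y \<in> nbh_type G CC (e u)" by simp_all
  moreover have "same_side G (e u) (e x) (e y) \<longrightarrow> e y \<in> nbh_type G OV (e u)"
    by (simp add: same_side_def)
  ultimately show ?thesis
    unfolding memberF_def sat_disjF sat.simps(1) ss holds_nmatF[OF assms(1,3,4,6)] by blast
qed

end

lemma logspace_computable_f_U: "logspace_computable_family f_U"
proof (rule logspace_computable_definable_family)
  show "wf_fm 4 (nmatF OV 4 2 3)" by (rule wf_nmatF) simp_all
  show "wf_fm 5 (memberF 5 2 3 4)" by (rule wf_memberF) simp_all
  fix G :: "nat graph" and n assume "admissible G" and V: "verts G = {0..<n}"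
  then have G: "simple_graph G" by (simp add: admissible_def)
  define F where "F u x = {u} \<union> nbh_type G CD u \<union> nbh_type G CC u \<union>
    {y \<in> nbh_type G OV u. same_side G u x y}" for u x
  have F: "F u x = {y. y < n \<and> sat n (adj G) 5 (env3 u x y) (memberF 5 2 3 4)}"
    if "u < n" "x < n" for u x
  proof -
    have "y \<in> F u x \<longleftrightarrow> sat n (adj G) 5 (env3 u x y) (memberF 5 2 3 4)" if "y < n" for y
      using holds_memberF[OF G V, of 2 5 3 4 "env3 u x y"] that \<open>u < n\<close> \<open>x < n\<close>
      by (simp add: env3_def F_def)
    moreover have "y < n" if "y \<in> F u x" for y
      using that \<open>u < n\<close> V by (auto simp: F_def nbh_type_def nbh_def)
    ultimately show ?thesis by blast
  qed
  have g: "x \<in> nbh_type G OV u \<longleftrightarrow> sat n (adj G) 4 (env3 u x 0) (nmatF OV 4 2 3)"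
    if "u < n" "x < n" for u x
    using holds_nmatF[OF G V, of 2 4 3 "env3 u x 0" OV] nbh_type_OV_iff[OF G V that] that
    by (simp add: env3_def del: nmatF.simps)
  have bound: "x < n" if "x \<in> nbh_type G OV u" for u x
    using that V by (auto simp: nbh_type_def nbh_def)
  have "f_U G = {F u x | u x. u \<in> verts G \<and> x \<in> nbh_type G OV u}"
    unfolding f_U_def F_def by blast
  also have "\<dots> = {F u x | u x. u < n \<and> x < n \<and> x \<in> nbh_type G OV u}"
    using bound V by (intro Collect_cong) auto
  also have "\<dots> = {{y. y < n \<and> sat n (adj G) 5 (env3 u x y) (memberF 5 2 3 4)} | u x.
      u < n \<and> x < n \<and> sat n (adj G) 4 (env3 u x 0) (nmatF OV 4 2 3)}"
    using F g by (intro Collect_cong) (metis (no_types, lifting))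
  finally show "f_U G = {{y. y < n \<and> sat n (adj G) 5 (env3 u x y) (memberF 5 2 3 4)} | u x.
      u < n \<and> x < n \<and> sat n (adj G) 4 (env3 u x 0) (nmatF OV 4 2 3)}" .
qed

theorem theorem16:
  shows "candidate_function (f_U :: 'a graph \<Rightarrow> 'a set set)
           {G. uniform_ca_graph G \<and> (\<exists>u \<in> verts G. nbh_type G OV u \<noteq> {})}
         \<and> logspace_computable_family f_U"
  using candidate_function_f_U logspace_computable_f_U by blast

end
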